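(* Let $\alpha\in(0,2)$ and $\zeta\in[0,1)$. Let $X_t=\sqrt{\varepsilon_t}\,G_t$ for $t\in\mathbf Z$, where the series $\{\varepsilon_t\}$ and $\{G_t\}$ are independent, the $\varepsilon_t$ are positive and i.i.d. with distribution in $D(\alpha/2)$, and $\{G_t\}$ is a stationary Gaussian series with mean zero and autocovariance $R(k)=\mathrm{Cov}(G_0,G_k)$ satisfying $$\sum_{|h|<n}R(h)\sim Cn^{\zeta}\quad\text{and}\quad\sum_{|h|<n}|R(h)|=O(n^{\zeta})\qquad\text{as }n\to\infty$$ for some constant $C>0$. Suppose that $\varepsilon_t$ is absolutely continuous with a probability density $f_\varepsilon$ that is bounded and ultimately monotone, that is, $f_\varepsilon$ is monotone on $(z,\infty)$ for some $z>0$ and is monotone on $(-\infty,u)$ for some $u<0$. Then $$a_n^{-2}\sum_{t=1}^nX_t^2\ \text{converges in law to } W\quad\text{as } n\to\infty,$$ where $a_n=n^{1/\alpha}K(n)$ for some slowly varying function $K(n)$, and $W$ is $\alpha/2$-stable with scale $C_{\alpha/2}^{-2/\alpha}\bigl(E|G_t|^{\alpha}\bigr)^{2/\alpha}$, skewness $1$ and location zero, where the constants $C_p$ are defined by $C_p^{-1}=\Gamma(2-p)\cos(\pi p/2)/(1-p)$.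
   Context: $D(\beta)$ denotes the domain of attraction of a $\beta$-stable law. A $p$-stable law ($p\in(0,1)$) with scale $\sigma$, skewness $\beta$ and location $\mu$ has characteristic function $\theta\mapsto\exp\{-\sigma^p|\theta|^p(1-i\beta\,\mathrm{sign}(\theta)\tan(\pi p/2))+i\mu\theta\}$. *)

theory Defs
  imports "HOL-Probability.Probability" "HOL-Library.Landau_Symbols"
begin

text \<open>
  Stable laws of index \<open>p \<in> (0,1)\<close> with scale \<open>\<sigma>\<close>, skewness \<open>\<beta>\<close> and location \<open>\<mu>\<close>.
  Only non-degenerate laws (\<open>\<sigma> > 0\<close>) count as stable here.
\<close>

definition stable_char :: "real \<Rightarrow> real \<Rightarrow> real \<Rightarrow> real \<Rightarrow> real \<Rightarrow> complex" where
  "stable_char p \<sigma> \<beta> \<mu> \<theta> =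
     exp (- complex_of_real (\<sigma> powr p * \<bar>\<theta>\<bar> powr p)
            * (1 - \<i> * complex_of_real (\<beta> * sgn \<theta> * tan (pi * p / 2)))
          + \<i> * complex_of_real (\<mu> * \<theta>))"

definition stable_law :: "real \<Rightarrow> real \<Rightarrow> real \<Rightarrow> real \<Rightarrow> real measure \<Rightarrow> bool" where
  "stable_law p \<sigma> \<beta> \<mu> N \<longleftrightarrow>
     0 < p \<and> p < 1 \<and> 0 < \<sigma> \<and> -1 \<le> \<beta> \<and> \<beta> \<le> 1 \<and>
     real_distribution N \<and> char N = stable_char p \<sigma> \<beta> \<mu>"

text \<open>
  \<open>D(p)\<close>: for i.i.d. variables with law \<open>N\<close> (realised as the coordinates of a product space),
  the partial sums \<open>S n\<close>, suitably centred and normalised, converge in law to a \<open>p\<close>-stable law.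
\<close>

definition in_domain_of_attraction :: "real \<Rightarrow> real measure \<Rightarrow> bool" where
  "in_domain_of_attraction p N \<longleftrightarrow>
     real_distribution N \<and>
     (\<exists>(A :: nat \<Rightarrow> real) (B :: nat \<Rightarrow> real) \<sigma> \<beta> \<mu> N'.
        (\<forall>n. 0 < A n) \<and> stable_law p \<sigma> \<beta> \<mu> N' \<and>
        weak_conv_m
          (\<lambda>n. distr (PiM {..<n} (\<lambda>_. N)) borel (\<lambda>x. ((\<Sum>k<n. x k) - B n) / A n)) N')"

definition stable_const :: "real \<Rightarrow> real" where
  "stable_const p = inverse (Gamma (2 - p) * cos (pi * p / 2) / (1 - p))"

definition slowly_varying :: "(real \<Rightarrow> real) \<Rightarrow> bool" where
  "slowly_varying K \<longleftrightarrow>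
     K \<in> borel_measurable borel \<and> (\<forall>x>0. 0 < K x) \<and>
     (\<forall>c>0. ((\<lambda>x. K (c * x) / K x) \<longlongrightarrow> 1) at_top)"

definition gaussian_law :: "real measure \<Rightarrow> bool" where
  "gaussian_law N \<longleftrightarrow>
     (\<exists>m. N = return borel m) \<or>
     (\<exists>m s. 0 < s \<and> N = density lborel (\<lambda>x. ennreal (normal_density m s x)))"

text \<open>
  All finite-dimensional distributions are (possibly degenerate) multivariate Gaussian, i.e.
  every finite linear combination is Gaussian.
\<close>

definition gaussian_series :: "'a measure \<Rightarrow> (int \<Rightarrow> 'a \<Rightarrow> real) \<Rightarrow> bool" where
  "gaussian_series M G \<longleftrightarrow>
     (\<forall>t. G t \<in> borel_measurable M) \<and>
     (\<forall>I c. finite I \<longrightarrow> gaussian_law (distr M borel (\<lambda>\<omega>. \<Sum>t\<in>I. c t * G t \<omega>)))"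

definition stationary_series :: "'a measure \<Rightarrow> (int \<Rightarrow> 'a \<Rightarrow> real) \<Rightarrow> bool" where
  "stationary_series M G \<longleftrightarrow>
     (\<forall>t. G t \<in> borel_measurable M) \<and>
     (\<forall>h. distr M (PiM UNIV (\<lambda>_. borel)) (\<lambda>\<omega> t. G (t + h) \<omega>)
         = distr M (PiM UNIV (\<lambda>_. borel)) (\<lambda>\<omega> t. G t \<omega>))"

definition covariance :: "'a measure \<Rightarrow> ('a \<Rightarrow> real) \<Rightarrow> ('a \<Rightarrow> real) \<Rightarrow> real" where
  "covariance M X Y =
     integral\<^sup>L M (\<lambda>\<omega>. (X \<omega> - integral\<^sup>L M X) * (Y \<omega> - integral\<^sup>L M Y))"

end

theory Submission
  imports Defs "HOL-Complex_Analysis.Complex_Analysis"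
begin

text \<open>
  Write \<open>h(s) = E(1 - exp (- s \<epsilon>))\<close> and \<open>p = \<alpha> / 2\<close>. Conditionally on \<open>G\<close>, the Laplace transform of
  \<open>a\<^sub>n\<^sup>-\<^sup>2 \<Sum> X\<^sub>t\<^sup>2\<close> at \<open>s\<close> is \<open>\<Prod> (1 - h(s G\<^sub>t\<^sup>2 / a\<^sub>n\<^sup>2))\<close>, which is close to
  \<open>exp (- \<Sum> h(s G\<^sub>t\<^sup>2 / a\<^sub>n\<^sup>2))\<close>. Since \<open>h\<close> varies regularly with index \<open>p\<close> at zero, the mean of the
  exponent converges to a multiple of \<open>s\<^sup>p E|G|\<^sup>\<alpha>\<close> when \<open>n h(1 / a\<^sub>n\<^sup>2)\<close> converges. The exponent concentrates:
  \<open>h(x\<^sup>2)\<close> is a mixture of the functions \<open>1 - cos (u x)\<close>, whose covariances along a Gaussian series are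
  explicit and bounded by the correlations.

  Regular variation of \<open>h\<close> is extracted from the domain of attraction by symmetrizing, which removes the
  centring: \<open>n (1 - |\<psi>(\<theta> / A\<^sub>n)|\<^sup>2)\<close> converges to a multiple of \<open>|\<theta>|\<^sup>p\<close>. Averaging over a normal
  \<open>\<theta>\<close> gives a monotone function of the scale, hence regular variation; Gaussian subordination and Potter's
  bound (this is where \<open>p < 1\<close> enters) turn it into a statement on the Laplace transform of the
  symmetrized law, and the smaller of two independent copies of \<open>\<epsilon>\<close> is negligible.

  A limit of Laplace transforms of the form \<open>exp (- m s\<^sup>p)\<close> determines a stable law by tightness and
  analytic continuation to the imaginary axis.
\<close>

section \<open>Laplace transforms and one-sided stable laws\<close>

text \<open>The domain of attraction is given only through convergence of normed sums, with no
  direct access to the tail of \<epsilon> or to the growth of the norming sequence \<open>A\<close>.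
  All information on h is therefore drawn from characteristic functions, and \<open>A\<close> is
  discarded once h is known to vary regularly. Since the slowly varying factor has to be a function
  of a real argument, a_n is built afresh from a monotone real inverse of h.

  The growth of the sums of |R(h)| decides the concentration: the fluctuation of the exponent,
  relative to its mean, is at most of the order of the root of (1 / n) times the sum of |R(h)| over
  |h| < n, that is n^((\<zeta> - 1) / 2), and vanishes for \<zeta> < 1. This requires covariance
  bounds that are linear in the correlation and quadratic in the mean of a summand.

  The level n h(1 / a_n^2) -> Gamma(1 - p) makes the constants match: the inverse of C_p is Gamma(1
  - p) cos(\<pi> p / 2), and a Laplace exponent m s^p belongs to the scale (m cos(\<pi> p / 2))^(1 /
  p).\<close>

lemma norm_exp_minus_diff_le:
  fixes z w :: complex and x r :: real
  assumes "0 \<le> x" "r \<le> Re z" "r \<le> Re w"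
  shows "norm (exp (- (z * x)) - exp (- (w * x))) \<le> x * exp (- (r * x)) * norm (z - w)"
proof -
  have "norm (exp (- (z * x)) - exp (- (w * x))) \<le> exp (- (r * x)) * norm (- (z * x) - - (w * x))"
  proof (rule field_differentiable_bound[where S="{u. Re u \<le> - (r * x)}" and f'=exp])
    show "convex {u. Re u \<le> - (r * x)}"
      by (rule convex_halfspace_Re_le)
  qed (use assms in \<open>auto intro!: derivative_eq_intros mult_right_mono\<close>)
  also have "norm (- (z * x) - - (w * x)) = x * norm (z - w)"
    using assms(1) by (simp add: norm_minus_commute norm_mult flip: left_diff_distrib)
  finally show ?thesis by (simp add: mult_ac)
qed

text \<open>Differentiation under the integral along an arbitrary sequence tending to
  \<open>z\<close>: the difference quotients are dominated by a constant, because x exp(- r x) is at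
  most 1 / r for x \<ge> 0.\<close>

lemma holomorphic_laplace:
  assumes W: "real_distribution W" and nonneg: "AE x in W. 0 \<le> x"
  shows "(\<lambda>z. LINT x|W. exp (- (z * complex_of_real x))) holomorphic_on {z. 0 < Re z}"
proof -
  interpret real_distribution W by fact
  let ?L = "\<lambda>z. LINT x|W. exp (- (z * complex_of_real x))"
  have int: "integrable W (\<lambda>x. exp (- (z * complex_of_real x)))" if "0 \<le> Re z" for z
    by (rule integrable_const_bound[where B=1]) (use nonneg that in \<open>auto\<close>)
  have "(?L has_field_derivative (LINT x|W. - (complex_of_real x * exp (- (z * complex_of_real x))))) (at z)"
    if z: "0 < Re z" for z
    unfolding has_field_derivative_iff tendsto_at_iff_sequentially comp_def
  proof safe
    fix X assume X: "\<forall>i. X i \<in> UNIV - {z}" "X \<longlonglongrightarrow> z"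
    \<comment> \<open>Half of the real part: a sequence converging to \<open>z\<close> eventually
      stays where the real part exceeds \<open>r\<close>, and there the exponential decay in
      \<open>x\<close> is uniform.\<close>
    define r where "r = Re z / 2"
    have r: "0 < r" using z by (simp add: r_def)
    have "(\<lambda>n. Re (X n)) \<longlonglongrightarrow> Re z" by (intro tendsto_intros X)
    from order_tendstoD(1)[OF this, of r] obtain n0 where n0: "\<And>n. n \<ge> n0 \<Longrightarrow> r < Re (X n)"
      using z by (auto simp: r_def eventually_sequentially)
    have "(\<lambda>n. LINT x|W. (exp (- (X (n + n0) * complex_of_real x)) - exp (- (z * complex_of_real x))) / (X (n + n0) - z))
       \<longlonglongrightarrow> (LINT x|W. - (complex_of_real x * exp (- (z * complex_of_real x))))"
    proof (rule integral_dominated_convergence[where w="\<lambda>_. 1 / r"])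
      show "AE x in W. (\<lambda>n. (exp (- (X (n + n0) * complex_of_real x)) - exp (- (z * complex_of_real x))) / (X (n + n0) - z))
         \<longlonglongrightarrow> - (complex_of_real x * exp (- (z * complex_of_real x)))"
      proof (rule AE_I2)
        fix x :: real
        have "((\<lambda>z. exp (- (z * complex_of_real x))) has_field_derivative
            - (complex_of_real x * exp (- (z * complex_of_real x)))) (at z)"
          by (auto intro!: derivative_eq_intros)
        then have "(\<lambda>n. (exp (- (X n * complex_of_real x)) - exp (- (z * complex_of_real x))) / (X n - z))
         \<longlonglongrightarrow> - (complex_of_real x * exp (- (z * complex_of_real x)))"
          unfolding has_field_derivative_iff tendsto_at_iff_sequentially comp_def using X by auto
        then show "(\<lambda>n. (exp (- (X (n + n0) * complex_of_real x)) - exp (- (z * complex_of_real x))) / (X (n + n0) - z))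
         \<longlonglongrightarrow> - (complex_of_real x * exp (- (z * complex_of_real x)))"
          by (rule LIMSEQ_ignore_initial_segment)
      qed
      show "AE x in W. norm ((exp (- (X (n + n0) * complex_of_real x)) - exp (- (z * complex_of_real x))) / (X (n + n0) - z)) \<le> 1 / r" for n
        using nonneg
      proof eventually_elim
        case (elim x)
        have ne: "X (n + n0) \<noteq> z" using X by auto
        have rx: "1 + r * x \<le> exp (r * x)" by (rule exp_ge_add_one_self)
        have "x * exp (- (r * x)) \<le> 1 / r"
          using order_trans[OF _ rx, of "r * x"] r elim by (simp add: exp_minus field_simps)
        then have le: "x * exp (- (r * x)) * norm (X (n + n0) - z) \<le> 1 / r * norm (X (n + n0) - z)"
          by (intro mult_right_mono) auto
        have "norm (exp (- (X (n + n0) * complex_of_real x)) - exp (- (z * complex_of_real x)))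
          \<le> x * exp (- (r * x)) * norm (X (n + n0) - z)"
          using elim n0[of "n + n0"] r by (intro norm_exp_minus_diff_le) (auto simp: r_def)
        also note le
        finally show ?case using ne
          by (simp add: norm_divide pos_divide_le_eq)
      qed
    qed auto
    moreover have "(LINT x|W. (exp (- (X (n + n0) * complex_of_real x)) - exp (- (z * complex_of_real x))) / (X (n + n0) - z))
      = (?L (X (n + n0)) - ?L z) / (X (n + n0) - z)" for n
      using z r n0[of "n + n0"] by (simp add: int)
    ultimately have "(\<lambda>n. (?L (X (n + n0)) - ?L z) / (X (n + n0) - z))
       \<longlonglongrightarrow> (LINT x|W. - (complex_of_real x * exp (- (z * complex_of_real x))))" by (simp only:)
    then show "(\<lambda>n. (?L (X n) - ?L z) / (X n - z))
       \<longlonglongrightarrow> (LINT x|W. - (complex_of_real x * exp (- (z * complex_of_real x))))"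
      by (rule LIMSEQ_offset)
  qed
  then have "?L field_differentiable (at z)" if "0 < Re z" for z
    using that unfolding field_differentiable_def by blast
  then show ?thesis
    unfolding holomorphic_on_def by (blast intro: field_differentiable_at_within)
qed

text \<open>The imaginary axis bounds the half-plane of holomorphy, so a characteristic function is
  reached as a limit from inside, here through the points 1 / (n + 1) - i \<theta>. Nonnegativity
  keeps the integrands bounded by one.\<close>

lemma char_eq_laplace_limit:
  assumes W: "real_distribution W" and nonneg: "AE x in W. 0 \<le> x"
  shows "(\<lambda>n. LINT x|W. exp (- ((complex_of_real (1 / real (Suc n)) - \<i> * complex_of_real \<theta>) * complex_of_real x)))
    \<longlonglongrightarrow> char W \<theta>"
  unfolding char_def
proof -
  interpret real_distribution W by fact
  show "(\<lambda>n. LINT x|W. exp (- ((complex_of_real (1 / real (Suc n)) - \<i> * complex_of_real \<theta>) * complex_of_real x)))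
    \<longlonglongrightarrow> (LINT x|W. iexp (\<theta> * x))"
  proof (rule integral_dominated_convergence[where w="\<lambda>_. 1"])
  show "integrable W (\<lambda>_. 1::real)" by simp
  show "AE x in W. (\<lambda>n. exp (- ((complex_of_real (1 / real (Suc n)) - \<i> * complex_of_real \<theta>) * complex_of_real x)))
      \<longlonglongrightarrow> iexp (\<theta> * x)"
  proof (rule AE_I2)
    fix x
    have "(\<lambda>n. exp (- ((complex_of_real (1 / real (Suc n)) - \<i> * complex_of_real \<theta>) * complex_of_real x)))
      \<longlonglongrightarrow> exp (- ((complex_of_real 0 - \<i> * complex_of_real \<theta>) * complex_of_real x))"
      by (intro tendsto_intros LIMSEQ_Suc[OF lim_1_over_n])
    then show "(\<lambda>n. exp (- ((complex_of_real (1 / real (Suc n)) - \<i> * complex_of_real \<theta>) * complex_of_real x)))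
      \<longlonglongrightarrow> iexp (\<theta> * x)" by (simp add: mult_ac)
  qed
  qed (use nonneg in auto)
qed

text \<open>Both sides extend holomorphically to the right half-plane and agree on the positive
  axis. On the boundary (- i \<theta>)^p equals |\<theta>|^p cos(\<pi> p / 2) (1 - i sgn(\<theta>)
  tan(\<pi> p / 2)), which is the origin of the skewness one and of the cosine in the scale.\<close>

lemma char_of_stable_laplace:
  assumes W: "real_distribution W" and nonneg: "AE x in W. 0 \<le> x"
    and p: "0 < p" "p < 1" and m: "0 < m"
    and L: "\<And>s. 0 < s \<Longrightarrow> (LINT x|W. exp (- (s * x))) = exp (- (m * s powr p))"
  shows "char W = stable_char p ((m * cos (pi * p / 2)) powr (1 / p)) 1 0"
proof
  fix \<theta>
  interpret real_distribution W by fact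
  let ?H = "{z. 0 < Re z}"
  let ?L = "\<lambda>z. LINT x|W. exp (- (z * complex_of_real x))"
  let ?E = "\<lambda>z. exp (- (complex_of_real m * z powr complex_of_real p))"
  have eq: "?L z = ?E z" if "0 < Re z" for z
  proof -
    have "?L z - ?E z = 0"
    proof (rule analytic_continuation[where f="\<lambda>z. ?L z - ?E z" and S="?H" and U="complex_of_real ` {0<..}" and \<xi>="1"])
      show "(\<lambda>z. ?L z - ?E z) holomorphic_on ?H"
        by (intro holomorphic_on_diff holomorphic_laplace W nonneg holomorphic_intros)
           (auto simp: complex_nonpos_Reals_iff)
      show "open ?H" by (rule open_halfspace_Re_gt)
      show "connected ?H" by (intro convex_connected convex_halfspace_Re_gt)
      show "1 islimpt complex_of_real ` {0<..}"
        unfolding islimpt_sequential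
      proof (intro exI[of _ "\<lambda>n. complex_of_real (1 + 1 / real (Suc n))"] conjI allI)
        have "(\<lambda>n. complex_of_real (1 + 1 / real (Suc n))) \<longlonglongrightarrow> complex_of_real (1 + 0)"
          by (intro tendsto_intros LIMSEQ_Suc[OF lim_1_over_n])
        then show "(\<lambda>n. complex_of_real (1 + 1 / real (Suc n))) \<longlonglongrightarrow> 1" by simp
        show "complex_of_real (1 + 1 / real (Suc n)) \<in> complex_of_real ` {0<..} - {1}" for n
        proof -
          have "complex_of_real (1 + 1 / real (Suc n)) \<in> complex_of_real ` {0<..}"
            by (intro imageI) (auto intro!: add_pos_nonneg)
          moreover have "complex_of_real (1 + 1 / real (Suc n)) \<noteq> 1"
            unfolding of_real_eq_1_iff by simp
          ultimately show ?thesis by simp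
        qed
      qed
      fix z assume "z \<in> complex_of_real ` {0<..}"
      then obtain s where s: "0 < s" "z = complex_of_real s" by auto
      have "?L z = complex_of_real (LINT x|W. exp (- (s * x)))"
        unfolding s integral_complex_of_real[symmetric]
        by (intro Bochner_Integration.integral_cong) (auto simp: exp_of_real[symmetric])
      also have "\<dots> = ?E z"
        using s by (simp add: L powr_of_real flip: exp_of_real)
      finally show "?L z - ?E z = 0" by simp
    qed (use that in auto)
    then show ?thesis by simp
  qed
  have c: "0 < cos (pi * p / 2)"
    using p by (intro cos_gt_zero) (auto simp: field_simps)
  show "char W \<theta> = stable_char p ((m * cos (pi * p / 2)) powr (1 / p)) 1 0 \<theta>"
  proof (cases "\<theta> = 0")
    case True
    then show ?thesis using p by (simp add: char_zero stable_char_def)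
  next
    case False
    have "(\<lambda>n. ?E (complex_of_real (1 / real (Suc n)) - \<i> * complex_of_real \<theta>))
      \<longlonglongrightarrow> ?E (complex_of_real 0 - \<i> * complex_of_real \<theta>)"
      by (intro tendsto_intros LIMSEQ_Suc[OF lim_1_over_n])
         (use False in \<open>auto simp: complex_nonpos_Reals_iff\<close>)
    moreover have "(\<lambda>n. ?E (complex_of_real (1 / real (Suc n)) - \<i> * complex_of_real \<theta>)) \<longlonglongrightarrow> char W \<theta>"
      using char_eq_laplace_limit[OF W nonneg, of \<theta>] by (subst (asm) eq) auto
    ultimately have "char W \<theta> = ?E (complex_of_real 0 - \<i> * complex_of_real \<theta>)"
      by (intro LIMSEQ_unique)
    then have ch: "char W \<theta> = ?E (- \<i> * complex_of_real \<theta>)" by simp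
    \<comment> \<open>Principal branch: the argument of - i \<theta> is - sgn(\<theta>) \<pi> / 2,
      inside the strip on which \<open>Ln\<close> inverts \<open>exp\<close>.\<close>
    have ln: "Ln (- \<i> * complex_of_real \<theta>) = complex_of_real (ln \<bar>\<theta>\<bar>) - \<i> * complex_of_real (sgn \<theta> * pi / 2)"
    proof (rule Ln_unique)
      have "exp (complex_of_real (ln \<bar>\<theta>\<bar>) - \<i> * complex_of_real (sgn \<theta> * pi / 2))
        = exp (complex_of_real (ln \<bar>\<theta>\<bar>)) * cis (- (sgn \<theta> * pi / 2))"
        unfolding cis_conv_exp by (simp flip: exp_add)
      also have "exp (complex_of_real (ln \<bar>\<theta>\<bar>)) = complex_of_real \<bar>\<theta>\<bar>"
        using False by (subst exp_of_real) simp
      also have "cis (- (sgn \<theta> * pi / 2)) = - \<i> * complex_of_real (sgn \<theta>)"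
        using False by (cases "\<theta> > 0") (auto simp: complex_eq_iff sgn_if)
      finally show "exp (complex_of_real (ln \<bar>\<theta>\<bar>) - \<i> * complex_of_real (sgn \<theta> * pi / 2)) = - \<i> * complex_of_real \<theta>"
        using False by (cases "\<theta> > 0") auto
    qed (use False in \<open>auto simp: sgn_if intro: order_trans[of _ 0]\<close>)
    have "(- \<i> * complex_of_real \<theta>) powr complex_of_real p
       = complex_of_real (\<bar>\<theta>\<bar> powr p) * cis (- (sgn \<theta> * (pi * p / 2)))"
    proof -
      have "(- \<i> * complex_of_real \<theta>) powr complex_of_real p = exp (complex_of_real p * Ln (- \<i> * complex_of_real \<theta>))"
        using False by (simp add: powr_def)
      also have "complex_of_real p * Ln (- \<i> * complex_of_real \<theta>)
        = complex_of_real (p * ln \<bar>\<theta>\<bar>) + \<i> * complex_of_real (- (sgn \<theta> * (pi * p / 2)))"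
        unfolding ln by (simp add: algebra_simps)
      also have "exp \<dots> = complex_of_real (exp (p * ln \<bar>\<theta>\<bar>)) * cis (- (sgn \<theta> * (pi * p / 2)))"
        unfolding cis_conv_exp exp_add exp_of_real ..
      finally show ?thesis using False by (simp add: powr_def)
    qed
    also have "cis (- (sgn \<theta> * (pi * p / 2))) = complex_of_real (cos (pi * p / 2)) *
        (1 - \<i> * complex_of_real (sgn \<theta> * tan (pi * p / 2)))"
      using False c by (cases "\<theta> > 0") (auto simp: complex_eq_iff sgn_if tan_def)
    finally have pw: "(- \<i> * complex_of_real \<theta>) powr complex_of_real p = complex_of_real (\<bar>\<theta>\<bar> powr p) *
      (complex_of_real (cos (pi * p / 2)) * (1 - \<i> * complex_of_real (sgn \<theta> * tan (pi * p / 2))))" .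
    have "((m * cos (pi * p / 2)) powr (1 / p)) powr p = m * cos (pi * p / 2)"
      using p m c by (simp add: powr_powr)
    then show ?thesis
      unfolding ch pw stable_char_def by (simp only: of_real_mult mult.assoc mult_1 mult_zero_left of_real_0 mult_zero_right add_0_right mult_minus_left)
         (simp only: mult.left_commute)
  qed
qed

text \<open>The transform near zero controls the tail: 1 - exp(- s x) is at least 1/2 once x \<ge> 1
  / s, and the limit is continuous at zero with value one. A single \<open>s\<close> serves all
  large \<open>n\<close>; the finitely many others are tight one by one.\<close>

lemma tight_of_laplace:
  assumes Y: "\<And>n. real_distribution (Y n)" and nonneg: "\<And>n. AE x in Y n. 0 \<le> x"
    and p: "0 < p" and m: "0 < m"
    and L: "\<And>s. 0 < s \<Longrightarrow> (\<lambda>n. LINT x|Y n. exp (- (s * x))) \<longlonglongrightarrow> exp (- (m * s powr p))"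
  shows "tight Y"
  unfolding tight_def
proof (intro conjI allI impI Y)
  fix \<epsilon> :: real assume \<epsilon>: "0 < \<epsilon>"
  interpret Y: real_distribution "Y n" for n by fact
  \<comment> \<open>The left end is -1 and not 0, since the interval is open on the left and the
    laws may have an atom at zero.\<close>
  have eqc: "measure (Y n) {-1<..M} = cdf (Y n) M" for n M
  proof -
    have "measure (Y n) {-1<..M} = measure (Y n) {..M}"
      using nonneg[of n] by (intro Y.finite_measure_eq_AE) auto
    then show ?thesis by (simp add: cdf_def)
  qed
  have "((\<lambda>s. exp (- (m * s powr p))) \<longlongrightarrow> exp (- (m * 0 powr p))) (at_right 0)"
    by (intro tendsto_intros tendsto_powr') (use p in \<open>auto simp: eventually_at_filter\<close>)
  then have "((\<lambda>s. exp (- (m * s powr p))) \<longlongrightarrow> 1) (at_right 0)" using p by simp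
  from order_tendstoD(1)[OF this, of "1 - \<epsilon> / 4"]
  have "\<forall>\<^sub>F s in at_right 0. 1 - \<epsilon> / 4 < exp (- (m * s powr p))" using \<epsilon> by simp
  then obtain s where s: "0 < s" "1 - \<epsilon> / 4 < exp (- (m * s powr p))"
    using eventually_happens'[OF trivial_limit_at_right_real eventually_conj[OF eventually_at_right_less[of 0]]] by blast
  from order_tendstoD(1)[OF L[OF s(1)] s(2)] obtain n0
    where n0: "\<And>n. n \<ge> n0 \<Longrightarrow> 1 - \<epsilon> / 4 < (LINT x|Y n. exp (- (s * x)))"
    by (auto simp: eventually_sequentially)
  have big: "1 - \<epsilon> < cdf (Y n) M" if n: "n \<ge> n0" and M: "M \<ge> 1 / s" for n M
  proof -
    have int: "integrable (Y n) (\<lambda>x. exp (- (s * x)))"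
      by (rule Y.integrable_const_bound[where B=1]) (use nonneg[of n] s in auto)
    have "1 / 2 * measure (Y n) {M<..} \<le> (LINT x|Y n. 1 - exp (- (s * x)))"
    proof -
      have "1 / 2 * measure (Y n) {M<..} = (LINT x|Y n. 1 / 2 * indicator {M<..} x)" by simp
      also have "\<dots> \<le> (LINT x|Y n. 1 - exp (- (s * x)))"
      proof (rule integral_mono_AE)
        show "AE x in Y n. 1 / 2 * indicator {M<..} x \<le> 1 - exp (- (s * x))"
          using nonneg[of n]
        proof eventually_elim
          case (elim x)
          have "1 / 2 \<le> 1 - exp (- (s * x))" if "M < x"
          proof -
            have "1 \<le> s * x" using mult_left_mono[of "1 / s" x s] that M s by simp
            moreover have "1 + s * x \<le> exp (s * x)" by (rule exp_ge_add_one_self)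
            ultimately have "2 \<le> exp (s * x)" by linarith
            then show ?thesis by (simp add: exp_minus field_simps)
          qed
          then show ?case using elim s by (auto simp: indicator_def)
        qed
      qed (use int in \<open>auto intro!: Y.integrable_const_bound[where B=1] simp: indicator_def\<close>)
      finally show ?thesis .
    qed
    also have "\<dots> = 1 - (LINT x|Y n. exp (- (s * x)))" using int Y.prob_space[of n] by simp
    also have "\<dots> < \<epsilon> / 4" using n0[OF n] by simp
    finally have "measure (Y n) {M<..} < \<epsilon>" using \<epsilon> by simp
    moreover have "measure (Y n) {M<..} = 1 - cdf (Y n) M"
      using Y.prob_compl[of "{..M}" n] by (simp add: cdf_def Compl_eq_Diff_UNIV[symmetric])
    ultimately show ?thesis by simp
  qed
  have "\<forall>\<^sub>F M in at_top. \<forall>n\<in>{..<n0}. 1 - \<epsilon> < cdf (Y n) M"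
    using \<epsilon> by (intro eventually_ball_finite ballI order_tendstoD(1)[OF Y.cdf_lim_at_top_prob]) auto
  moreover have "\<forall>\<^sub>F M in at_top. M \<ge> 1 / s" by (rule eventually_ge_at_top)
  moreover have "\<forall>\<^sub>F M in at_top. M > (-1::real)" by (rule eventually_gt_at_top)
  ultimately have "\<forall>\<^sub>F M in at_top. -1 < M \<and> (\<forall>n. 1 - \<epsilon> < cdf (Y n) M)"
  proof eventually_elim
    case (elim M)
    then show ?case using big[of _ M] by (metis lessThan_iff linorder_not_less)
  qed
  then obtain M where "-1 < M" "\<forall>n. 1 - \<epsilon> < cdf (Y n) M"
    using eventually_happens'[OF trivial_limit_at_top_linorder] by blast
  then show "\<exists>a b. a < b \<and> (\<forall>n. 1 - \<epsilon> < measure (Y n) {a<..b})"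
    by (intro exI[of _ "-1"] exI[of _ M]) (simp add: eqc)
qed

text \<open>The test function is bounded and continuous and vanishes exactly on the nonnegative
  half-line.\<close>

lemma weak_limit_nonneg:
  assumes Y: "\<And>n. real_distribution (Y n)" and nonneg: "\<And>n. AE x in Y n. 0 \<le> x"
    and W: "real_distribution W" and conv: "weak_conv_m Y W"
  shows "AE x in W. 0 \<le> x"
proof -
  interpret W: real_distribution W by fact
  let ?f = "\<lambda>x::real. min 1 (max 0 (- x))"
  have "(\<lambda>n. integral\<^sup>L (Y n) ?f) \<longlonglongrightarrow> integral\<^sup>L W ?f"
    by (rule weak_conv_imp_integral_bdd_continuous_conv[where B=1, OF Y W conv]) (auto intro!: continuous_intros)
  moreover have "integral\<^sup>L (Y n) ?f = 0" for n
  proof -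
    interpret real_distribution "Y n" by fact
    have "integral\<^sup>L (Y n) ?f = integral\<^sup>L (Y n) (\<lambda>_. 0)"
      by (rule integral_cong_AE) (use nonneg[of n] in auto)
    then show ?thesis by simp
  qed
  ultimately have "integral\<^sup>L W ?f = 0" by (simp add: LIMSEQ_const_iff)
  moreover have "integrable W ?f"
    by (rule W.integrable_const_bound[where B=1]) auto
  ultimately have "AE x in W. ?f x = 0"
    by (subst (asm) integral_nonneg_eq_0_iff_AE) auto
  then show ?thesis by eventually_elim (auto simp: min_def max_def split: if_splits)
qed

text \<open>Tightness yields limits along subsequences; each of them has the prescribed transform
  and hence the same characteristic function, so they coincide and the whole sequence
  converges.\<close>

theorem laplace_continuity_stable:
  assumes Y: "\<And>n. real_distribution (Y n)" and nonneg: "\<And>n. AE x in Y n. 0 \<le> x"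
    and p: "0 < p" "p < 1" and m: "0 < m"
    and L: "\<And>s. 0 < s \<Longrightarrow> (\<lambda>n. LINT x|Y n. exp (- (s * x))) \<longlonglongrightarrow> exp (- (m * s powr p))"
  obtains W where "stable_law p ((m * cos (pi * p / 2)) powr (1 / p)) 1 0 W" "weak_conv_m Y W"
proof -
  have c: "0 < cos (pi * p / 2)"
    using p by (intro cos_gt_zero) (auto simp: field_simps)
  have lim: "stable_law p ((m * cos (pi * p / 2)) powr (1 / p)) 1 0 W"
    if s: "strict_mono s" and W: "real_distribution W" "weak_conv_m (Y \<circ> s) W" for s W
  proof -
    interpret W: real_distribution W by fact
    have nn: "AE x in W. 0 \<le> x"
      by (rule weak_limit_nonneg[where Y="Y \<circ> s"]) (simp_all only: comp_def Y nonneg W[unfolded comp_def])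
    have "(LINT x|W. exp (- (u * x))) = exp (- (m * u powr p))" if u: "0 < u" for u
    proof -
      \<comment> \<open>With the absolute value the integrand is bounded and continuous on the whole
        line, as weak convergence requires; it is removed again almost everywhere on both
        sides.\<close>
      have "(\<lambda>n. LINT x|(Y \<circ> s) n. exp (- (u * \<bar>x\<bar>))) \<longlonglongrightarrow> (LINT x|W. exp (- (u * \<bar>x\<bar>)))"
        by (rule weak_conv_imp_integral_bdd_continuous_conv[where B=1, OF _ W])
           (use u in \<open>auto intro!: continuous_intros simp: Y\<close>)
      moreover have "(LINT x|(Y \<circ> s) n. exp (- (u * \<bar>x\<bar>))) = (LINT x|Y (s n). exp (- (u * x)))" for n
      proof -
        interpret real_distribution "Y (s n)" by fact
        have "AE x in Y (s n). exp (- (u * \<bar>x\<bar>)) = exp (- (u * x))"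
          using nonneg[of "s n"] by eventually_elim simp
        then show ?thesis unfolding comp_def by (intro integral_cong_AE) auto
      qed
      moreover have "(LINT x|W. exp (- (u * \<bar>x\<bar>))) = (LINT x|W. exp (- (u * x)))"
      proof (rule integral_cong_AE)
        show "AE x in W. exp (- (u * \<bar>x\<bar>)) = exp (- (u * x))"
          using nn by eventually_elim simp
      qed auto
      ultimately have "(\<lambda>n. LINT x|Y (s n). exp (- (u * x))) \<longlonglongrightarrow> (LINT x|W. exp (- (u * x)))" by simp
      moreover have "(\<lambda>n. LINT x|Y (s n). exp (- (u * x))) \<longlonglongrightarrow> exp (- (m * u powr p))"
        using LIMSEQ_subseq_LIMSEQ[OF L[OF u] s] by (simp add: comp_def)
      ultimately show ?thesis by (rule LIMSEQ_unique)
    qed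
    from char_of_stable_laplace[OF W(1) nn p m this]
    show ?thesis using p m c W by (auto simp: stable_law_def)
  qed
  have tight: "tight Y" by (rule tight_of_laplace[OF Y nonneg p(1) m L])
  from tight_imp_convergent_subsubsequence[OF this strict_mono_id] obtain r W
    where r: "strict_mono r" "real_distribution W" "weak_conv_m (Y \<circ> r) W" by auto
  have stW: "stable_law p ((m * cos (pi * p / 2)) powr (1 / p)) 1 0 W" by (rule lim[OF r])
  have "weak_conv_m Y W"
  proof (rule tight_subseq_weak_converge[OF Y r(2) tight])
    fix s \<nu> assume s: "strict_mono s" "real_distribution \<nu>" "weak_conv_m (Y \<circ> s) \<nu>"
    have "\<nu> = W"
      using lim[OF s] stW by (intro Levy_uniqueness s r) (auto simp: stable_law_def)
    then show "weak_conv_m (Y \<circ> s) W" using s by simp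
  qed
  then show thesis using stW that by blast
qed

section \<open>Regular variation at zero\<close>

lemma one_minus_cos_le: "1 - cos (y::real) \<le> y\<^sup>2 / 2"
proof -
  have "1 - cos y = 2 * (sin (y / 2))\<^sup>2"
    using cos_double_sin[of "y / 2"] by simp
  also have "(sin (y / 2))\<^sup>2 \<le> (y / 2)\<^sup>2"
    using abs_sin_x_le_abs_x[of "y / 2"] unfolding abs_le_square_iff .
  finally show ?thesis by (simp add: power2_eq_square)
qed

text \<open>With z = x^2 / 2, the left side is at most z and at most 2; the smaller of the two is
  below 4 z / (1 + z), and z / (1 + z) is at most 1 - exp(- z).\<close>

lemma one_minus_cos_le_gauss:
  fixes x y :: real
  assumes "\<bar>y\<bar> \<le> \<bar>x\<bar>"
  shows "1 - cos y \<le> 4 * (1 - exp (- (x\<^sup>2 / 2)))"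
proof -
  define z where "z = x\<^sup>2 / 2"
  have z0: "0 \<le> z" by (simp add: z_def)
  have yz: "1 - cos y \<le> z"
    using one_minus_cos_le[of y] assms by (simp add: z_def abs_le_square_iff)
  have "1 + z \<le> exp z" by (rule exp_ge_add_one_self)
  then have "exp (- z) \<le> 1 / (1 + z)"
    using z0 by (simp add: exp_minus field_simps)
  then have 1: "z / (1 + z) \<le> 1 - exp (- z)"
    using z0 by (simp add: field_simps)
  have "1 - cos y \<le> 4 * (z / (1 + z))"
  proof (cases "z \<le> 1")
    case True
    have "z \<le> 4 * (z / (1 + z))"
      using z0 True mult_left_mono[of z 3 z] by (simp add: field_simps)
    then show ?thesis using yz by linarith
  next
    case False
    have "1 - cos y \<le> 2" using cos_ge_minus_one[of y] by linarith
    also have "2 \<le> 4 * (z / (1 + z))" using False by (simp add: field_simps)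
    finally show ?thesis .
  qed
  also have "\<dots> \<le> 4 * (1 - exp (- z))" using 1 by simp
  finally show ?thesis by (simp add: z_def)
qed

lemma abs_sin_mult_le: "\<bar>sin (real k * x)\<bar> \<le> real k * \<bar>sin x\<bar>"
proof (induction k)
  case (Suc k)
  have "\<bar>sin (real (Suc k) * x)\<bar> = \<bar>sin (real k * x) * cos x + cos (real k * x) * sin x\<bar>"
    by (simp add: distrib_right sin_add algebra_simps)
  also have "\<dots> \<le> \<bar>sin (real k * x)\<bar> * \<bar>cos x\<bar> + \<bar>cos (real k * x)\<bar> * \<bar>sin x\<bar>"
    by (metis abs_mult abs_triangle_ineq)
  also have "\<dots> \<le> \<bar>sin (real k * x)\<bar> * 1 + 1 * \<bar>sin x\<bar>"
    by (intro add_mono mult_left_mono mult_right_mono) auto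
  finally show ?case using Suc by (simp add: algebra_simps)
qed simp

text \<open>The quadratic growth in \<open>k\<close> lets a bound near frequency zero spread to all
  frequencies at a price that is integrable against a normal law.\<close>

lemma one_minus_cos_mult_le: "1 - cos (real k * x) \<le> (real k)\<^sup>2 * (1 - cos x)"
proof -
  have c: "1 - cos y = 2 * (sin (y / 2))\<^sup>2" for y :: real
    using cos_double_sin[of "y / 2"] by simp
  have "(sin (real k * (x / 2)))\<^sup>2 \<le> (real k * \<bar>sin (x / 2)\<bar>)\<^sup>2"
    using power_mono[OF abs_sin_mult_le[of k "x / 2"], of 2] by simp
  then show ?thesis unfolding c by (simp add: power_mult_distrib)
qed

definition regularly_varying_0 :: "real \<Rightarrow> (real \<Rightarrow> real) \<Rightarrow> bool" where
  "regularly_varying_0 p F \<longleftrightarrow> (\<forall>c>0. ((\<lambda>s. F (c * s) / F s) \<longlongrightarrow> c powr p) (at_right 0))"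

text \<open>Choosing \<open>n\<close> of the order c / F(s) makes n F(s) and n F(d / A n)
  comparable: their limits are c and c d^p. By monotonicity \<open>s\<close> then lies below d / A n
  for d > 1 and above it for d < 1. So s A n is close to one, and F(l s) is squeezed between values
  along the sequence.\<close>

lemma regularly_varying_0_of_sequence:
  assumes mono: "\<And>s t. 0 < s \<Longrightarrow> s \<le> t \<Longrightarrow> F s \<le> F t"
    and pos: "\<And>s. 0 < s \<Longrightarrow> 0 < F s"
    and zero: "(F \<longlongrightarrow> 0) (at_right 0)"
    and A: "\<And>n. 0 < A n" and c: "0 < c" and p: "0 < p"
    and lim: "\<And>s. 0 < s \<Longrightarrow> (\<lambda>n. real n * F (s / A n)) \<longlonglongrightarrow> c * s powr p"
  shows "regularly_varying_0 p F"
  unfolding regularly_varying_0_def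
proof (intro allI impI)
  fix l :: real assume l: "0 < l"
  \<comment> \<open>Rounding up changes the product \<open>N s * F s\<close> by at most
    \<open>F s\<close>, which tends to zero.\<close>
  define N where "N s = nat \<lceil>c / F s\<rceil>" for s
  have ev0: "\<forall>\<^sub>F s::real in at_right 0. 0 < s" by (rule eventually_at_right_less)
  have NF: "c \<le> N s * F s" "N s * F s \<le> c + F s" if "0 < s" for s
  proof -
    have "c / F s \<le> N s" unfolding N_def by linarith
    then show "c \<le> N s * F s" using pos[OF that] by (simp add: field_simps)
    have "0 \<le> c / F s" using pos[OF that] c by simp
    then have "N s \<le> c / F s + 1" unfolding N_def by linarith
    then have "N s * F s \<le> (c / F s + 1) * F s"
      using pos[OF that] by (intro mult_right_mono) auto
    also have "\<dots> = c + F s" using pos[OF that] by (simp add: distrib_right)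
    finally show "N s * F s \<le> c + F s" .
  qed
  have NFlim: "((\<lambda>s. N s * F s) \<longlongrightarrow> c) (at_right 0)"
  proof (rule tendsto_sandwich[where f="\<lambda>_. c" and h="\<lambda>s. c + F s"])
    show "((\<lambda>s. c + F s) \<longlongrightarrow> c) (at_right 0)"
      using tendsto_add[OF tendsto_const zero, of c] by simp
    show "\<forall>\<^sub>F s in at_right 0. c \<le> N s * F s" using ev0 by eventually_elim (rule NF)
    show "\<forall>\<^sub>F s in at_right 0. N s * F s \<le> c + F s" using ev0 by eventually_elim (rule NF)
  qed simp
  have "filterlim (\<lambda>s. real (N s)) at_top (at_right 0)"
    unfolding filterlim_at_top
  proof
    fix Z :: real
    have "\<forall>\<^sub>F s in at_right 0. F s < c / (\<bar>Z\<bar> + 1)"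
      using c by (intro order_tendstoD(2)[OF zero]) simp
    with ev0 show "\<forall>\<^sub>F s in at_right 0. Z \<le> real (N s)"
    proof eventually_elim
      case (elim s)
      have "\<bar>Z\<bar> + 1 \<le> c / F s" using elim pos[of s] by (simp add: field_simps)
      then show ?case unfolding N_def by linarith
    qed
  qed
  then have Nlim: "filterlim N sequentially (at_right 0)"
    using filterlim_sequentially_iff_filterlim_real by blast
  have limN: "((\<lambda>s. N s * F (t / A (N s))) \<longlongrightarrow> c * t powr p) (at_right 0)" if "0 < t" for t
    using filterlim_compose[OF lim[OF that] Nlim] .
  have ratio: "F (l * s) / F s = (N s * F (l * s)) / (N s * F s)" if "0 < s" for s
  proof -
    have "real (N s) \<noteq> 0" using NF(1)[OF that] c by (metis mult_zero_left not_le)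
    then show ?thesis by simp
  qed
  have qlim: "((\<lambda>s. (N s * F (l * d / A (N s))) / (N s * F s)) \<longlongrightarrow> (l * d) powr p) (at_right 0)"
    if d: "0 < d" for d
    using tendsto_divide[OF limN[of "l * d"] NFlim] l d c by simp
  have contd: "((\<lambda>d. (l * d) powr p) \<longlongrightarrow> (l * 1) powr p) (at 1)"
    using l by (intro tendsto_intros) auto
  show "((\<lambda>s. F (l * s) / F s) \<longlongrightarrow> l powr p) (at_right 0)"
  proof (rule order_tendstoI)
    fix a assume a: "l powr p < a"
    have "\<forall>\<^sub>F d in at_right 1. (l * d) powr p < a"
      using a order_tendstoD(2)[OF contd, of a] by (auto simp: eventually_at_split)
    then obtain d where d: "1 < d" "(l * d) powr p < a"
      using eventually_happens'[OF trivial_limit_at_right_real eventually_conj[OF eventually_at_right_less[of 1]]] by blast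
    have "\<forall>\<^sub>F s in at_right 0. (N s * F (l * d / A (N s))) / (N s * F s) < a"
      using d by (intro order_tendstoD(2)[OF qlim]) auto
    moreover
    have "1 powr p < d powr p" using d p by (intro powr_less_mono2) auto
    then have cd: "c < c * d powr p" using c by simp
    \<comment> \<open>\<open>m\<close> separates the limits c and c d^p, so that their strict order
      holds between the two functions for all small \<open>s\<close>.\<close>
    obtain m where m: "c < m" "m < c * d powr p" using dense[OF cd] by blast
    have "\<forall>\<^sub>F s in at_right 0. N s * F s < m" by (rule order_tendstoD(2)[OF NFlim m(1)])
    moreover have "\<forall>\<^sub>F s in at_right 0. m < N s * F (d / A (N s))"
      using d by (intro order_tendstoD(1)[OF limN m(2)]) auto
    ultimately show "\<forall>\<^sub>F s in at_right 0. F (l * s) / F s < a"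
      using ev0
    proof eventually_elim
      case (elim s)
      have dA: "0 < d / A (N s)" using d A[of "N s"] by simp
      have "N s * F s < N s * F (d / A (N s))" using elim by linarith
      then have "F s < F (d / A (N s))" by (simp add: mult_less_cancel_left)
      then have "s < d / A (N s)" using mono[OF dA, of s] by force
      then have "l * s \<le> l * d / A (N s)" using l by (simp flip: times_divide_eq_right)
      then have "F (l * s) \<le> F (l * d / A (N s))" using l elim by (intro mono) auto
      then have "(N s * F (l * s)) / (N s * F s) \<le> (N s * F (l * d / A (N s))) / (N s * F s)"
        using elim pos[of s] by (intro divide_right_mono mult_left_mono) auto
      then show ?case using ratio[of s] elim by simp
    qed
  next
    fix a assume a: "a < l powr p"
    have "\<forall>\<^sub>F d in at_left 1. a < (l * d) powr p"
      using a order_tendstoD(1)[OF contd, of a] by (auto simp: eventually_at_split)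
    moreover have "\<forall>\<^sub>F d::real in at_left 1. d \<in> {0<..<1}"
      by (rule eventually_at_leftI[of 0]) auto
    ultimately have "\<forall>\<^sub>F d in at_left 1. a < (l * d) powr p \<and> d \<in> {0<..<1}"
      by (rule eventually_conj)
    then have "\<exists>d. a < (l * d) powr p \<and> d \<in> {0<..<1}"
      by (rule eventually_happens'[OF trivial_limit_at_left_real])
    then obtain d where d: "0 < d" "d < 1" "a < (l * d) powr p" by auto
    have "d powr p < 1 powr p" using d p by (intro powr_less_mono2) auto
    then have cd: "c * d powr p < c" using c by simp
    have "\<forall>\<^sub>F s in at_right 0. a < (N s * F (l * d / A (N s))) / (N s * F s)"
      using d by (intro order_tendstoD(1)[OF qlim]) auto
    moreover
    obtain m where m: "m < c" "c * d powr p < m" using dense[OF cd] by blast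
    have "\<forall>\<^sub>F s in at_right 0. m < N s * F s" by (rule order_tendstoD(1)[OF NFlim m(1)])
    moreover have "\<forall>\<^sub>F s in at_right 0. N s * F (d / A (N s)) < m"
      using d by (intro order_tendstoD(2)[OF limN m(2)]) auto
    ultimately show "\<forall>\<^sub>F s in at_right 0. a < F (l * s) / F s"
      using ev0
    proof eventually_elim
      case (elim s)
      have "N s * F (d / A (N s)) < N s * F s" using elim by linarith
      then have "F (d / A (N s)) < F s" by (simp add: mult_less_cancel_left)
      then have "d / A (N s) < s" using mono[of s "d / A (N s)"] elim by force
      then have "l * d / A (N s) \<le> l * s" using l by (simp flip: times_divide_eq_right)
      then have "F (l * d / A (N s)) \<le> F (l * s)" using l d A[of "N s"] by (intro mono) auto
      then have "(N s * F (l * d / A (N s))) / (N s * F s) \<le> (N s * F (l * s)) / (N s * F s)"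
        using elim pos[of s] by (intro divide_right_mono mult_left_mono) auto
      then show ?case using ratio[of s] elim by simp
    qed
  qed
qed

text \<open>Near zero, doubling the argument costs at most the factor 2^q, as q > p. Dyadic
  iteration gives the power law as long as the argument stays small, and beyond that the bound F
  \<le> 1 takes over.\<close>

lemma potter_bound:
  assumes rv: "regularly_varying_0 p F"
    and mono: "\<And>s t. 0 < s \<Longrightarrow> s \<le> t \<Longrightarrow> F s \<le> F t"
    and pos: "\<And>s. 0 < s \<Longrightarrow> 0 < F s"
    and le1: "\<And>s. F s \<le> 1"
    and q: "p < q" "0 < q"
  obtains C s0 where "0 < C" "0 < s0"
    "\<And>l s. 0 < s \<Longrightarrow> s \<le> s0 \<Longrightarrow> 0 < l \<Longrightarrow> F (l * s) \<le> C * (1 + l powr q) * F s"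
proof -
  have "((\<lambda>s. F (2 * s) / F s) \<longlongrightarrow> 2 powr p) (at_right 0)"
    using rv by (auto simp: regularly_varying_0_def)
  from order_tendstoD(2)[OF this, of "2 powr q"]
  have "\<forall>\<^sub>F s in at_right 0. F (2 * s) / F s < 2 powr q" using q by simp
  then obtain b where b: "0 < b" "\<And>s. 0 < s \<Longrightarrow> s < b \<Longrightarrow> F (2 * s) / F s < 2 powr q"
    by (auto simp: eventually_at_right_field)
  \<comment> \<open>Half of \<open>b\<close>, so that doubling is allowed from every point up to and
    including \<open>s0\<close>; a dyadic chain may then end anywhere up to
    \<open>2 * s0\<close>.\<close>
  define s0 where "s0 = b / 2"
  have s0: "0 < s0" using b by (simp add: s0_def)
  have two: "F (2 * s) \<le> 2 powr q * F s" if "0 < s" "s \<le> s0" for s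
    using b(2)[of s] that pos[of s] b(1) by (simp add: s0_def field_simps)
  have pow: "F (2 ^ k * s) \<le> (2 powr q) ^ k * F s" if "0 < s" "2 ^ k * s \<le> 2 * s0" for k s
    using that(2)
  proof (induction k)
    case (Suc k)
    have "2 ^ k * s \<le> s0" using Suc.prems by simp
    moreover have "0 < 2 ^ k * s" using that(1) by simp
    ultimately have "F (2 * (2 ^ k * s)) \<le> 2 powr q * F (2 ^ k * s)" by (intro two)
    also have "F (2 ^ k * s) \<le> (2 powr q) ^ k * F s"
      using Suc.IH \<open>2 ^ k * s \<le> s0\<close> s0 by linarith
    finally show ?case by (simp add: mult_ac)
  qed simp
  have small: "F (l * s) \<le> (2 * l) powr q * F s" if s: "0 < s" and l: "1 \<le> l" and ls: "l * s \<le> s0" for l s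
  proof -
    note that = s l ls
    obtain k where k: "l \<le> 2 ^ k" "2 ^ k < 2 * l"
    proof -
      define k where "k = nat \<lceil>log 2 l\<rceil>"
      have "0 \<le> log 2 l" using l by simp
      then have "log 2 l \<le> k" "k < log 2 l + 1" unfolding k_def by linarith+
      then have "2 powr (log 2 l) \<le> 2 powr real k" "2 powr real k < 2 powr (log 2 l + 1)"
        by simp_all
      then have "l \<le> 2 ^ k" "2 ^ k < 2 * l" using l by (simp_all add: powr_realpow powr_add)
      then show thesis by (rule that)
    qed
    have "2 ^ k * s \<le> 2 * l * s" using k that by (intro mult_right_mono) auto
    then have "2 ^ k * s \<le> 2 * s0" using that by linarith
    then have "F (2 ^ k * s) \<le> (2 powr q) ^ k * F s" using that by (intro pow) auto
    moreover have "F (l * s) \<le> F (2 ^ k * s)"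
      using that k by (intro mono) (auto intro: mult_right_mono)
    moreover have "(2 powr q) ^ k \<le> (2 * l) powr q"
    proof -
      have "(2 powr q) ^ k = (2 ^ k) powr q"
        by (simp add: powr_powr mult.commute flip: powr_realpow)
      also have "\<dots> \<le> (2 * l) powr q" using k q by (intro powr_mono2) auto
      finally show ?thesis .
    qed
    ultimately show ?thesis
      using mult_right_mono[of "(2 powr q) ^ k" "(2 * l) powr q" "F s"] pos[of s] that by linarith
  qed
  \<comment> \<open>Three requirements in one: 1 for l \<le> 1, \<open>2 powr q\<close> for
    arguments up to \<open>s0\<close>, and \<open>2 powr q / F s0\<close> for larger arguments,
    where only F \<le> 1 is used.\<close>
  define C where "C = max 1 (2 powr q * max 1 (1 / F s0))"
  have C: "1 \<le> C" "2 powr q \<le> C" "2 powr q / F s0 \<le> C"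
    using mult_left_mono[of 1 "max 1 (1 / F s0)" "2 powr q"]
      mult_left_mono[of "1 / F s0" "max 1 (1 / F s0)" "2 powr q"]
    unfolding C_def by (simp_all add: le_max_iff_disj)
  show thesis
  proof
    show "0 < C" using C by linarith
    fix l s :: real assume s: "0 < s" "s \<le> s0" and l: "0 < l"
    consider "l \<le> 1" | "1 \<le> l" "l * s \<le> s0" | "1 \<le> l" "s0 < l * s" by linarith
    then show "F (l * s) \<le> C * (1 + l powr q) * F s"
    proof cases
      case 1
      have "F (l * s) \<le> F s" using 1 l s by (intro mono) (auto simp: mult_le_cancel_right1)
      moreover have "1 * 1 \<le> C * (1 + l powr q)" using C by (intro mult_mono) auto
      moreover have "1 * F s \<le> C * (1 + l powr q) * F s"
        using calculation(2) pos[of s] s by (intro mult_right_mono) auto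
      ultimately show ?thesis by linarith
    next
      case 2
      have "F (l * s) \<le> (2 * l) powr q * F s" by (rule small[OF s(1) 2])
      also have "\<dots> \<le> C * (1 + l powr q) * F s"
        using C l pos[of s] s by (intro mult_right_mono) (auto simp: powr_mult intro!: mult_mono)
      finally show ?thesis .
    next
      case 3
      have "F s0 = F ((s0 / s) * s)" using s by simp
      also have "\<dots> \<le> (2 * (s0 / s)) powr q * F s" using s s0 by (intro small) auto
      also have "\<dots> \<le> (2 * l) powr q * F s"
        using s 3 s0 q pos[of s] by (intro mult_right_mono powr_mono2) (auto simp: field_simps)
      finally have "1 \<le> (2 * l) powr q * F s / F s0" using pos[OF s0] by simp
      also have "\<dots> = (2 powr q / F s0) * l powr q * F s" using l by (simp add: powr_mult)
      also have "\<dots> \<le> C * (1 + l powr q) * F s"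
        using C pos[of s] s pos[OF s0] by (intro mult_right_mono mult_mono) auto
      finally show ?thesis using le1[of "l * s"] by linarith
    qed
  qed (rule s0)
qed

section \<open>Gaussian subordination\<close>

abbreviation (input) std_gauss :: "real measure" where
  "std_gauss \<equiv> std_normal_distribution"

lemma AE_std_normal_nonzero: "AE t in std_gauss. t \<noteq> (0::real)"
proof -
  have "AE t in lborel. t \<noteq> (0::real)" by (rule AE_lborel_singleton)
  then show ?thesis by (subst AE_density) (auto elim: eventually_mono)
qed

lemma integrable_std_normal_iff:
  fixes f :: "real \<Rightarrow> real"
  assumes "f \<in> borel_measurable borel"
  shows "integrable std_gauss f \<longleftrightarrow> integrable lborel (\<lambda>t. std_normal_density t * f t)"
  using assms by (subst integrable_density) (auto simp: normal_density_nonneg)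

lemma integral_std_normal_eq:
  fixes f :: "real \<Rightarrow> real"
  assumes "f \<in> borel_measurable borel"
  shows "(LINT t|std_gauss. f t) = (LINT t|lborel. std_normal_density t * f t)"
  using assms by (subst integral_density) (auto simp: normal_density_nonneg)

lemma integral_cos_std_normal: "(LINT t|std_gauss. cos (x * t)) = exp (- (x\<^sup>2 / 2))"
proof -
  interpret real_distribution std_gauss by (rule real_dist_normal_dist)
  have "integrable std_gauss (\<lambda>t. iexp (x * t))" by (rule integrable_iexp) auto
  then have "Re (char std_gauss x) = (LINT t|std_gauss. Re (iexp (x * t)))"
    unfolding char_def by (rule integral_Re[symmetric])
  also have "\<dots> = (LINT t|std_gauss. cos (x * t))" by (simp add: Re_exp)
  finally show ?thesis unfolding char_std_normal_distribution by simp
qed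

text \<open>Completing the square: t^2 + (a / t)^2 = 2 a + (t - a / t)^2.\<close>

lemma std_normal_density_subordination:
  assumes "t \<noteq> (0::real)"
  shows "std_normal_density t * exp (- ((a / t)\<^sup>2 / 2)) = exp (- a) * std_normal_density (t - a / t)"
proof -
  have "- t\<^sup>2 / 2 - (a / t)\<^sup>2 / 2 = - a - (t - a / t)\<^sup>2 / 2"
    using assms by (simp add: power2_eq_square field_simps)
  then have "exp (- t\<^sup>2 / 2) * exp (- ((a / t)\<^sup>2 / 2)) = exp (- a) * exp (- (t - a / t)\<^sup>2 / 2)"
    by (simp flip: exp_add)
  then show ?thesis by (simp add: std_normal_density_def)
qed

text \<open>The Cauchy--Schloemilch trick: both \<open>t \<mapsto> t - a / t\<close> and \<open>t \<mapsto> a / t\<close> are used as substitutions,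
  and the weights \<open>1 + a / t\<^sup>2\<close> and \<open>a / t\<^sup>2\<close> differ by one.\<close>

lemma integral_std_normal_cauchy_schloemilch:
  assumes a: "0 < (a::real)"
  shows "(LINT t:{0<..}|lborel. std_normal_density (t - a / t)) = 1 / 2"
proof -
  let ?S = "{0<..} :: real set"
  let ?w = "\<lambda>t. std_normal_density (t - a / t)"
  have m[measurable]: "?w \<in> borel_measurable borel" by measurable
  have S: "?S \<in> sets lebesgue" by simp
  have sym: "?w (a / t) = ?w t" if "0 < t" for t
  proof -
    have "a / t - a / (a / t) = - (t - a / t)" using that a by simp
    then show ?thesis by (simp add: std_normal_density_def power2_commute)
  qed
  have int_w: "set_integrable lborel ?S ?w"
    unfolding set_integrable_def
  proof (rule Bochner_Integration.integrable_bound[where f="\<lambda>t. exp a * std_normal_density t"])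
    show "AE t in lborel. norm (indicator ?S t *\<^sub>R ?w t) \<le> norm (exp a * std_normal_density t)"
    proof (rule AE_I2)
      fix t :: real
      have "?w t \<le> exp a * std_normal_density t" if "0 < t"
      proof -
        have "?w t = exp a * (std_normal_density t * exp (- ((a / t)\<^sup>2 / 2)))"
          using that std_normal_density_subordination[of t a] by (simp flip: exp_add mult.assoc)
        also have "\<dots> \<le> exp a * (std_normal_density t * 1)"
          by (intro mult_left_mono) (auto simp: normal_density_nonneg)
        finally show ?thesis by simp
      qed
      then show "norm (indicator ?S t *\<^sub>R ?w t) \<le> norm (exp a * std_normal_density t)"
        by (auto simp: indicator_def normal_density_nonneg)
    qed
  qed auto
  have leb_w: "?w absolutely_integrable_on ?S"
    using int_w unfolding set_integrable_def by (subst integrable_completion) auto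
  have J: "(LINT t:?S|lborel. ?w t) = integral ?S ?w"
    by (rule set_borel_integral_eq_integral(2)[OF int_w])
  have phi: "std_normal_density absolutely_integrable_on UNIV \<and> integral UNIV std_normal_density = 1"
  proof
    have i: "set_integrable lborel UNIV std_normal_density" by (simp add: set_integrable_def)
    then show "std_normal_density absolutely_integrable_on UNIV"
      unfolding set_integrable_def by (subst integrable_completion) auto
    show "integral UNIV std_normal_density = 1"
      using set_borel_integral_eq_integral(2)[OF i] by (simp add: set_lebesgue_integral_def)
  qed
  have img1: "(\<lambda>t. t - a / t) ` ?S = UNIV"
  proof -
    have "\<exists>t>0. t - a / t = u" for u :: real
    proof -
      \<comment> \<open>The positive root of t^2 - u t - a = 0.\<close>
      define t where "t = (u + sqrt (u\<^sup>2 + 4 * a)) / 2"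
      have "\<bar>u\<bar> < sqrt (u\<^sup>2 + 4 * a)" using a by (intro real_less_rsqrt) simp
      then have t: "0 < t" by (auto simp: t_def)
      have "2 * t - u = sqrt (u\<^sup>2 + 4 * a)" by (simp add: t_def field_simps)
      then have "(2 * t - u)\<^sup>2 = u\<^sup>2 + 4 * a" using a by simp
      moreover have "(2 * t - u)\<^sup>2 = 4 * (t * t) - 4 * (u * t) + u\<^sup>2"
        by (simp add: power2_eq_square algebra_simps)
      ultimately have "a = (t - u) * t" by (simp add: left_diff_distrib)
      then have "t - a / t = u" using t by simp
      then show ?thesis using t by blast
    qed
    then have "u \<in> (\<lambda>t. t - a / t) ` ?S" for u :: real
      unfolding image_iff by (metis greaterThan_iff)
    then show ?thesis by blast
  qed
  have inj1: "inj_on (\<lambda>t. t - a / t) ?S"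
  proof (rule strict_mono_on_imp_inj_on, rule strict_mono_onI)
    fix r s :: real assume "r \<in> ?S" "s \<in> ?S" "r < s"
    then have "a / s < a / r" using a by (intro divide_strict_left_mono) auto
    then show "r - a / r < s - a / s" using \<open>r < s\<close> by linarith
  qed
  have der1: "((\<lambda>t. t - a / t) has_field_derivative 1 + a / t\<^sup>2) (at t within ?S)" if "t \<in> ?S" for t
    using that by (auto intro!: derivative_eq_intros simp: power2_eq_square)
  have 1: "(\<lambda>t. \<bar>1 + a / t\<^sup>2\<bar> * ?w t) absolutely_integrable_on ?S \<and>
      integral ?S (\<lambda>t. \<bar>1 + a / t\<^sup>2\<bar> * ?w t) = 1"
    by (rule iffD2[OF has_absolute_integral_change_of_variables_1'[OF S der1 inj1]]) (simp_all only: img1 phi simp_thms)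
  have img2: "(\<lambda>t. a / t) ` ?S = ?S"
  proof (rule set_eqI)
    fix u :: real
    have "u = a / (a / u)" using a by simp
    then have "\<exists>t>0. u = a / t" if "0 < u" using that a by (intro exI[of _ "a / u"]) auto
    moreover have "0 < u" if "\<exists>t>0. u = a / t" using that a by auto
    ultimately show "u \<in> (\<lambda>t. a / t) ` ?S \<longleftrightarrow> u \<in> ?S"
      unfolding image_iff by (metis greaterThan_iff)
  qed
  have inj2: "inj_on (\<lambda>t. a / t) ?S" using a by (auto simp: inj_on_def)
  have der2: "((\<lambda>t. a / t) has_field_derivative - a / t\<^sup>2) (at t within ?S)" if "t \<in> ?S" for t
    using that by (auto intro!: derivative_eq_intros simp: power2_eq_square)
  have 2: "(\<lambda>t. \<bar>- a / t\<^sup>2\<bar> * ?w (a / t)) absolutely_integrable_on ?S \<and>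
      integral ?S (\<lambda>t. \<bar>- a / t\<^sup>2\<bar> * ?w (a / t)) = integral ?S ?w"
    by (rule iffD2[OF has_absolute_integral_change_of_variables_1'[OF S der2 inj2]]) (simp_all only: img2 leb_w simp_thms)
  \<comment> \<open>The density is even and a / (a / t) = t, so \<open>?w\<close> is unchanged when
    \<open>t\<close> is replaced by \<open>a / t\<close>. With J the integral sought, the two
    substitutions combine to J = 1 - J.\<close>
  have 3: "integral ?S (\<lambda>t. \<bar>- a / t\<^sup>2\<bar> * ?w (a / t)) = integral ?S (\<lambda>t. \<bar>1 + a / t\<^sup>2\<bar> * ?w t - ?w t)"
  proof (rule integral_cong)
    fix t :: real assume t: "t \<in> ?S"
    then have "\<bar>- a / t\<^sup>2\<bar> = a / t\<^sup>2" "\<bar>1 + a / t\<^sup>2\<bar> = 1 + a / t\<^sup>2" using a by auto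
    moreover have "?w (a / t) = ?w t" using t sym by simp
    ultimately show "\<bar>- a / t\<^sup>2\<bar> * ?w (a / t) = \<bar>1 + a / t\<^sup>2\<bar> * ?w t - ?w t"
      by (simp only: distrib_right)
  qed
  also have "\<dots> = integral ?S (\<lambda>t. \<bar>1 + a / t\<^sup>2\<bar> * ?w t) - integral ?S ?w"
    using 1 leb_w by (intro Henstock_Kurzweil_Integration.integral_diff) (auto dest: set_lebesgue_integral_eq_integral(1))
  finally have "integral ?S ?w = 1 - integral ?S ?w" using 1 2 by linarith
  then show ?thesis unfolding J by linarith
qed

text \<open>With T standard normal, 1 / T^2 has the Levy distribution, the one-sided stable law of
  index 1/2, and this is its Laplace transform at x^2 / 2. It writes a Laplace kernel as a mixture
  of Gaussian kernels at the random scale 1 / T.\<close>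

theorem laplace_subordination:
  "(LINT t|std_gauss. exp (- ((x / t)\<^sup>2 / 2))) = exp (- \<bar>x\<bar>)"
proof (cases "x = 0")
  case True
  interpret real_distribution std_gauss by (rule real_dist_normal_dist)
  show ?thesis using True prob_space by simp
next
  case False
  define a where "a = \<bar>x\<bar>"
  have a: "0 < a" using False by (simp add: a_def)
  let ?f = "\<lambda>t. std_normal_density t * exp (- ((a / t)\<^sup>2 / 2))"
  have [measurable]: "?f \<in> borel_measurable borel" by measurable
  have int: "integrable lborel ?f"
    by (rule Bochner_Integration.integrable_bound[where f=std_normal_density])
       (auto simp: normal_density_nonneg intro!: AE_I2 mult_left_le)
  have ind: "integrable lborel (\<lambda>t. indicator A t * ?f t)" if "A \<in> sets borel" for A
    by (rule Bochner_Integration.integrable_bound[OF int]) (use that in \<open>auto simp: indicator_def\<close>)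
  have "(x / t)\<^sup>2 = (a / t)\<^sup>2" for t by (simp add: a_def power_divide)
  then have "(LINT t|std_gauss. exp (- ((x / t)\<^sup>2 / 2))) = (LINT t|lborel. ?f t)"
    by (subst integral_std_normal_eq) auto
  also have "\<dots> = (LINT t|lborel. indicator {0<..} t * ?f t + indicator {..<0} t * ?f t)"
  proof (rule integral_cong_AE)
    show "AE t in lborel. ?f t = indicator {0<..} t * ?f t + indicator {..<0} t * ?f t"
      using AE_lborel_singleton[of "0::real"]
      by eventually_elim (auto simp: indicator_def)
  qed auto
  also have "\<dots> = (LINT t|lborel. indicator {0<..} t * ?f t) + (LINT t|lborel. indicator {..<0} t * ?f t)"
    by (rule Bochner_Integration.integral_add) (auto intro: ind)
  also have "(LINT t|lborel. indicator {..<0} t * ?f t) = (LINT t|lborel. indicator {0<..} t * ?f t)"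
    by (subst lborel_integral_real_affine[where c="-1" and t=0])
       (auto simp: indicator_def std_normal_density_def intro!: Bochner_Integration.integral_cong)
  also have "(LINT t|lborel. indicator {0<..} t * ?f t)
     = exp (- a) * (LINT t:{0<..}|lborel. std_normal_density (t - a / t))"
    unfolding set_lebesgue_integral_def
    by (subst integral_mult_right_zero[symmetric], rule Bochner_Integration.integral_cong)
       (auto simp: indicator_def std_normal_density_subordination)
  finally show ?thesis
    unfolding integral_std_normal_cauchy_schloemilch[OF a] by (simp add: a_def)
qed

text \<open>Only the singularity at zero matters: there the density is at most one, and |t|^(-q) is
  integrable for q < 1.\<close>

lemma integrable_std_normal_negative_moment:
  assumes q: "0 < q" "q < 1"
  shows "integrable std_gauss (\<lambda>t. \<bar>t\<bar> powr - q)"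
proof -
  let ?g = "\<lambda>t::real. indicator {0<..1} t * t powr - q"
  have "(\<lambda>t. t powr - q) integrable_on {0<..1}"
    using q by (intro integrable_on_powr_from_0') auto
  then have "(\<lambda>t. t powr - q) absolutely_integrable_on {0<..1}"
    by (intro nonnegative_absolutely_integrable_1) auto
  then have g: "integrable lborel ?g"
    unfolding set_integrable_def by (subst (asm) integrable_completion) auto
  have g': "integrable lborel (\<lambda>t. ?g (- t))"
    using lborel_integrable_real_affine[OF g, of "-1" 0] by simp
  have le: "std_normal_density t \<le> 1" for t
  proof -
    have "1 \<le> sqrt (2 * pi)" using pi_gt3 by (simp add: real_le_rsqrt)
    then have "exp (- t\<^sup>2 / 2) / sqrt (2 * pi) \<le> 1 / 1" by (intro frac_le) auto
    then show ?thesis by (simp add: std_normal_density_def)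
  qed
  have "integrable lborel (\<lambda>t. std_normal_density t * \<bar>t\<bar> powr - q)"
  proof (rule Bochner_Integration.integrable_bound[where f="\<lambda>t. ?g t + ?g (- t) + std_normal_density t"])
    show "integrable lborel (\<lambda>t. ?g t + ?g (- t) + std_normal_density t)"
      using g g' by (intro Bochner_Integration.integrable_add) auto
    show "AE t in lborel. norm (std_normal_density t * \<bar>t\<bar> powr - q) \<le> norm (?g t + ?g (- t) + std_normal_density t)"
    proof (rule AE_I2)
      fix t :: real
      have nn: "0 \<le> ?g u" for u by (simp add: indicator_def)
      have "std_normal_density t * \<bar>t\<bar> powr - q \<le> ?g t + ?g (- t) + std_normal_density t"
      proof (cases "\<bar>t\<bar> \<le> 1")
        case True
        have "std_normal_density t * \<bar>t\<bar> powr - q \<le> 1 * \<bar>t\<bar> powr - q"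
          by (intro mult_right_mono le) auto
        also have "\<dots> = ?g t + ?g (- t)"
          using True by (auto simp: indicator_def abs_if)
        finally show ?thesis using normal_density_nonneg[of 0 1 t] by linarith
      next
        case False
        have "\<bar>t\<bar> powr - q \<le> 1" using False q powr_mono[of "-q" 0 "\<bar>t\<bar>"] by (auto split: if_splits)
        then have "std_normal_density t * \<bar>t\<bar> powr - q \<le> std_normal_density t * 1"
          by (intro mult_left_mono) (auto simp: normal_density_nonneg)
        then show ?thesis using nn[of t] nn[of "-t"] by linarith
      qed
      moreover have "0 \<le> ?g t + ?g (- t) + std_normal_density t"
        using nn[of t] nn[of "-t"] normal_density_nonneg[of 0 1 t] by linarith
      ultimately show "norm (std_normal_density t * \<bar>t\<bar> powr - q) \<le> norm (?g t + ?g (- t) + std_normal_density t)"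
        by (simp add: normal_density_nonneg)
    qed
  qed auto
  then show ?thesis by (subst integrable_std_normal_iff) auto
qed

section \<open>Tail functionals of a law\<close>

text \<open>The absolute value lets one functional serve both a law on the positive half-line, where
  it is one minus the Laplace transform, and the symmetrization of that law.\<close>

definition lap_tail :: "real measure \<Rightarrow> real \<Rightarrow> real" where
  "lap_tail N s = (LINT x|N. 1 - exp (- (s * \<bar>x\<bar>)))"

definition gauss_tail :: "real measure \<Rightarrow> real \<Rightarrow> real" where
  "gauss_tail N s = (LINT x|N. 1 - exp (- ((s * x)\<^sup>2 / 2)))"

lemma regularly_varying_0_asymp:
  assumes rv: "regularly_varying_0 p F" and pos: "\<And>s. 0 < s \<Longrightarrow> 0 < F s"
    and lim: "((\<lambda>s. H s / F s) \<longlongrightarrow> K) (at_right 0)" and K: "K \<noteq> 0"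
  shows "regularly_varying_0 p H"
  unfolding regularly_varying_0_def
proof (intro allI impI)
  fix c :: real assume c: "0 < c"
  have fl: "filterlim (\<lambda>s. c * s) (at_right 0) (at_right 0)"
    by (rule filterlim_times_pos[OF filterlim_ident c]) simp
  have "((\<lambda>s. (H (c * s) / F (c * s)) * (F (c * s) / F s) / (H s / F s)) \<longlongrightarrow> K * c powr p / K) (at_right 0)"
    using rv c by (intro tendsto_intros lim K filterlim_compose[OF lim fl]) (auto simp: regularly_varying_0_def)
  then have "((\<lambda>s. (H (c * s) / F (c * s)) * (F (c * s) / F s) / (H s / F s)) \<longlongrightarrow> c powr p) (at_right 0)"
    using K by simp
  moreover have "\<forall>\<^sub>F s in at_right 0. (H (c * s) / F (c * s)) * (F (c * s) / F s) / (H s / F s) = H (c * s) / H s"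
    using eventually_at_right_less[of 0]
  proof eventually_elim
    case (elim s)
    then show ?case using pos[of s] pos[of "c * s"] c by simp
  qed
  ultimately show "((\<lambda>s. H (c * s) / H s) \<longlongrightarrow> c powr p) (at_right 0)"
    by (rule Lim_transform_eventually)
qed

context real_distribution
begin

lemma integrable_lap: "0 \<le> s \<Longrightarrow> integrable M (\<lambda>x. 1 - exp (- (s * \<bar>x\<bar>)))"
  by (rule integrable_const_bound[where B=1]) auto

lemma integrable_gauss: "integrable M (\<lambda>x. 1 - exp (- ((s * x)\<^sup>2 / 2)))"
  by (rule integrable_const_bound[where B=1]) auto

lemma lap_tail_nonneg: "0 \<le> s \<Longrightarrow> 0 \<le> lap_tail M s"
  unfolding lap_tail_def by (rule Bochner_Integration.integral_nonneg) auto

lemma lap_tail_le_1: "0 \<le> s \<Longrightarrow> lap_tail M s \<le> 1"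
  unfolding lap_tail_def
  using integral_mono[OF integrable_lap, of s "\<lambda>_. 1"] prob_space by simp

lemma lap_tail_zero [simp]: "lap_tail M 0 = 0"
  by (simp add: lap_tail_def)

lemma gauss_tail_le_1: "gauss_tail M s \<le> 1"
  unfolding gauss_tail_def
  using integral_mono[OF integrable_gauss, of "\<lambda>_. 1" s] prob_space by simp

lemma lap_tail_mono: "0 \<le> s \<Longrightarrow> s \<le> t \<Longrightarrow> lap_tail M s \<le> lap_tail M t"
  unfolding lap_tail_def by (intro integral_mono integrable_lap) (auto intro: mult_right_mono)

lemma gauss_tail_mono: "0 < s \<Longrightarrow> s \<le> t \<Longrightarrow> gauss_tail M s \<le> gauss_tail M t"
  unfolding gauss_tail_def power_mult_distrib
  by (intro integral_mono integrable_gauss[unfolded power_mult_distrib])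
     (auto intro!: mult_right_mono power_mono)

text \<open>The function 1 - exp(- y) is increasing, concave and zero at the origin, so stretching
  the argument by c \<ge> 1 costs at most the factor c. With c proportional to the square of a
  Gaussian variable this becomes an integrable majorant.\<close>

lemma lap_tail_mult_le:
  assumes "0 \<le> s" "0 \<le> c"
  shows "lap_tail M (c * s) \<le> max 1 c * lap_tail M s"
proof -
  have pw: "1 - exp (- (c * s * \<bar>x\<bar>)) \<le> max 1 c * (1 - exp (- (s * \<bar>x\<bar>)))" for x
  proof -
    define y where "y = s * \<bar>x\<bar>"
    have y: "0 \<le> y" using assms by (simp add: y_def)
    have "1 - exp (- (c * y)) \<le> max 1 c * (1 - exp (- y))"
    proof (cases "c \<le> 1")
      case True
      then show ?thesis using y assms mult_right_mono[of c 1 y] by simp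
    next
      case False
      \<comment> \<open>Convexity of exp at \<open>- y\<close>, which is the point
        \<open>- (c * y)\<close> taken with weight 1 / c and 0 with the remaining weight.\<close>
      have "exp ((1 - 1 / c) *\<^sub>R 0 + (1 / c) *\<^sub>R (- (c * y))) \<le> (1 - 1 / c) * exp 0 + 1 / c * exp (- (c * y))"
        using False by (intro convex_onD[OF exp_convex]) auto
      then have "exp (- y) \<le> 1 - 1 / c + exp (- (c * y)) / c" using False by simp
      then have "c * exp (- y) \<le> c * (1 - 1 / c + exp (- (c * y)) / c)"
        using False by (intro mult_left_mono) auto
      then show ?thesis using False by (simp add: right_diff_distrib distrib_left)
    qed
    then show ?thesis by (simp add: y_def mult_ac)
  qed
  have "lap_tail M (c * s) \<le> (LINT x|M. max 1 c * (1 - exp (- (s * \<bar>x\<bar>))))"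
    unfolding lap_tail_def using assms pw
    by (intro integral_mono integrable_lap integrable_mult_right) auto
  then show ?thesis by (simp add: lap_tail_def)
qed

lemma integral_pos_of_nonzero:
  fixes f :: "real \<Rightarrow> real"
  assumes f: "integrable M f" "\<And>x. 0 \<le> f x" "\<And>x. f x = 0 \<Longrightarrow> x = 0"
    and nz: "\<not> (AE x in M. x = 0)"
  shows "0 < (LINT x|M. f x)"
proof -
  have "(LINT x|M. f x) \<noteq> 0"
  proof
    assume "(LINT x|M. f x) = 0"
    then have "AE x in M. f x = 0"
      using integral_nonneg_eq_0_iff_AE[OF f(1)] f(2) by auto
    then have "AE x in M. x = 0" by eventually_elim (rule f)
    then show False using nz by simp
  qed
  moreover have "0 \<le> (LINT x|M. f x)" using f by (intro Bochner_Integration.integral_nonneg) auto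
  ultimately show ?thesis by linarith
qed

lemma lap_tail_pos: "\<not> (AE x in M. x = 0) \<Longrightarrow> 0 < s \<Longrightarrow> 0 < lap_tail M s"
  unfolding lap_tail_def by (rule integral_pos_of_nonzero) (auto intro: integrable_lap)

lemma gauss_tail_pos: "\<not> (AE x in M. x = 0) \<Longrightarrow> 0 < s \<Longrightarrow> 0 < gauss_tail M s"
  unfolding gauss_tail_def by (rule integral_pos_of_nonzero) (auto intro: integrable_gauss)

lemma lap_tail_tendsto_0: "(lap_tail M \<longlongrightarrow> 0) (at_right 0)"
  \<comment> \<open>With s = 1 / t the limit at zero becomes one at infinity, to which dominated
    convergence along a real parameter applies.\<close>
  unfolding filterlim_at_right_to_top lap_tail_def
proof -
  have "((\<lambda>t. LINT x|M. 1 - exp (- (inverse t * \<bar>x\<bar>))) \<longlongrightarrow> (LINT x|M. 0)) at_top"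
  proof (rule integral_dominated_convergence_at_top[where w="\<lambda>_. 1"])
    show "\<forall>\<^sub>F t in at_top. AE x in M. norm (1 - exp (- (inverse t * \<bar>x\<bar>))) \<le> 1"
      using eventually_ge_at_top[of 0] by eventually_elim auto
    show "AE x in M. ((\<lambda>t. 1 - exp (- (inverse t * \<bar>x\<bar>))) \<longlongrightarrow> 0) at_top"
    proof (rule AE_I2)
      fix x :: real
      have "((\<lambda>t. 1 - exp (- (inverse t * \<bar>x\<bar>))) \<longlongrightarrow> 1 - exp (- (0 * \<bar>x\<bar>))) at_top"
        by (intro tendsto_intros tendsto_inverse_0_at_top filterlim_ident)
      then show "((\<lambda>t. 1 - exp (- (inverse t * \<bar>x\<bar>))) \<longlongrightarrow> 0) at_top" by simp
    qed
  qed auto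
  then show "((\<lambda>t. LINT x|M. 1 - exp (- (inverse t * \<bar>x\<bar>))) \<longlongrightarrow> 0) at_top" by simp
qed

lemma gauss_tail_tendsto_0: "(gauss_tail M \<longlongrightarrow> 0) (at_right 0)"
  unfolding filterlim_at_right_to_top gauss_tail_def
proof -
  have "((\<lambda>t. LINT x|M. 1 - exp (- ((inverse t * x)\<^sup>2 / 2))) \<longlongrightarrow> (LINT x|M. 0)) at_top"
  proof (rule integral_dominated_convergence_at_top[where w="\<lambda>_. 1"])
    show "AE x in M. ((\<lambda>t. 1 - exp (- ((inverse t * x)\<^sup>2 / 2))) \<longlongrightarrow> 0) at_top"
    proof (rule AE_I2)
      fix x :: real
      have "((\<lambda>t. 1 - exp (- ((inverse t * x)\<^sup>2 / 2))) \<longlongrightarrow> 1 - exp (- ((0 * x)\<^sup>2 / 2))) at_top"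
        by (intro tendsto_intros tendsto_inverse_0_at_top filterlim_ident) auto
      then show "((\<lambda>t. 1 - exp (- ((inverse t * x)\<^sup>2 / 2))) \<longlongrightarrow> 0) at_top" by simp
    qed
  qed auto
  then show "((\<lambda>t. LINT x|M. 1 - exp (- ((inverse t * x)\<^sup>2 / 2))) \<longlongrightarrow> 0) at_top" by simp
qed

lemma Re_char_eq: "Re (char M \<theta>) = (LINT x|M. cos (\<theta> * x))"
proof -
  have "integrable M (\<lambda>x. iexp (\<theta> * x))" by (rule integrable_iexp) auto
  then have "Re (char M \<theta>) = (LINT x|M. Re (iexp (\<theta> * x)))"
    unfolding char_def by (rule integral_Re[symmetric])
  then show ?thesis by (simp add: Re_exp)
qed

lemma integrable_cos: "integrable M (\<lambda>x. cos (\<theta> * x))"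
  by (rule integrable_const_bound[where B=1]) auto

lemma integrable_one_minus_cos: "integrable M (\<lambda>x. 1 - cos (\<theta> * x))"
  using integrable_cos by simp

lemma one_minus_Re_char_eq: "1 - Re (char M \<theta>) = (LINT x|M. 1 - cos (\<theta> * x))"
  using prob_space integrable_cos by (simp add: Re_char_eq)

text \<open>Fubini, with E cos(x T) = exp(- x^2 / 2) for T standard normal.\<close>

lemma gauss_tail_eq_char: "gauss_tail M s = (LINT t|std_gauss. 1 - Re (char M (s * t)))"
proof -
  interpret N: real_distribution std_gauss by (rule real_dist_normal_dist)
  interpret P: pair_prob_space std_gauss M ..
  \<comment> \<open>The lower half of |1 - cos y| \<le> 2 reads cos y \<le> 3.\<close>
  have c3: "cos y \<le> 3" for y :: real by (rule order_trans[OF cos_le_one]) simp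
  have m: "(\<lambda>(t, x). 1 - cos (s * t * x)) \<in> borel_measurable (std_gauss \<Otimes>\<^sub>M M)" by measurable
  have "(LINT x|M. (LINT t|std_gauss. 1 - cos (s * t * x))) = (LINT t|std_gauss. (LINT x|M. 1 - cos (s * t * x)))"
    by (rule P.Fubini_integral) (rule P.integrable_const_bound[where B=2],
      use m in \<open>auto intro!: AE_I2 simp: abs_le_iff c3\<close>)
  moreover have "(LINT t|std_gauss. 1 - cos (s * t * x)) = 1 - exp (- ((s * x)\<^sup>2 / 2))" for x
    using integral_cos_std_normal[of "s * x"] N.integrable_cos[of "s * x"] N.prob_space
    by (simp add: mult_ac)
  ultimately show ?thesis by (simp add: gauss_tail_def one_minus_Re_char_eq)
qed

lemma lap_tail_eq_gauss_tail:
  assumes "0 \<le> s"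
  shows "lap_tail M s = (LINT t|std_gauss. gauss_tail M (s / t))"
proof -
  interpret N: real_distribution std_gauss by (rule real_dist_normal_dist)
  interpret P: pair_prob_space std_gauss M ..
  have m: "(\<lambda>(t, x). 1 - exp (- ((s / t * x)\<^sup>2 / 2))) \<in> borel_measurable (std_gauss \<Otimes>\<^sub>M M)" by measurable
  have "(LINT x|M. (LINT t|std_gauss. 1 - exp (- ((s / t * x)\<^sup>2 / 2)))) = (LINT t|std_gauss. (LINT x|M. 1 - exp (- ((s / t * x)\<^sup>2 / 2))))"
    by (rule P.Fubini_integral) (rule P.integrable_const_bound[where B=1], use m in auto)
  moreover have "(LINT t|std_gauss. 1 - exp (- ((s / t * x)\<^sup>2 / 2))) = 1 - exp (- (s * \<bar>x\<bar>))" for x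
  proof -
    have "integrable std_gauss (\<lambda>t. exp (- ((s * x / t)\<^sup>2 / 2)))"
      by (rule N.integrable_const_bound[where B=1]) auto
    then have "(LINT t|std_gauss. 1 - exp (- ((s * x / t)\<^sup>2 / 2))) = 1 - exp (- \<bar>s * x\<bar>)"
      using N.prob_space by (simp add: laplace_subordination)
    then show ?thesis using assms by (simp add: abs_mult)
  qed
  ultimately show ?thesis by (simp add: lap_tail_def gauss_tail_def)
qed

text \<open>Single frequencies are bounded by an average, uniformly in |\<theta>| \<le> s; pointwise
  convergence of characteristic functions thereby turns into a locally uniform bound.\<close>

lemma one_minus_Re_char_le_gauss_tail:
  assumes "\<bar>\<theta>\<bar> \<le> s"
  shows "1 - Re (char M \<theta>) \<le> 4 * gauss_tail M s"
proof -
  have "(LINT x|M. 1 - cos (\<theta> * x)) \<le> (LINT x|M. 4 * (1 - exp (- ((s * x)\<^sup>2 / 2))))"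
    using assms by (intro integral_mono one_minus_cos_le_gauss integrable_mult_right integrable_gauss)
      (auto simp: integrable_one_minus_cos abs_mult intro!: mult_mono)
  also have "\<dots> = 4 * gauss_tail M s"
    unfolding gauss_tail_def by (rule integral_mult_right_zero)
  finally show ?thesis by (simp only: one_minus_Re_char_eq)
qed

lemma one_minus_Re_char_mult_le:
  "1 - Re (char M (real k * \<theta>)) \<le> (real k)\<^sup>2 * (1 - Re (char M \<theta>))"
proof -
  have "(LINT x|M. 1 - cos (real k * \<theta> * x)) \<le> (LINT x|M. (real k)\<^sup>2 * (1 - cos (\<theta> * x)))"
    using one_minus_cos_mult_le[of k "\<theta> * x" for x]
    by (intro integral_mono integrable_mult_right integrable_one_minus_cos) (simp add: mult.assoc)
  also have "\<dots> = (real k)\<^sup>2 * (1 - Re (char M \<theta>))"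
    unfolding one_minus_Re_char_eq by (rule integral_mult_right_zero)
  finally show ?thesis by (simp only: one_minus_Re_char_eq)
qed

text \<open>By subordination the quotient of \<open>lap_tail\<close> and \<open>gauss_tail\<close>
  at \<open>s\<close> is the normal average over t of
  \<open>gauss_tail M (s / t) / gauss_tail M s\<close>. It tends to E|T|^(-p), with the Potter
  majorant C (1 + |t|^(-q)).\<close>

theorem regularly_varying_lap_tail:
  assumes nz: "\<not> (AE x in M. x = 0)" and p: "0 < p" "p < 1"
    and rv: "regularly_varying_0 p (gauss_tail M)"
  shows "regularly_varying_0 p (lap_tail M)"
proof -
  interpret N: real_distribution std_gauss by (rule real_dist_normal_dist)
  \<comment> \<open>An exponent strictly between p and 1: above p for Potter's bound, below 1 for
    the negative moment.\<close>
  define q where "q = (1 + p) / 2"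
  have q: "p < q" "q < 1" "0 < q" using p by (auto simp: q_def)
  obtain C s0 where C: "0 < C" "0 < s0"
    "\<And>l s. 0 < s \<Longrightarrow> s \<le> s0 \<Longrightarrow> 0 < l \<Longrightarrow> gauss_tail M (l * s) \<le> C * (1 + l powr q) * gauss_tail M s"
    using potter_bound[OF rv gauss_tail_mono gauss_tail_pos[OF nz] gauss_tail_le_1 q(1,3)] by blast
  have even: "gauss_tail M (- s) = gauss_tail M s" for s by (simp add: gauss_tail_def)
  have gabs: "gauss_tail M (s / t) = gauss_tail M (1 / \<bar>t\<bar> * s)" for s t
    using even[of "s / t"] by (cases "t \<ge> 0") auto
  define K where "K = (LINT t|std_gauss. \<bar>t\<bar> powr - p)"
  have neg: "integrable std_gauss (\<lambda>t. \<bar>t\<bar> powr - q)" "integrable std_gauss (\<lambda>t. \<bar>t\<bar> powr - p)"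
    using p q by (auto intro: integrable_std_normal_negative_moment)
  have K: "0 < K"
  proof -
    have "K \<noteq> 0"
    proof
      assume "K = 0"
      then have "AE t in std_gauss. \<bar>t\<bar> powr - p = 0"
        unfolding K_def using neg by (subst (asm) integral_nonneg_eq_0_iff_AE) auto
      then have "AE t in std_gauss. False" using AE_std_normal_nonzero by eventually_elim simp
      then show False using N.AE_False by simp
    qed
    moreover have "0 \<le> K" unfolding K_def by (rule Bochner_Integration.integral_nonneg) auto
    ultimately show ?thesis by linarith
  qed
  have [measurable]: "gauss_tail M \<in> borel_measurable borel"
    unfolding gauss_tail_def by measurable
  have "((\<lambda>s. lap_tail M s / gauss_tail M s) \<longlongrightarrow> K) (at_right 0)"
    unfolding filterlim_at_right_to_top
  proof -
    have "((\<lambda>x. LINT t|std_gauss. gauss_tail M (inverse x / t) / gauss_tail M (inverse x)) \<longlongrightarrow> K) at_top"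
      unfolding K_def
    proof (rule integral_dominated_convergence_at_top[where w="\<lambda>t. C * (1 + \<bar>t\<bar> powr - q)"])
      show "integrable std_gauss (\<lambda>t. C * (1 + \<bar>t\<bar> powr - q))"
        using neg by (intro integrable_mult_right Bochner_Integration.integrable_add) auto
      show "\<forall>\<^sub>F x in at_top. AE t in std_gauss. norm (gauss_tail M (inverse x / t) / gauss_tail M (inverse x)) \<le> C * (1 + \<bar>t\<bar> powr - q)"
        using eventually_ge_at_top[of "1 / s0"] eventually_gt_at_top[of 0]
      proof eventually_elim
        case (elim x)
        have x: "0 < inverse x" "inverse x \<le> s0" using elim C by (auto simp: field_simps)
        show ?case using AE_std_normal_nonzero
        proof eventually_elim
          case (elim t)
          have "gauss_tail M (inverse x / t) \<le> C * (1 + (1 / \<bar>t\<bar>) powr q) * gauss_tail M (inverse x)"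
            unfolding gabs using elim by (intro C x) auto
          moreover have "(1 / \<bar>t\<bar>) powr q = \<bar>t\<bar> powr - q"
            using elim by (simp add: powr_divide powr_minus_divide)
          moreover have "0 \<le> gauss_tail M (inverse x / t)"
            unfolding gauss_tail_def by (rule Bochner_Integration.integral_nonneg) auto
          ultimately show ?case
            using gauss_tail_pos[OF nz x(1)] by (simp add: divide_le_eq)
        qed
      qed
      show "AE t in std_gauss. ((\<lambda>x. gauss_tail M (inverse x / t) / gauss_tail M (inverse x)) \<longlongrightarrow> \<bar>t\<bar> powr - p) at_top"
        using AE_std_normal_nonzero
      proof eventually_elim
        case (elim t)
        have "((\<lambda>s. gauss_tail M (1 / \<bar>t\<bar> * s) / gauss_tail M s) \<longlongrightarrow> (1 / \<bar>t\<bar>) powr p) (at_right 0)"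
          using rv[unfolded regularly_varying_0_def, rule_format, of "1 / \<bar>t\<bar>"] elim by simp
        moreover have "(1 / \<bar>t\<bar>) powr p = \<bar>t\<bar> powr - p"
          using elim by (simp add: powr_divide powr_minus_divide)
        ultimately show ?case
          unfolding filterlim_at_right_to_top gabs by simp
      qed
    qed auto
    moreover have "\<forall>\<^sub>F x in at_top. (LINT t|std_gauss. gauss_tail M (inverse x / t) / gauss_tail M (inverse x))
        = lap_tail M (inverse x) / gauss_tail M (inverse x)"
      using eventually_gt_at_top[of 0] by eventually_elim (simp add: lap_tail_eq_gauss_tail)
    ultimately show "((\<lambda>x. lap_tail M (inverse x) / gauss_tail M (inverse x)) \<longlongrightarrow> K) at_top"
      by (rule Lim_transform_eventually)
  qed
  from regularly_varying_0_asymp[OF rv gauss_tail_pos[OF nz] this] K show ?thesis by auto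
qed

end

section \<open>Symmetrization and its effect on the Laplace transform\<close>

definition symmetrize :: "real measure \<Rightarrow> real measure" where
  "symmetrize N = distr (N \<Otimes>\<^sub>M N) borel (\<lambda>(x, y). x - y)"

context real_distribution
begin

lemma real_distribution_symmetrize: "real_distribution (symmetrize M)"
proof -
  interpret P: pair_prob_space M M ..
  show ?thesis unfolding symmetrize_def
    by (intro real_distribution.intro real_distribution_axioms.intro P.prob_space_distr) auto
qed

lemma integral_symmetrize:
  fixes f :: "real \<Rightarrow> 'b::{banach, second_countable_topology}"
  assumes [measurable]: "f \<in> borel_measurable borel" and B: "\<And>x. norm (f x) \<le> B"
  shows "(LINT z|symmetrize M. f z) = (LINT x|M. (LINT y|M. f (x - y)))"
proof -
  interpret P: pair_prob_space M M ..
  have m: "(\<lambda>z. f (fst z - snd z)) \<in> borel_measurable (M \<Otimes>\<^sub>M M)" by measurable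
  have "(LINT z|symmetrize M. f z) = (LINT z|(M \<Otimes>\<^sub>M M). f (fst z - snd z))"
    unfolding symmetrize_def by (subst integral_distr) (auto simp: case_prod_unfold)
  also have "\<dots> = (LINT x|M. (LINT y|M. f (fst (x, y) - snd (x, y))))"
    by (rule P.integral_fst'[symmetric], rule P.integrable_const_bound[where B=B]) (use m B in auto)
  finally show ?thesis by simp
qed

lemma char_symmetrize: "char (symmetrize M) \<theta> = complex_of_real ((norm (char M \<theta>))\<^sup>2)"
proof -
  have "char (symmetrize M) \<theta> = (LINT x|M. (LINT y|M. iexp (\<theta> * x) * cnj (iexp (\<theta> * y))))"
    unfolding char_def
    by (subst integral_symmetrize[where B=1])
       (auto intro!: Bochner_Integration.integral_cong simp: exp_cnj right_diff_distrib simp flip: exp_add)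
  also have "\<dots> = char M \<theta> * cnj (char M \<theta>)"
    unfolding char_def integral_mult_right_zero Bochner_Integration.integral_cnj integral_mult_left_zero ..
  finally show ?thesis by (simp add: complex_norm_square[symmetric])
qed

lemma Re_char_symmetrize: "Re (char (symmetrize M) \<theta>) = (norm (char M \<theta>))\<^sup>2"
  by (simp add: char_symmetrize)

text \<open>For x, y > 0 and f(x) = 1 - exp(- s x), subadditivity and |x - y| = max - min give f(x)
  + f(y) - 2 f(min) \<le> f(|x - y|) \<le> f(x) + f(y). The minimum is controlled by a cut at
  \<open>x0\<close>: f(min) is at most s x0 if y \<le> x0 and at most f(x) otherwise, and
  independence turns the second case into the product with \<open>prob {x0<..}\<close>.\<close>

lemma lap_tail_symmetrize_bounds:
  assumes pos: "AE x in M. 0 < x" and s: "0 \<le> s" and x0: "0 \<le> x0"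
  shows "lap_tail (symmetrize M) s \<le> 2 * lap_tail M s"
    and "2 * lap_tail M s - 2 * (s * x0 + prob {x0<..} * lap_tail M s) \<le> lap_tail (symmetrize M) s"
proof -
  define f where "f x = 1 - exp (- (s * \<bar>x\<bar>))" for x
  have [measurable]: "f \<in> borel_measurable borel" unfolding f_def by measurable
  have f01: "0 \<le> f x" "f x \<le> 1" for x using s by (auto simp: f_def)
  have intf: "integrable M f" unfolding f_def by (rule integrable_lap[OF s])
  have intd: "integrable M (\<lambda>y. f (x - y))" for x
    by (rule integrable_const_bound[where B=1]) (use f01 in auto)
  have intind: "integrable M (indicator {x0<..} :: real \<Rightarrow> real)"
    by (rule integrable_const_bound[where B=1]) (auto simp: indicator_def)
  have inti: "integrable M (\<lambda>x. LINT y|M. f (x - y))"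
  proof (rule integrable_const_bound[where B=1])
    show "AE x in M. norm (LINT y|M. f (x - y)) \<le> 1"
    proof (rule AE_I2)
      fix x
      have "(LINT y|M. f (x - y)) \<le> (LINT y|M. 1)" by (intro integral_mono intd) (auto simp: f01)
      moreover have "0 \<le> (LINT y|M. f (x - y))" by (intro Bochner_Integration.integral_nonneg) (auto simp: f01)
      ultimately show "norm (LINT y|M. f (x - y)) \<le> 1" using prob_space by simp
    qed
  qed auto
  have h: "lap_tail M s = (LINT x|M. f x)" by (simp add: lap_tail_def f_def)
  have hD: "lap_tail (symmetrize M) s = (LINT x|M. (LINT y|M. f (x - y)))"
    unfolding lap_tail_def f_def by (rule integral_symmetrize[where B=1]) (use s in auto)
  have mono: "f x \<le> f y" if "0 \<le> x" "x \<le> y" for x y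
    using that s by (auto simp: f_def intro: mult_left_mono)
  \<comment> \<open>\<open>1 - f\<close> is multiplicative on the nonnegative half-line, so f(x + y)
    = f(x) + f(y) - f(x) f(y).\<close>
  have sub: "f (x + y) \<le> f x + f y" if "0 \<le> x" "0 \<le> y" for x y
  proof -
    have "0 \<le> f x * f y" using f01 by simp
    then show ?thesis using that by (simp add: f_def algebra_simps flip: exp_add)
  qed
  have abs: "f (x - y) = f (y - x)" for x y by (simp add: f_def abs_minus_commute)
  have up: "f (x - y) \<le> f x + f y" if "0 < x" "0 < y" for x y
  proof -
    have "f (x - y) \<le> f (max x y)"
      using mono[of "\<bar>x - y\<bar>" "max x y"] that by (auto simp: f_def)
    also have "\<dots> \<le> f x + f y" using f01[of x] f01[of y] by (auto simp: max_def)
    finally show ?thesis .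
  qed
  have low: "f x + f y - 2 * (s * x0 + indicator {x0<..} y * f x) \<le> f (x - y)" if "0 < x" "0 < y" for x y
  proof -
    have 1: "f x + f y - 2 * f (min x y) \<le> f (x - y)"
    proof (cases "x \<le> y")
      case True
      then show ?thesis using sub[of "y - x" x] that abs[of x y] by (simp add: min_def)
    next
      case False
      then show ?thesis using sub[of "x - y" y] that by (simp add: min_def)
    qed
    have "f (min x y) \<le> s * x0 + indicator {x0<..} y * f x"
    proof (cases "x0 < y")
      case True
      then show ?thesis using mono[of "min x y" x] mult_nonneg_nonneg[OF s x0] that by simp
    next
      case False
      have "f (min x y) \<le> f x0" using that False by (intro mono) auto
      also have "f x0 \<le> s * x0"
        using exp_ge_add_one_self[of "- (s * x0)"] x0 by (simp add: f_def)
      finally show ?thesis using False by simp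
    qed
    then have "2 * f (min x y) \<le> 2 * (s * x0 + indicator {x0<..} y * f x)" by simp
    then show ?thesis using 1 by (meson diff_left_mono order_trans)
  qed
  have "AE x in M. (LINT y|M. f (x - y)) \<le> f x + lap_tail M s"
    using pos
  proof eventually_elim
    case (elim x)
    have "(LINT y|M. f (x - y)) \<le> (LINT y|M. f x + f y)"
      using pos up[OF elim] by (intro integral_mono_AE intd Bochner_Integration.integrable_add intf) auto
    also have "\<dots> = f x + lap_tail M s" using intf prob_space by (simp add: h)
    finally show ?case .
  qed
  then have "(LINT x|M. (LINT y|M. f (x - y))) \<le> (LINT x|M. f x + lap_tail M s)"
    by (intro integral_mono_AE inti) (auto simp: intf)
  then show "lap_tail (symmetrize M) s \<le> 2 * lap_tail M s"
    using intf prob_space by (simp add: h hD)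
  have "AE x in M. f x + lap_tail M s - 2 * (s * x0 + prob {x0<..} * f x) \<le> (LINT y|M. f (x - y))"
    using pos
  proof eventually_elim
    case (elim x)
    have "f x + lap_tail M s - 2 * (s * x0 + prob {x0<..} * f x)
        = (LINT y|M. f x + f y - 2 * (s * x0 + indicator {x0<..} y * f x))"
      using intf intind prob_space by (simp add: h)
    also have "\<dots> \<le> (LINT y|M. f (x - y))"
      using pos low[OF elim]
      by (intro integral_mono_AE intd) (auto simp: intf intind)
    finally show ?case .
  qed
  then have "(LINT x|M. f x + lap_tail M s - 2 * (s * x0 + prob {x0<..} * f x)) \<le> (LINT x|M. (LINT y|M. f (x - y)))"
    by (intro integral_mono_AE inti) (auto simp: intf)
  then show "2 * lap_tail M s - 2 * (s * x0 + prob {x0<..} * lap_tail M s) \<le> lap_tail (symmetrize M) s"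
    using intf prob_space by (simp add: h hD)
qed

text \<open>The quotient of the two tail functionals tends to 2. A large \<open>x0\<close> makes
  \<open>prob {x0<..}\<close> small; for this fixed \<open>x0\<close> the term s x0 is negligible,
  because the functional of the symmetrized law is at least of order s^q with q < 1.\<close>

theorem regularly_varying_of_symmetrize:
  assumes pos: "AE x in M. 0 < x" and p: "0 < p" "p < 1"
    and nz: "\<not> (AE x in symmetrize M. x = 0)"
    and rv: "regularly_varying_0 p (lap_tail (symmetrize M))"
  shows "regularly_varying_0 p (lap_tail M)"
proof -
  interpret D: real_distribution "symmetrize M" by (rule real_distribution_symmetrize)
  let ?h = "lap_tail M" and ?D = "lap_tail (symmetrize M)"
  have nzM: "\<not> (AE x in M. x = 0)"
  proof
    assume "AE x in M. x = 0"
    with pos have "AE x in M. False" by eventually_elim simp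
    then show False by (simp add: AE_False)
  qed
  define q where "q = (1 + p) / 2"
  have q: "p < q" "q < 1" "0 < q" using p by (auto simp: q_def)
  \<comment> \<open>\<open>potter_bound\<close> asks for a bound by one at every real argument,
    \<open>lap_tail_le_1\<close> gives it at nonnegative ones; extension by zero to the left
    reconciles them.\<close>
  define D' where "D' s = (if 0 \<le> s then ?D s else 0)" for s
  have rv': "regularly_varying_0 p D'"
  proof (rule regularly_varying_0_asymp[OF rv])
    show "((\<lambda>s. D' s / ?D s) \<longlongrightarrow> 1) (at_right 0)"
    proof (rule Lim_transform_eventually)
      show "((\<lambda>_. 1) \<longlongrightarrow> (1::real)) (at_right 0)" by simp
      show "\<forall>\<^sub>F s in at_right 0. 1 = D' s / ?D s"
        using eventually_at_right_less[of 0]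
        by eventually_elim (use D.lap_tail_pos[OF nz] in \<open>force simp: D'_def\<close>)
    qed
  qed (use D.lap_tail_pos[OF nz] in auto)
  obtain C s0 where C: "0 < C" "0 < s0"
    "\<And>l s. 0 < s \<Longrightarrow> s \<le> s0 \<Longrightarrow> 0 < l \<Longrightarrow> D' (l * s) \<le> C * (1 + l powr q) * D' s"
  proof (rule potter_bound[OF rv' _ _ _ q(1,3)])
    show "D' s \<le> D' t" if "0 < s" "s \<le> t" for s t using that D.lap_tail_mono by (simp add: D'_def)
    show "0 < D' s" if "0 < s" for s using that D.lap_tail_pos[OF nz] by (simp add: D'_def)
    show "D' s \<le> 1" for s using D.lap_tail_le_1 by (simp add: D'_def)
  qed blast
  have Dpos: "0 < ?D s0" by (rule D.lap_tail_pos[OF nz C(2)])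
  have slim: "((\<lambda>s. s / ?D s) \<longlongrightarrow> 0) (at_right 0)"
  proof (rule tendsto_sandwich[where f="\<lambda>_. 0" and h="\<lambda>s. C / ?D s0 * (s + s0 powr q * s powr (1 - q))"])
    show "\<forall>\<^sub>F s in at_right 0. 0 \<le> s / ?D s"
      using eventually_at_right_less[of 0]
      by eventually_elim (use D.lap_tail_nonneg in simp)
    show "\<forall>\<^sub>F s in at_right 0. s / ?D s \<le> C / ?D s0 * (s + s0 powr q * s powr (1 - q))"
      using eventually_at_right_less[of 0] eventually_at_right_real[OF C(2)]
    proof eventually_elim
      case (elim s)
      then have s: "0 < s" "s \<le> s0" by auto
      have Ds: "0 < ?D s" by (rule D.lap_tail_pos[OF nz s(1)])
      \<comment> \<open>Potter's bound read backwards, from \<open>s\<close> up to the fixed point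
        \<open>s0\<close>: the functional cannot decay faster than s^q.\<close>
      have "?D s0 \<le> C * (1 + (s0 / s) powr q) * ?D s"
        using C(3)[of s "s0 / s"] s C(2) by (simp add: D'_def)
      then have "s * ?D s0 \<le> s * (C * (1 + (s0 / s) powr q) * ?D s)"
        using s by (intro mult_left_mono) auto
      also have "\<dots> = C * (s + s0 powr q * (s * s powr - q)) * ?D s"
        using s C(2) by (simp add: powr_divide powr_minus_divide algebra_simps)
      also have "s * s powr - q = s powr (1 - q)" using s by (simp add: powr_diff powr_minus_divide)
      finally show ?case using Ds Dpos by (simp add: field_simps)
    qed
    have "((\<lambda>s. C / ?D s0 * (s + s0 powr q * s powr (1 - q))) \<longlongrightarrow> C / ?D s0 * (0 + s0 powr q * 0 powr (1 - q))) (at_right 0)"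
      by (intro tendsto_intros tendsto_powr') (use q in \<open>auto simp: eventually_at_filter\<close>)
    then show "((\<lambda>s. C / ?D s0 * (s + s0 powr q * s powr (1 - q))) \<longlongrightarrow> 0) (at_right 0)" by simp
  qed simp
  have tail: "((\<lambda>x0. prob {x0<..}) \<longlongrightarrow> 0) at_top"
  proof -
    have "((\<lambda>x0. 1 - cdf M x0) \<longlongrightarrow> 1 - 1) at_top"
      by (intro tendsto_intros cdf_lim_at_top_prob)
    moreover have "1 - cdf M x0 = prob {x0<..}" for x0
      using prob_compl[of "{..x0}"] by (simp add: cdf_def Compl_eq_Diff_UNIV[symmetric])
    ultimately show ?thesis by simp
  qed
  have quot: "((\<lambda>s. ?D s / ?h s) \<longlongrightarrow> 2) (at_right 0)"
  proof (rule order_tendstoI)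
    fix a :: real assume a: "2 < a"
    show "\<forall>\<^sub>F s in at_right 0. ?D s / ?h s < a"
      using eventually_at_right_less[of 0]
    proof eventually_elim
      case (elim s)
      have "?D s / ?h s \<le> 2"
        using lap_tail_symmetrize_bounds(1)[OF pos, of s 0] elim lap_tail_pos[OF nzM elim] by (simp add: divide_le_eq)
      then show ?case using a by linarith
    qed
  next
    fix a :: real assume a: "a < 2"
    \<comment> \<open>The two error terms cost at most \<open>6 * e * ?h s\<close> together, which
      is less than \<open>(2 - a) * ?h s\<close>, that is \<open>8 * e * ?h s\<close>.\<close>
    define e where "e = (2 - a) / 8"
    have e: "0 < e" using a by (simp add: e_def)
    have "\<exists>x0. prob {x0<..} < e \<and> 0 < x0"
      by (rule eventually_happens'[OF trivial_limit_at_top_linorder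
        eventually_conj[OF order_tendstoD(2)[OF tail e] eventually_gt_at_top[of 0]]])
    then obtain x0 where x0: "prob {x0<..} < e" "0 < x0" by auto
    have "\<forall>\<^sub>F s in at_right 0. s / ?D s < e / x0"
      using e x0 by (intro order_tendstoD(2)[OF slim]) auto
    with eventually_at_right_less[of 0] show "\<forall>\<^sub>F s in at_right 0. a < ?D s / ?h s"
    proof eventually_elim
      case (elim s)
      have hs: "0 < ?h s" by (rule lap_tail_pos[OF nzM elim(1)])
      have Ds: "0 < ?D s" by (rule D.lap_tail_pos[OF nz elim(1)])
      have D2: "?D s \<le> 2 * ?h s"
        using lap_tail_symmetrize_bounds(1)[OF pos, of s 0] elim by simp
      have "s * x0 < e * ?D s" using elim Ds x0 by (simp add: field_simps)
      also have "\<dots> \<le> e * (2 * ?h s)" using D2 e by (intro mult_left_mono) auto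
      finally have 1: "s * x0 < 2 * (e * ?h s)" by simp
      have 2: "prob {x0<..} * ?h s \<le> e * ?h s" using x0 hs by (intro mult_right_mono) auto
      have "2 * ?h s - 2 * (s * x0 + prob {x0<..} * ?h s) \<le> ?D s"
        using x0 elim by (intro lap_tail_symmetrize_bounds(2)[OF pos]) auto
      then have "2 * ?h s - 6 * (e * ?h s) < ?D s" using 1 2 unfolding distrib_left by linarith
      moreover have "a * ?h s \<le> 2 * ?h s - 6 * (e * ?h s)"
      proof -
        have "8 * e = 2 - a" by (simp add: e_def)
        then have "a \<le> 2 - 6 * e" using e by linarith
        then have "a * ?h s \<le> (2 - 6 * e) * ?h s" using hs by (intro mult_right_mono) auto
        then show ?thesis by (simp add: algebra_simps)
      qed
      ultimately show ?case using hs by (simp add: less_divide_eq)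
    qed
  qed
  have "((\<lambda>s. inverse (?D s / ?h s)) \<longlongrightarrow> inverse 2) (at_right 0)"
    by (intro tendsto_inverse quot) simp
  then have "((\<lambda>s. ?h s / ?D s) \<longlongrightarrow> inverse 2) (at_right 0)" by (simp only: inverse_divide)
  from regularly_varying_0_asymp[OF rv D.lap_tail_pos[OF nz] this] show ?thesis by simp
qed

end

section \<open>Domains of attraction\<close>

text \<open>After taking logarithms, - ln(1 - x) lies between x and x + 2 x^2 for small x \<ge> 0. A
  crude bound on n x_n forces x_n -> 0, and then n x_n^2 vanishes in the limit.\<close>

lemma power_one_minus_tendsto_exp:
  fixes x :: "nat \<Rightarrow> real"
  assumes x: "\<And>n. 0 \<le> x n" "\<And>n. x n \<le> 1"
    and lim: "(\<lambda>n. (1 - x n) ^ n) \<longlonglongrightarrow> exp (- L)"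
  shows "(\<lambda>n. real n * x n) \<longlonglongrightarrow> L"
proof -
  have le_exp: "(1 - x n) ^ n \<le> exp (- (real n * x n))" for n
  proof -
    have "(1 - x n) ^ n \<le> exp (- x n) ^ n"
      using exp_ge_add_one_self[of "- x n"] x by (intro power_mono) auto
    then show ?thesis by (simp add: exp_of_nat_mult[symmetric])
  qed
  \<comment> \<open>Half of the limit, hence the \<open>ln 2\<close> in the next bound; it also
    keeps the power positive, so that its logarithm is meaningful.\<close>
  have ev_pos: "\<forall>\<^sub>F n in sequentially. exp (- L) / 2 < (1 - x n) ^ n"
    by (rule order_tendstoD(1)[OF lim]) simp
  have bdd: "\<forall>\<^sub>F n in sequentially. real n * x n \<le> L + ln 2"
    using ev_pos
  proof eventually_elim
    case (elim n)
    have "exp (- L - ln 2) < exp (- (real n * x n))"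
      using elim le_exp[of n] by (simp add: exp_diff)
    then show ?case by simp
  qed
  have x0: "x \<longlonglongrightarrow> 0"
  proof (rule tendsto_sandwich[where f="\<lambda>_. 0" and h="\<lambda>n. (L + ln 2) / real n"])
    show "\<forall>\<^sub>F n in sequentially. x n \<le> (L + ln 2) / real n"
      using bdd eventually_gt_at_top[of 0] by eventually_elim (simp add: field_simps)
    show "(\<lambda>n. (L + ln 2) / real n) \<longlonglongrightarrow> 0" by (rule lim_const_over_n)
  qed (use x in auto)
  have ln: "(\<lambda>n. ln ((1 - x n) ^ n)) \<longlonglongrightarrow> - L"
    using tendsto_ln[OF lim] by simp
  have half: "\<forall>\<^sub>F n in sequentially. x n < 1 / 2"
    by (rule order_tendstoD(2)[OF x0]) simp
  have small: "(\<lambda>n. - ln ((1 - x n) ^ n) - 2 * ((L + ln 2) * x n)) \<longlonglongrightarrow> - (- L) - 2 * ((L + ln 2) * 0)"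
    by (intro tendsto_intros ln x0)
  show ?thesis
  proof (rule tendsto_sandwich)
    show "(\<lambda>n. - ln ((1 - x n) ^ n) - 2 * ((L + ln 2) * x n)) \<longlonglongrightarrow> L" using small by simp
    show "(\<lambda>n. - ln ((1 - x n) ^ n)) \<longlonglongrightarrow> L" using tendsto_minus[OF ln] by simp
    show "\<forall>\<^sub>F n in sequentially. real n * x n \<le> - ln ((1 - x n) ^ n)"
      using ev_pos
    proof eventually_elim
      case (elim n)
      then have "0 < (1 - x n) ^ n" by (rule less_trans[rotated]) simp
      then have "ln ((1 - x n) ^ n) \<le> ln (exp (- (real n * x n)))"
        using le_exp[of n] by (subst ln_le_cancel_iff) auto
      then show ?case by simp
    qed
    show "\<forall>\<^sub>F n in sequentially. - ln ((1 - x n) ^ n) - 2 * ((L + ln 2) * x n) \<le> real n * x n"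
      using half bdd
    proof eventually_elim
      case (elim n)
      have "- x n - 2 * (x n)\<^sup>2 \<le> ln (1 - x n)"
        using elim x by (intro ln_one_minus_pos_lower_bound) auto
      then have "real n * (- x n - 2 * (x n)\<^sup>2) \<le> real n * ln (1 - x n)"
        by (intro mult_left_mono) auto
      also have "\<dots> = ln ((1 - x n) ^ n)" using elim by (simp add: ln_realpow)
      finally have 1: "- ln ((1 - x n) ^ n) \<le> real n * x n + 2 * (real n * x n * x n)"
        by (simp add: algebra_simps power2_eq_square)
      have "real n * x n * x n \<le> (L + ln 2) * x n"
        using elim x by (intro mult_right_mono) auto
      then show ?case using 1 by linarith
    qed
  qed
qed

lemma integrable_std_normal_powr:
  assumes "0 < p" "p < 1"
  shows "integrable std_gauss (\<lambda>t. \<bar>t\<bar> powr p)"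
proof (rule Bochner_Integration.integrable_bound)
  interpret N: real_distribution std_gauss by (rule real_dist_normal_dist)
  show "integrable std_gauss (\<lambda>t. 1 + t ^ 2)"
    by (intro Bochner_Integration.integrable_add integrable_std_normal_distribution_moment) auto
  show "AE t in std_gauss. norm (\<bar>t\<bar> powr p) \<le> norm (1 + t ^ 2)"
  proof (rule AE_I2)
    fix t :: real
    have "\<bar>t\<bar> powr p \<le> 1 + t\<^sup>2"
    proof (cases "\<bar>t\<bar> \<le> 1")
      case True
      then have "\<bar>t\<bar> powr p \<le> 1" using assms by (intro powr_le1) auto
      then show ?thesis using zero_le_power2[of t] by linarith
    next
      case False
      then have "\<bar>t\<bar> powr p \<le> \<bar>t\<bar> powr 2" using assms by (intro powr_mono) auto
      also have "\<dots> = t\<^sup>2" using False by simp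
      finally show ?thesis by simp
    qed
    then show "norm (\<bar>t\<bar> powr p) \<le> norm (1 + t ^ 2)" by simp
  qed
qed auto

text \<open>The centring \<open>b\<close> contributes only a factor of modulus one, invisible to the
  norm.\<close>

lemma char_normalized_sum:
  assumes N: "real_distribution N"
  shows "char (distr (PiM {..<n} (\<lambda>_. N)) borel (\<lambda>x. ((\<Sum>k<n. x k) - b) / a)) \<theta>
    = iexp (- \<theta> * b / a) * char N (\<theta> / a) ^ n"
proof -
  interpret real_distribution N by fact
  interpret product_sigma_finite "\<lambda>_::nat. N" ..
  have int: "integrable N (\<lambda>x. iexp (\<theta> / a * x))" by (rule integrable_iexp) auto
  have "char (distr (PiM {..<n} (\<lambda>_. N)) borel (\<lambda>x. ((\<Sum>k<n. x k) - b) / a)) \<theta>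
     = (LINT x|PiM {..<n} (\<lambda>_. N). iexp (\<theta> * (((\<Sum>k<n. x k) - b) / a)))"
    unfolding char_def by (subst integral_distr) auto
  also have "\<dots> = (LINT x|PiM {..<n} (\<lambda>_. N). iexp (- \<theta> * b / a) * (\<Prod>k<n. iexp (\<theta> / a * x k)))"
  proof (rule Bochner_Integration.integral_cong[OF refl])
    fix x :: "nat \<Rightarrow> real"
    have "\<theta> * (((\<Sum>k<n. x k) - b) / a) = - \<theta> * b / a + (\<Sum>k<n. \<theta> / a * x k)"
      by (simp add: diff_divide_distrib sum_divide_distrib sum_distrib_left right_diff_distrib)
    then have "iexp (\<theta> * (((\<Sum>k<n. x k) - b) / a)) = iexp (- \<theta> * b / a + (\<Sum>k<n. \<theta> / a * x k))" by simp
    also have "\<dots> = iexp (- \<theta> * b / a) * (\<Prod>k<n. iexp (\<theta> / a * x k))"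
      by (simp only: of_real_add distrib_left exp_add of_real_sum sum_distrib_left exp_sum finite_lessThan)
    finally show "iexp (\<theta> * (((\<Sum>k<n. x k) - b) / a)) = iexp (- \<theta> * b / a) * (\<Prod>k<n. iexp (\<theta> / a * x k))" .
  qed
  also have "\<dots> = iexp (- \<theta> * b / a) * (\<Prod>k<n. LINT x|N. iexp (\<theta> / a * x))"
    unfolding integral_mult_right_zero
    by (subst product_integral_prod[OF finite_lessThan int]) (rule refl)
  finally show ?thesis by (simp add: char_def)
qed

lemma norm_stable_char:
  "norm (stable_char p \<sigma> \<beta> \<mu> \<theta>) = exp (- (\<sigma> powr p * \<bar>\<theta>\<bar> powr p))"
  by (simp add: stable_char_def norm_exp_eq_Re)

text \<open>Supplies the majorant for integrating the limit of n (1 - Re char(\<theta> / A n)) over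
  a normal \<theta>. Averaging gives a bound uniform on some interval |\<theta>| \<le> u, where the
  n-th power stays above 1/2; passing to integer multiples of a frequency carries it to all \<theta>
  with quadratic growth.\<close>

lemma (in real_distribution) eventually_bounded_of_power_char:
  fixes A :: "nat \<Rightarrow> real" and Q :: "nat \<Rightarrow> real measure"
  assumes Q: "\<And>n. real_distribution (Q n)" and p: "0 < p" and c: "0 < c"
    and QA: "\<And>n \<theta>. Re (char (Q n) \<theta>) = (Re (char M (\<theta> / A n))) ^ n"
    and M0: "\<And>\<theta>. 0 \<le> Re (char M \<theta>)"
    and lim: "\<And>\<theta>. (\<lambda>n. Re (char (Q n) \<theta>)) \<longlonglongrightarrow> exp (- (c * \<bar>\<theta>\<bar> powr p))"
  obtains K n0 where "\<And>n \<theta>. n0 \<le> n \<Longrightarrow> real n * (1 - Re (char M (\<theta> / A n))) \<le> K * (1 + \<theta>\<^sup>2)"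
proof -
  interpret N: real_distribution std_gauss by (rule real_dist_normal_dist)
  interpret Q: real_distribution "Q n" for n by fact
  have le1: "Re (char M \<theta>) \<le> 1" for \<theta>
    using cmod_char_le_1[of \<theta>] complex_Re_le_cmod[of "char M \<theta>"] by linarith
  have "(\<lambda>k. LINT t|std_gauss. 1 - exp (- (c * \<bar>1 / real (Suc k) * t\<bar> powr p))) \<longlonglongrightarrow> (LINT t|std_gauss. 0)"
  proof (rule integral_dominated_convergence[where w="\<lambda>_. 1"])
    show "AE t in std_gauss. (\<lambda>k. 1 - exp (- (c * \<bar>1 / real (Suc k) * t\<bar> powr p))) \<longlonglongrightarrow> 0"
    proof (rule AE_I2)
      fix t :: real
      have "(\<lambda>k. 1 - exp (- (c * \<bar>1 / real (Suc k) * t\<bar> powr p))) \<longlonglongrightarrow> 1 - exp (- (c * \<bar>0 * t\<bar> powr p))"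
        by (intro tendsto_intros tendsto_powr' LIMSEQ_Suc[OF lim_1_over_n]) (use p in auto)
      then show "(\<lambda>k. 1 - exp (- (c * \<bar>1 / real (Suc k) * t\<bar> powr p))) \<longlonglongrightarrow> 0" by simp
    qed
  qed (use c in auto)
  then have "(\<lambda>k. LINT t|std_gauss. 1 - exp (- (c * \<bar>1 / real (Suc k) * t\<bar> powr p))) \<longlonglongrightarrow> 0" by simp
  \<comment> \<open>The value 1/8 is chosen because comparing a single frequency with the average
    costs a factor 4, and the n-th power is to stay above 1/2.\<close>
  then have "\<forall>\<^sub>F k in sequentially. (LINT t|std_gauss. 1 - exp (- (c * \<bar>1 / real (Suc k) * t\<bar> powr p))) < 1 / 8"
    by (rule order_tendstoD(2)) simp
  from eventually_happens'[OF sequentially_bot this] obtain k where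
    k: "(LINT t|std_gauss. 1 - exp (- (c * \<bar>1 / real (Suc k) * t\<bar> powr p))) < 1 / 8" ..
  define u where "u = 1 / real (Suc k)"
  have u: "0 < u" by (simp add: u_def)
  have "(\<lambda>n. gauss_tail (Q n) u) \<longlonglongrightarrow> (LINT t|std_gauss. 1 - exp (- (c * \<bar>u * t\<bar> powr p)))"
    unfolding Q.gauss_tail_eq_char
  proof (rule integral_dominated_convergence[where w="\<lambda>_. 2"])
    show "AE t in std_gauss. norm (1 - Re (char (Q n) (u * t))) \<le> 2" for n
    proof (rule AE_I2)
      fix t
      have "\<bar>Re (char (Q n) (u * t))\<bar> \<le> 1"
        using Q.cmod_char_le_1[of n "u * t"] abs_Re_le_cmod[of "char (Q n) (u * t)"] by linarith
      then show "norm (1 - Re (char (Q n) (u * t))) \<le> 2" by simp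
    qed
    show "AE t in std_gauss. (\<lambda>n. 1 - Re (char (Q n) (u * t))) \<longlonglongrightarrow> 1 - exp (- (c * \<bar>u * t\<bar> powr p))"
      by (intro AE_I2 tendsto_intros lim)
  qed auto
  from order_tendstoD(2)[OF this k[folded u_def]] obtain n0
    where n0: "\<And>n. n0 \<le> n \<Longrightarrow> gauss_tail (Q n) u < 1 / 8"
    by (auto simp: eventually_sequentially)
  have near: "real n * (1 - Re (char M (\<theta> / A n))) \<le> 1" if n: "n0 \<le> n" and \<theta>: "\<bar>\<theta>\<bar> \<le> u" for n \<theta>
  proof -
    let ?x = "1 - Re (char M (\<theta> / A n))"
    have "1 - Re (char (Q n) \<theta>) \<le> 4 * gauss_tail (Q n) u"
      by (rule Q.one_minus_Re_char_le_gauss_tail[OF \<theta>])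
    then have "1 / 2 < (1 - ?x) ^ n" using n0[OF n] unfolding QA by simp
    also have "(1 - ?x) ^ n \<le> exp (- ?x) ^ n"
      using exp_ge_add_one_self[of "- ?x"] M0 by (intro power_mono) auto
    also have "\<dots> = exp (- (real n * ?x))" by (simp add: exp_of_nat_mult[symmetric] algebra_simps)
    finally have "1 / 2 < exp (- (real n * ?x))" .
    moreover have "exp (- 1) \<le> (1 / 2 :: real)"
      using exp_ge_add_one_self[of "1::real"] by (simp add: exp_minus field_simps)
    ultimately have "exp (- 1) < exp (- (real n * ?x))" by linarith
    then show ?thesis by simp
  qed
  show thesis
  proof
    fix n \<theta> assume n: "n0 \<le> n"
    \<comment> \<open>Large enough to bring \<open>\<theta> / j\<close> into the interval of radius
      \<open>u\<close>; the added 1 keeps \<open>j\<close> positive at \<theta> = 0.\<close>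
    define j where "j = nat \<lceil>\<bar>\<theta>\<bar> / u\<rceil> + 1"
    have j: "\<bar>\<theta>\<bar> / u \<le> real j" "real j \<le> \<bar>\<theta>\<bar> / u + 2" "0 < real j"
    proof -
      have "0 \<le> \<bar>\<theta>\<bar> / u" using u by simp
      then show "\<bar>\<theta>\<bar> / u \<le> real j" "real j \<le> \<bar>\<theta>\<bar> / u + 2" "0 < real j"
        unfolding j_def by linarith+
    qed
    have "\<bar>\<theta> / real j\<bar> \<le> u" using j u by (simp add: field_simps)
    from near[OF n this] have 1: "real n * (1 - Re (char M (\<theta> / real j / A n))) \<le> 1" .
    have "\<theta> / A n = real j * (\<theta> / real j / A n)" using j by simp
    then have "1 - Re (char M (\<theta> / A n)) \<le> (real j)\<^sup>2 * (1 - Re (char M (\<theta> / real j / A n)))"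
      using one_minus_Re_char_mult_le[of j "\<theta> / real j / A n"] by simp
    then have "real n * (1 - Re (char M (\<theta> / A n))) \<le> real n * ((real j)\<^sup>2 * (1 - Re (char M (\<theta> / real j / A n))))"
      by (intro mult_left_mono) auto
    also have "\<dots> = (real j)\<^sup>2 * (real n * (1 - Re (char M (\<theta> / real j / A n))))" by simp
    also have "\<dots> \<le> (real j)\<^sup>2 * 1" using 1 by (intro mult_left_mono) auto
    also have "\<dots> \<le> (\<bar>\<theta>\<bar> / u + 2)\<^sup>2" using j by (simp add: power_mono)
    also have "\<dots> \<le> 2 * (\<bar>\<theta>\<bar> / u)\<^sup>2 + 8"
      using zero_le_power2[of "\<bar>\<theta>\<bar> / u - 2"] unfolding power2_sum power2_diff by simp
    also have "\<dots> \<le> (2 / u\<^sup>2 + 8) * (1 + \<theta>\<^sup>2)"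
    proof -
      have "0 \<le> 2 / u\<^sup>2 + 8 * \<theta>\<^sup>2" by simp
      then show ?thesis by (simp add: power_divide algebra_simps add_divide_distrib)
    qed
    finally show "real n * (1 - Re (char M (\<theta> / A n))) \<le> (2 / u\<^sup>2 + 8) * (1 + \<theta>\<^sup>2)" .
  qed
qed

theorem regularly_varying_of_domain_of_attraction:
  assumes p: "0 < p" "p < 1" and dom: "in_domain_of_attraction p N" and pos: "AE x in N. 0 < x"
  shows "regularly_varying_0 p (lap_tail N)"
proof -
  obtain A B \<sigma> \<beta> \<mu> N' where N: "real_distribution N" and A: "\<And>n. 0 < A n"
    and st: "stable_law p \<sigma> \<beta> \<mu> N'"
    and conv: "weak_conv_m (\<lambda>n. distr (PiM {..<n} (\<lambda>_. N)) borel (\<lambda>x. ((\<Sum>k<n. x k) - B n) / A n)) N'"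
    using dom unfolding in_domain_of_attraction_def by (elim conjE exE) blast
  interpret N: real_distribution N by fact
  interpret G: real_distribution std_gauss by (rule real_dist_normal_dist)
  define D where "D = symmetrize N"
  interpret D: real_distribution D unfolding D_def by (rule N.real_distribution_symmetrize)
  define P where "P n = distr (PiM {..<n} (\<lambda>_. N)) borel (\<lambda>x. ((\<Sum>k<n. x k) - B n) / A n)" for n
  have P: "real_distribution (P n)" for n
  proof -
    interpret product_prob_space "\<lambda>_::nat. N" "{..<n}" ..
    show ?thesis unfolding P_def
      by (intro real_distribution.intro real_distribution_axioms.intro prob_space_distr) auto
  qed
  interpret P: real_distribution "P n" for n by (rule P)
  define Q where "Q n = symmetrize (P n)" for n
  have Q: "real_distribution (Q n)" for n unfolding Q_def by (rule P.real_distribution_symmetrize)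
  \<comment> \<open>The squared modulus of the stable characteristic function is exp(- c
    |\<theta>|^p); location and skewness affect only the phase.\<close>
  define c where "c = 2 * \<sigma> powr p"
  have c: "0 < c" using st by (simp add: c_def stable_law_def)
  have normP: "norm (char (P n) \<theta>) = norm (char N (\<theta> / A n)) ^ n" for n \<theta>
    unfolding P_def char_normalized_sum[OF N] by (simp add: norm_mult norm_power)
  have ReD: "Re (char D \<theta>) = (norm (char N \<theta>))\<^sup>2" for \<theta>
    unfolding D_def by (rule N.Re_char_symmetrize)
  have QA: "Re (char (Q n) \<theta>) = (Re (char D (\<theta> / A n))) ^ n" for n \<theta>
    unfolding Q_def P.Re_char_symmetrize ReD normP by (simp add: power_mult[symmetric] mult.commute)
  have limQ: "(\<lambda>n. Re (char (Q n) \<theta>)) \<longlonglongrightarrow> exp (- (c * \<bar>\<theta>\<bar> powr p))" for \<theta>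
  proof -
    have "(\<lambda>n. char (P n) \<theta>) \<longlonglongrightarrow> char N' \<theta>"
      by (rule levy_continuity1[OF P]) (use st conv in \<open>auto simp: stable_law_def P_def[abs_def]\<close>)
    then have "(\<lambda>n. (norm (char (P n) \<theta>))\<^sup>2) \<longlonglongrightarrow> (norm (char N' \<theta>))\<^sup>2"
      by (intro tendsto_intros)
    also have "(norm (char N' \<theta>))\<^sup>2 = exp (- (c * \<bar>\<theta>\<bar> powr p))"
      using st by (simp add: stable_law_def norm_stable_char c_def exp_double[symmetric])
    finally show ?thesis unfolding Q_def P.Re_char_symmetrize .
  qed
  have D01: "0 \<le> Re (char D \<theta>)" "Re (char D \<theta>) \<le> 1" for \<theta>
    unfolding ReD using N.cmod_char_le_1[of \<theta>] by (auto simp: power_le_one)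
  have ng: "(\<lambda>n. real n * (1 - Re (char D (\<theta> / A n)))) \<longlonglongrightarrow> c * \<bar>\<theta>\<bar> powr p" for \<theta>
    by (rule power_one_minus_tendsto_exp) (use D01 limQ[of \<theta>] in \<open>auto simp: QA\<close>)
  \<comment> \<open>Were the symmetrized law concentrated at zero, the sequence in \<open>ng\<close>
    would vanish identically, against c > 0.\<close>
  have nz: "\<not> (AE x in D. x = 0)"
  proof
    assume "AE x in D. x = 0"
    then have "Re (char D \<theta>) = 1" for \<theta>
    proof -
      have "Re (char D \<theta>) = (LINT x|D. 1)"
        unfolding D.Re_char_eq by (rule integral_cong_AE) (use \<open>AE x in D. x = 0\<close> in \<open>auto elim!: AE_mp\<close>)
      then show ?thesis using D.prob_space by simp
    qed
    then have "(\<lambda>n. 0) \<longlonglongrightarrow> c" using ng[of 1] by simp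
    then show False using c by (simp add: LIMSEQ_const_iff)
  qed
  obtain K n0 where K: "\<And>n \<theta>. n0 \<le> n \<Longrightarrow> real n * (1 - Re (char D (\<theta> / A n))) \<le> K * (1 + \<theta>\<^sup>2)"
    by (rule D.eventually_bounded_of_power_char[where Q=Q and A=A, OF Q p(1) c QA D01(1) limQ]) (rule that)
  define E where "E = (LINT t|std_gauss. \<bar>t\<bar> powr p)"
  have E: "0 < E"
    unfolding E_def
  proof (rule G.integral_pos_of_nonzero)
    show "\<not> (AE t in std_gauss. t = 0)"
    proof
      assume "AE t in std_gauss. t = (0::real)"
      with AE_std_normal_nonzero have "AE t in std_gauss. False" by eventually_elim simp
      then show False using G.AE_False by simp
    qed
  qed (use p in \<open>auto intro: integrable_std_normal_powr\<close>)
  have lim: "(\<lambda>n. real n * gauss_tail D (s / A n)) \<longlonglongrightarrow> c * E * s powr p" if s: "0 < s" for s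
  \<comment> \<open>Shifted by \<open>n0\<close>, because the majorant holds only from there
    on.\<close>
  proof (rule LIMSEQ_offset[where k=n0])
    have "(\<lambda>n. LINT t|std_gauss. real (n + n0) * (1 - Re (char D (s / A (n + n0) * t))))
      \<longlonglongrightarrow> (LINT t|std_gauss. c * \<bar>s * t\<bar> powr p)"
    proof (rule integral_dominated_convergence[where w="\<lambda>t. K * (1 + s\<^sup>2 * t\<^sup>2)"])
      show "integrable std_gauss (\<lambda>t. K * (1 + s\<^sup>2 * t\<^sup>2))"
        by (intro integrable_mult_right Bochner_Integration.integrable_add integrable_std_normal_distribution_moment) auto
      show "AE t in std_gauss. (\<lambda>n. real (n + n0) * (1 - Re (char D (s / A (n + n0) * t)))) \<longlonglongrightarrow> c * \<bar>s * t\<bar> powr p"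
      proof (rule AE_I2)
        fix t
        show "(\<lambda>n. real (n + n0) * (1 - Re (char D (s / A (n + n0) * t)))) \<longlonglongrightarrow> c * \<bar>s * t\<bar> powr p"
          using LIMSEQ_ignore_initial_segment[OF ng[of "s * t"], of n0] by simp
      qed
      show "AE t in std_gauss. norm (real (n + n0) * (1 - Re (char D (s / A (n + n0) * t)))) \<le> K * (1 + s\<^sup>2 * t\<^sup>2)" for n
      proof (rule AE_I2)
        fix t
        have "real (n + n0) * (1 - Re (char D (s * t / A (n + n0)))) \<le> K * (1 + (s * t)\<^sup>2)"
          by (rule K) simp
        moreover have "0 \<le> real (n + n0) * (1 - Re (char D (s / A (n + n0) * t)))"
          using D01(2) by (intro mult_nonneg_nonneg) auto
        ultimately show "norm (real (n + n0) * (1 - Re (char D (s / A (n + n0) * t)))) \<le> K * (1 + s\<^sup>2 * t\<^sup>2)"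
          by (simp add: power_mult_distrib)
      qed
    qed auto
    also have "(LINT t|std_gauss. c * \<bar>s * t\<bar> powr p) = (LINT t|std_gauss. c * s powr p * \<bar>t\<bar> powr p)"
      using s by (intro Bochner_Integration.integral_cong) (auto simp: abs_mult powr_mult)
    also have "\<dots> = c * E * s powr p" by (simp add: E_def)
    also have "(\<lambda>n. LINT t|std_gauss. real (n + n0) * (1 - Re (char D (s / A (n + n0) * t))))
      = (\<lambda>n. real (n + n0) * gauss_tail D (s / A (n + n0)))"
      unfolding D.gauss_tail_eq_char by (simp only: integral_mult_right_zero)
    finally show "(\<lambda>n. real (n + n0) * gauss_tail D (s / A (n + n0))) \<longlonglongrightarrow> c * E * s powr p" .
  qed
  have "regularly_varying_0 p (gauss_tail D)"
    by (rule regularly_varying_0_of_sequence[OF D.gauss_tail_mono D.gauss_tail_pos[OF nz]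
          D.gauss_tail_tendsto_0 A mult_pos_pos[OF c E] p(1) lim])
  from D.regularly_varying_lap_tail[OF nz p this]
  show ?thesis using nz unfolding D_def by (intro N.regularly_varying_of_symmetrize[OF pos p])
qed

section \<open>Asymptotic inversion\<close>

lemma (in real_distribution) continuous_on_lap_tail: "continuous_on {0..} (lap_tail M)"
  unfolding continuous_on_sequentially comp_def
proof (intro allI ballI impI)
  fix X :: "nat \<Rightarrow> real" and a :: real
  assume X: "(\<forall>n. X n \<in> {0..}) \<and> X \<longlonglongrightarrow> a"
  show "(\<lambda>n. lap_tail M (X n)) \<longlonglongrightarrow> lap_tail M a"
    unfolding lap_tail_def
  proof (rule integral_dominated_convergence[where w="\<lambda>_. 1"])
    show "AE x in M. (\<lambda>n. 1 - exp (- (X n * \<bar>x\<bar>))) \<longlonglongrightarrow> 1 - exp (- (a * \<bar>x\<bar>))"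
      using X by (intro AE_I2 tendsto_intros) auto
  qed (use X in auto)
qed

text \<open>The tail functional h is continuous and vanishes at zero, so h(s) = k / y is solvable
  for large y; the solution is 1 / b(y). Monotonicity transfers the index: b(c y) / b(y) < a is read
  off from h(s / a) < h(s') at s = 1 / b(y) and s' = 1 / b(c y), where the limit (1 / a)^p of h(s /
  a) / h(s) is compared with h(s') / h(s) = 1 / c.\<close>

theorem (in real_distribution) asymptotic_inverse_lap_tail:
  assumes nz: "\<not> (AE x in M. x = 0)" and rv: "regularly_varying_0 p (lap_tail M)"
    and p: "0 < p" and k: "0 < k"
  obtains b y0 where "mono b" "\<And>y. 0 < b y" "0 < y0"
    "\<And>y. y0 \<le> y \<Longrightarrow> lap_tail M (1 / b y) = k / y"
    "filterlim b at_top at_top"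
    "\<And>c. 0 < c \<Longrightarrow> ((\<lambda>y. b (c * y) / b y) \<longlongrightarrow> c powr (1 / p)) at_top"
proof -
  let ?h = "lap_tail M"
  \<comment> \<open>The threshold from which on k / y lies in the range of \<open>?h\<close> on
    [0, 1].\<close>
  define y0 where "y0 = k / ?h 1"
  have h1: "0 < ?h 1" by (rule lap_tail_pos[OF nz]) simp
  have y0: "0 < y0" using h1 k by (simp add: y0_def)
  \<comment> \<open>Below \<open>y0\<close> the equation is frozen at \<open>y0\<close>, which keeps
    the inverse positive and monotone on the whole real line.\<close>
  define s where "s y = (SOME s. 0 < s \<and> ?h s = k / max y y0)" for y
  have s: "0 < s y \<and> ?h (s y) = k / max y y0" for y
    unfolding s_def
  proof (rule someI_ex)
    have pos: "0 < k / max y y0" using k y0 by (auto simp: max_def)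
    have "k / max y y0 \<le> k / y0" using k y0 by (intro divide_left_mono) (auto simp: max_def)
    also have "\<dots> = ?h 1" using k h1 by (simp add: y0_def)
    finally have "\<exists>x. 0 \<le> x \<and> x \<le> 1 \<and> ?h x = k / max y y0"
      using pos continuous_on_subset[OF continuous_on_lap_tail, of "{0..1}"] by (intro IVT') auto
    then obtain x where x: "0 \<le> x" "?h x = k / max y y0" by blast
    with pos have "x \<noteq> 0" by (metis lap_tail_zero less_irrefl)
    then show "\<exists>s. 0 < s \<and> ?h s = k / max y y0" using x by (intro exI[of _ x]) auto
  qed
  have spos: "0 < s y" for y using s[of y] by blast
  have cmp: "u < v" if "?h u < ?h v" "0 < v" for u v
    using that lap_tail_mono[of v u] by force
  define b where "b y = 1 / s y" for y
  have bpos: "0 < b y" for y using spos[of y] by (simp add: b_def)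
  have mono: "mono b"
  proof (rule monoI)
    fix x y :: real assume xy: "x \<le> y"
    show "b x \<le> b y"
    proof (cases "max x y0 = max y y0")
      \<comment> \<open>The choice depends on \<open>y\<close> only through \<open>max y y0\<close>,
        so both points get the same witness.\<close>
      case True
      then show ?thesis by (simp add: b_def s_def)
    next
      case False
      then have "max x y0 < max y y0" using xy by (auto simp: max_def split: if_splits)
      then have "?h (s y) < ?h (s x)"
      proof -
        have "0 < max x y0" "0 < max y y0" using y0 by (simp_all add: less_max_iff_disj)
        with \<open>max x y0 < max y y0\<close> have "k / max y y0 < k / max x y0"
          using k by (intro divide_strict_left_mono mult_pos_pos)
        then show ?thesis using s by metis
      qed
      then have "s y < s x" by (rule cmp) (use s in blast)
      then show ?thesis using spos[of y] spos[of x] unfolding b_def by (intro frac_le) auto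
    qed
  qed
  have hs: "?h (s y) = k / y" if "y0 \<le> y" for y using s[of y] that by (simp add: max_def)
  have slim: "\<forall>\<^sub>F y in at_top. s y < e" if e: "0 < e" for e
    using eventually_gt_at_top[of "k / ?h e"] eventually_ge_at_top[of y0]
  proof eventually_elim
    case (elim y)
    have he: "0 < ?h e" by (rule lap_tail_pos[OF nz e])
    have "k / y < ?h e" using elim he y0 by (simp add: field_simps)
    then have "?h (s y) < ?h e" using elim hs[of y] by simp
    then show ?case using e by (rule cmp)
  qed
  have sright: "filterlim s (at_right 0) at_top"
    unfolding filterlim_at
  proof
    show "\<forall>\<^sub>F y in at_top. s y \<in> {0<..} \<and> s y \<noteq> 0"
      by (intro always_eventually allI) (metis spos greaterThan_iff less_irrefl)
    show "(s \<longlongrightarrow> 0) at_top"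
    proof (rule order_tendstoI)
      fix a :: real assume "a < 0"
      then show "\<forall>\<^sub>F y in at_top. a < s y" using spos by (intro always_eventually allI) (meson order_less_trans)
    qed (rule slim)
  qed
  show thesis
  proof
    show "mono b" "0 < b y" "0 < y0" for y by (fact mono bpos y0)+
    show "?h (1 / b y) = k / y" if "y0 \<le> y" for y using hs[OF that] by (simp add: b_def)
    show "filterlim b at_top at_top"
      unfolding filterlim_at_top
    proof
      fix Z :: real
      have "\<forall>\<^sub>F y in at_top. s y < 1 / (\<bar>Z\<bar> + 1)" by (rule slim) simp
      then show "\<forall>\<^sub>F y in at_top. Z \<le> b y"
      proof eventually_elim
        case (elim y)
        then have "\<bar>Z\<bar> + 1 < b y" using spos[of y] by (simp add: b_def field_simps)
        then show ?case by linarith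
      qed
    qed
    fix c :: real assume c: "0 < c"
    have ev: "\<forall>\<^sub>F y in at_top. y0 \<le> y \<and> y0 \<le> c * y"
      using eventually_ge_at_top[of y0] eventually_ge_at_top[of "y0 / c"]
      by eventually_elim (use c in \<open>simp add: field_simps\<close>)
    have lim: "((\<lambda>y. ?h (1 / a * s y) / ?h (s y)) \<longlongrightarrow> (1 / a) powr p) at_top" if "0 < a" for a
    proof -
      have "((\<lambda>u. ?h (1 / a * u) / ?h u) \<longlongrightarrow> (1 / a) powr p) (at_right 0)"
        using rv[unfolded regularly_varying_0_def, rule_format, of "1 / a"] that by simp
      from filterlim_compose[OF this sright] show ?thesis .
    qed
    have cp: "(c powr (1 / p)) powr p = c" using p c by (simp add: powr_powr)
    have inv: "(1 / a) powr p = 1 / a powr p" if "0 < a" for a :: real using that by (simp add: powr_divide)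
    have hc: "?h (s (c * y)) = 1 / c * ?h (s y)" if "y0 \<le> y \<and> y0 \<le> c * y" for y
      using that c by (simp add: hs)
    show "((\<lambda>y. b (c * y) / b y) \<longlongrightarrow> c powr (1 / p)) at_top"
    proof (rule order_tendstoI)
      fix a assume a: "c powr (1 / p) < a"
      have "0 < c powr (1 / p)" using c by simp
      then have a0: "0 < a" using a by linarith
      have "(c powr (1 / p)) powr p < a powr p" using a p c by (intro powr_less_mono2) auto
      then have "(1 / a) powr p < 1 / c"
        unfolding cp inv[OF a0] using c a0 by (intro divide_strict_left_mono) auto
      from order_tendstoD(2)[OF lim[OF a0] this] ev
      show "\<forall>\<^sub>F y in at_top. b (c * y) / b y < a"
      proof eventually_elim
        case (elim y)
        have hp: "0 < ?h (s y)" by (rule lap_tail_pos[OF nz]) (use s in blast)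
        have "?h (1 / a * s y) < ?h (s (c * y))"
          unfolding hc[OF elim(2)] using elim(1) hp by (simp add: divide_less_eq)
        then have "1 / a * s y < s (c * y)" by (rule cmp) (use s in blast)
        then show ?case using spos[of y] spos[of "c * y"] a0 by (simp add: b_def field_simps)
      qed
    next
      fix a assume a: "a < c powr (1 / p)"
      show "\<forall>\<^sub>F y in at_top. a < b (c * y) / b y"
      proof (cases "0 < a")
        case False
        have "a < b (c * y) / b y" for y
          using divide_pos_pos[OF bpos[of "c * y"] bpos[of y]] False by linarith
        then show ?thesis by (intro always_eventually allI)
      next
        case a0: True
        have "a powr p < (c powr (1 / p)) powr p" using a p a0 by (intro powr_less_mono2) auto
        then have "1 / c < (1 / a) powr p"
          unfolding cp inv[OF a0] using a0 c by (intro divide_strict_left_mono) auto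
        from order_tendstoD(1)[OF lim[OF a0] this] ev
        show ?thesis
        proof eventually_elim
          case (elim y)
          have hp: "0 < ?h (s y)" by (rule lap_tail_pos[OF nz]) (use s in blast)
          have "?h (s (c * y)) < ?h (1 / a * s y)"
            unfolding hc[OF elim(2)] using elim(1) hp by (simp add: less_divide_eq)
          then have "s (c * y) < 1 / a * s y" by (rule cmp) (use s[of y] a0 in \<open>intro mult_pos_pos; simp\<close>)
          then show ?case using spos[of y] spos[of "c * y"] a0 by (simp add: b_def field_simps)
        qed
      qed
    qed
  qed
qed

text \<open>With \<alpha> = 2 p this is the factor K for which n^(1 / \<alpha>) K(n) is the root of
  b(n) for n > 0. Monotonicity of \<open>b\<close> supplies the measurability.\<close>

lemma slowly_varying_sqrt_quotient:
  assumes b: "mono b" "\<And>y. 0 < b y"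
    and lim: "\<And>c. 0 < c \<Longrightarrow> ((\<lambda>y. b (c * y) / b y) \<longlongrightarrow> c powr (1 / p)) at_top"
    and p: "0 < p"
  shows "slowly_varying (\<lambda>x. sqrt (b x) / x powr (1 / (2 * p)))"
  unfolding slowly_varying_def
proof (intro conjI allI impI)
  have [measurable]: "b \<in> borel_measurable borel" using b(1) by (rule borel_measurable_mono)
  show "(\<lambda>x. sqrt (b x) / x powr (1 / (2 * p))) \<in> borel_measurable borel" by measurable
  show "0 < sqrt (b x) / x powr (1 / (2 * p))" if "0 < x" for x using b that by simp
  fix c :: real assume c: "0 < c"
  have "((\<lambda>y. sqrt (b (c * y) / b y) / c powr (1 / (2 * p))) \<longlongrightarrow> sqrt (c powr (1 / p)) / c powr (1 / (2 * p))) at_top"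
    using c by (intro tendsto_intros lim) auto
  moreover have "sqrt (c powr (1 / p)) = c powr (1 / (2 * p))"
    using c by (simp add: powr_half_sqrt[symmetric] powr_powr mult.commute)
  ultimately have "((\<lambda>y. sqrt (b (c * y) / b y) / c powr (1 / (2 * p))) \<longlongrightarrow> 1) at_top" using c by simp
  moreover have "\<forall>\<^sub>F y in at_top. sqrt (b (c * y) / b y) / c powr (1 / (2 * p))
      = (sqrt (b (c * y)) / (c * y) powr (1 / (2 * p))) / (sqrt (b y) / y powr (1 / (2 * p)))"
    using eventually_gt_at_top[of 0]
    by eventually_elim (use c in \<open>simp add: real_sqrt_divide powr_mult\<close>)
  ultimately show "((\<lambda>x. (sqrt (b (c * x)) / (c * x) powr (1 / (2 * p))) / (sqrt (b x) / x powr (1 / (2 * p)))) \<longlongrightarrow> 1) at_top"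
    by (rule Lim_transform_eventually)
qed

section \<open>Bounded functionals of a stationary Gaussian series\<close>

lemma (in prob_space) gaussian_law_centered:
  fixes Z :: "'a \<Rightarrow> real"
  assumes [measurable]: "Z \<in> borel_measurable M"
    and g: "gaussian_law (distr M borel Z)" and mean: "expectation Z = 0"
  shows "integrable M (\<lambda>\<omega>. (Z \<omega>)\<^sup>2)"
    and "expectation (\<lambda>\<omega>. cos (Z \<omega>)) = exp (- (expectation (\<lambda>\<omega>. (Z \<omega>)\<^sup>2) / 2))"
proof -
  have "integrable M (\<lambda>\<omega>. (Z \<omega>)\<^sup>2) \<and>
    expectation (\<lambda>\<omega>. cos (Z \<omega>)) = exp (- (expectation (\<lambda>\<omega>. (Z \<omega>)\<^sup>2) / 2))"
    using g unfolding gaussian_law_def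
  proof (elim disjE exE conjE)
    fix m assume d: "distr M borel Z = return borel m"
    have i: "expectation (\<lambda>\<omega>. f (Z \<omega>)) = f m" if "f \<in> borel_measurable borel" for f :: "real \<Rightarrow> real"
      using that by (subst integral_distr[symmetric, where N=borel and f=f]) (auto simp: d integral_return)
    have "m = 0" using i[of "\<lambda>x. x"] mean by simp
    have "AE x in return borel m. x = 0" using \<open>m = 0\<close> by (subst AE_return) auto
    then have "AE \<omega> in M. Z \<omega> = 0" unfolding d[symmetric] by (subst (asm) AE_distr_iff) auto
    then have "integrable M (\<lambda>\<omega>. (Z \<omega>)\<^sup>2) \<longleftrightarrow> integrable M (\<lambda>\<omega>. 0::real)"
      by (intro integrable_cong_AE) auto
    then show ?thesis using i[of cos] i[of "\<lambda>x. x\<^sup>2"] \<open>m = 0\<close> by simp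
  next
    fix m s assume s: "0 < s" and d: "distr M borel Z = density lborel (\<lambda>x. ennreal (normal_density m s x))"
    have dist: "distributed M lborel Z (normal_density m s)"
      unfolding distributed_def using d by (auto simp: distr_cong[of M M lborel borel Z Z])
    have "expectation Z = m" using normal_distributed_expectation[OF s dist] .
    then have m: "m = 0" using mean by simp
    define V where "V \<omega> = Z \<omega> / s" for \<omega>
    have [measurable]: "V \<in> borel_measurable M" unfolding V_def by measurable
    have "distributed M lborel V std_normal_density"
      using normal_standard_normal_convert[OF s, of Z m] dist m s by (simp add: V_def[abs_def])
    then have dV: "distr M borel V = std_gauss"
      unfolding distributed_def by (auto simp: distr_cong[of M M borel lborel V V])
    have Z: "Z \<omega> = s * V \<omega>" for \<omega> using s by (simp add: V_def)
    have "expectation (\<lambda>\<omega>. (V \<omega>)\<^sup>2) = (LINT t|std_gauss. t\<^sup>2)"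
      unfolding dV[symmetric] by (subst integral_distr) auto
    also have "\<dots> = 1" using std_normal_distribution_even_moments(1)[of 1] by simp
    finally have V2: "expectation (\<lambda>\<omega>. (V \<omega>)\<^sup>2) = 1" .
    have "integrable std_gauss (\<lambda>t. t\<^sup>2)" by (rule integrable_std_normal_distribution_moment)
    then have iV: "integrable M (\<lambda>\<omega>. (V \<omega>)\<^sup>2)"
      unfolding dV[symmetric] by (subst (asm) integrable_distr_eq) auto
    have "expectation (\<lambda>\<omega>. cos (Z \<omega>)) = (LINT t|std_gauss. cos (s * t))"
      unfolding dV[symmetric] Z by (subst integral_distr) auto
    then show ?thesis
      using iV V2 by (simp add: Z power_mult_distrib integral_cos_std_normal)
  qed
  then show "integrable M (\<lambda>\<omega>. (Z \<omega>)\<^sup>2)"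
    "expectation (\<lambda>\<omega>. cos (Z \<omega>)) = exp (- (expectation (\<lambda>\<omega>. (Z \<omega>)\<^sup>2) / 2))" by auto
qed

text \<open>Convexity of exp on the segments from 0 to \<open>y\<close> and from 0 to
  \<open>- y\<close>. It makes the covariance bound for cosines linear in the correlation
  \<open>r\<close>.\<close>

lemma cosh_mult_minus_one_le:
  fixes y r :: real
  assumes r: "0 \<le> r" "r \<le> 1"
  shows "(exp (r * y) + exp (- (r * y))) / 2 - 1 \<le> r * ((exp y + exp (- y)) / 2 - 1)"
proof -
  have "exp ((1 - r) *\<^sub>R 0 + r *\<^sub>R z) \<le> (1 - r) * exp 0 + r * exp z" for z :: real
    using r by (intro convex_onD[OF exp_convex]) auto
  from this[of y] this[of "- y"]
  have "exp (r * y) \<le> 1 - r + r * exp y" "exp (- (r * y)) \<le> 1 - r + r * exp (- y)" by simp_all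
  then have "(exp (r * y) + exp (- (r * y))) / 2 - 1 \<le> (r * exp y + r * exp (- y)) / 2 - r"
    by (simp add: field_simps)
  also have "\<dots> = r * ((exp y + exp (- y)) / 2 - 1)"
    by (simp add: distrib_left right_diff_distrib)
  finally show ?thesis .
qed

text \<open>For fixed \<open>i\<close> the differences j - i are distinct and less than n in
  modulus.\<close>

lemma sum_sum_diff_le:
  fixes f :: "int \<Rightarrow> real"
  assumes "\<And>h. 0 \<le> f h"
  shows "(\<Sum>i=1..int n. \<Sum>j=1..int n. f (j - i)) \<le> real n * (\<Sum>h\<in>{h. \<bar>h\<bar> < int n}. f h)"
proof -
  have fin: "finite {h. \<bar>h\<bar> < int n}"
    by (rule finite_subset[of _ "{- int n..int n}"]) auto
  have "(\<Sum>j=1..int n. f (j - i)) \<le> (\<Sum>h\<in>{h. \<bar>h\<bar> < int n}. f h)" if "i \<in> {1..int n}" for i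
  proof -
    have "(\<Sum>j=1..int n. f (j - i)) = (\<Sum>h\<in>(\<lambda>j. j - i) ` {1..int n}. f h)"
      by (subst sum.reindex) (auto simp: inj_on_def)
    also have "\<dots> \<le> (\<Sum>h\<in>{h. \<bar>h\<bar> < int n}. f h)"
      using that fin assms by (intro sum_mono2) auto
    finally show ?thesis .
  qed
  then have "(\<Sum>i=1..int n. \<Sum>j=1..int n. f (j - i)) \<le> (\<Sum>i=1..int n. \<Sum>h\<in>{h. \<bar>h\<bar> < int n}. f h)"
    by (intro sum_mono) auto
  then show ?thesis by simp
qed

locale stationary_gaussian = prob_space +
  fixes G :: "int \<Rightarrow> 'a \<Rightarrow> real" and R :: "int \<Rightarrow> real"
  assumes stationary: "stationary_series M G"
    and gaussian: "gaussian_series M G"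
    and mean: "\<And>t. expectation (G t) = 0"
    and R_eq: "\<And>k. R k = covariance M (G 0) (G k)"
begin

lemma G_measurable [measurable]: "G t \<in> borel_measurable M"
  using stationary by (simp add: stationary_series_def)

lemma G_path_measurable [measurable]:
  "(\<lambda>\<omega> t. G (t + h) \<omega>) \<in> measurable M (PiM UNIV (\<lambda>_. borel))"
  "(\<lambda>\<omega> t. G t \<omega>) \<in> measurable M (PiM UNIV (\<lambda>_. borel))"
  by (rule measurable_PiM_single'; simp)+

lemma expectation_shift:
  fixes f :: "(int \<Rightarrow> real) \<Rightarrow> real"
  assumes [measurable]: "f \<in> borel_measurable (PiM UNIV (\<lambda>_. borel))"
  shows "expectation (\<lambda>\<omega>. f (\<lambda>t. G (t + h) \<omega>)) = expectation (\<lambda>\<omega>. f (\<lambda>t. G t \<omega>))"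
proof -
  have "expectation (\<lambda>\<omega>. f (\<lambda>t. G (t + h) \<omega>)) = integral\<^sup>L (distr M (PiM UNIV (\<lambda>_. borel)) (\<lambda>\<omega> t. G (t + h) \<omega>)) f"
    by (subst integral_distr) auto
  also have "\<dots> = integral\<^sup>L (distr M (PiM UNIV (\<lambda>_. borel)) (\<lambda>\<omega> t. G t \<omega>)) f"
    using stationary by (simp add: stationary_series_def)
  also have "\<dots> = expectation (\<lambda>\<omega>. f (\<lambda>t. G t \<omega>))"
    by (subst integral_distr) auto
  finally show ?thesis .
qed

lemma expectation_marginal:
  fixes f :: "real \<Rightarrow> real"
  assumes [measurable]: "f \<in> borel_measurable borel"
  shows "expectation (\<lambda>\<omega>. f (G t \<omega>)) = expectation (\<lambda>\<omega>. f (G 0 \<omega>))"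
  using expectation_shift[of "\<lambda>g. f (g 0)" t] by simp

lemma integrable_square_G: "integrable M (\<lambda>\<omega>. (G t \<omega>)\<^sup>2)"
proof (rule gaussian_law_centered)
  have "gaussian_law (distr M borel (\<lambda>\<omega>. \<Sum>t\<in>{t}. 1 * G t \<omega>))"
    using gaussian unfolding gaussian_series_def by (elim conjE allE[of _ "{t}"] allE[of _ "\<lambda>_. 1"]) auto
  then show "gaussian_law (distr M borel (G t))" by simp
qed (simp_all add: mean)

lemma integrable_G: "integrable M (G t)"
  by (rule square_integrable_imp_integrable) (auto intro: integrable_square_G)

lemma integrable_mult_G: "integrable M (\<lambda>\<omega>. G s \<omega> * G t \<omega>)"
proof (rule Bochner_Integration.integrable_bound)
  show "integrable M (\<lambda>\<omega>. (G s \<omega>)\<^sup>2 + (G t \<omega>)\<^sup>2)"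
    by (intro Bochner_Integration.integrable_add integrable_square_G)
  have "\<bar>x * y\<bar> \<le> x\<^sup>2 + y\<^sup>2" for x y :: real
  proof -
    have "2 * (\<bar>x\<bar> * \<bar>y\<bar>) \<le> x\<^sup>2 + y\<^sup>2"
      using zero_le_power2[of "\<bar>x\<bar> - \<bar>y\<bar>"] unfolding power2_diff by simp
    moreover have "0 \<le> \<bar>x\<bar> * \<bar>y\<bar>" by simp
    ultimately show ?thesis unfolding abs_mult by linarith
  qed
  then show "AE \<omega> in M. norm (G s \<omega> * G t \<omega>) \<le> norm ((G s \<omega>)\<^sup>2 + (G t \<omega>)\<^sup>2)"
    by (intro AE_I2) simp
qed auto

lemma expectation_mult_G: "expectation (\<lambda>\<omega>. G i \<omega> * G j \<omega>) = R (j - i)"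
proof -
  have "expectation (\<lambda>\<omega>. G i \<omega> * G j \<omega>) = expectation (\<lambda>\<omega>. G 0 \<omega> * G (j - i) \<omega>)"
    using expectation_shift[of "\<lambda>g. g 0 * g (j - i)" i] by simp
  then show ?thesis by (simp add: R_eq covariance_def mean)
qed

lemma expectation_cos_combination:
  "expectation (\<lambda>\<omega>. cos (a * G i \<omega> + b * G j \<omega>)) = exp (- ((a\<^sup>2 * R 0 + b\<^sup>2 * R 0 + 2 * a * b * R (j - i)) / 2))"
proof -
  have law: "gaussian_law (distr M borel (\<lambda>\<omega>. a * G i \<omega> + b * G j \<omega>))"
  \<comment> \<open>For i = j the index set \<open>{i, j}\<close> has a single element, so the
    coefficients must be added beforehand.\<close>
  proof (cases "i = j")
    case True
    have "gaussian_law (distr M borel (\<lambda>\<omega>. \<Sum>t\<in>{i}. (a + b) * G t \<omega>))"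
      using gaussian unfolding gaussian_series_def by (elim conjE allE[of _ "{i}"] allE[of _ "\<lambda>_. a + b"]) auto
    then show ?thesis using True by (simp add: distrib_right)
  next
    case False
    have "gaussian_law (distr M borel (\<lambda>\<omega>. \<Sum>t\<in>{i, j}. (if t = i then a else b) * G t \<omega>))"
      using gaussian unfolding gaussian_series_def
      by (elim conjE allE[of _ "{i, j}"] allE[of _ "\<lambda>t. if t = i then a else b"]) auto
    then show ?thesis using False by simp
  qed
  have m: "expectation (\<lambda>\<omega>. a * G i \<omega> + b * G j \<omega>) = 0"
    using integrable_G mean by simp
  have "expectation (\<lambda>\<omega>. (a * G i \<omega> + b * G j \<omega>)\<^sup>2)
      = expectation (\<lambda>\<omega>. a\<^sup>2 * (G i \<omega> * G i \<omega>) + b\<^sup>2 * (G j \<omega> * G j \<omega>) + 2 * a * b * (G i \<omega> * G j \<omega>))"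
    by (intro Bochner_Integration.integral_cong) (auto simp: power2_eq_square algebra_simps)
  also have "\<dots> = a\<^sup>2 * R 0 + b\<^sup>2 * R 0 + 2 * a * b * R (j - i)"
    by (simp add: integrable_mult_G expectation_mult_G)
  finally show ?thesis
    using gaussian_law_centered(2)[OF _ law m] by simp
qed

text \<open>Expand the second moments of G 0 + G k and G 0 - G k, which are nonnegative; both signs
  are handled by a \<open>c\<close> with c^2 = 1.\<close>

lemma abs_R_le: "\<bar>R k\<bar> \<le> R 0"
proof -
  have "0 \<le> 2 * R 0 + 2 * c * R k" if c: "c * c = 1" for c
  proof -
    have "0 \<le> expectation (\<lambda>\<omega>. (G 0 \<omega> + c * G k \<omega>)\<^sup>2)"
      by (rule Bochner_Integration.integral_nonneg) simp
    also have "\<dots> = expectation (\<lambda>\<omega>. G 0 \<omega> * G 0 \<omega> + c * c * (G k \<omega> * G k \<omega>) + 2 * c * (G 0 \<omega> * G k \<omega>))"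
      by (intro Bochner_Integration.integral_cong) (auto simp: power2_eq_square algebra_simps)
    also have "\<dots> = 2 * R 0 + 2 * c * R k"
      unfolding c by (simp add: integrable_mult_G expectation_mult_G)
    finally show ?thesis .
  qed
  from this[of 1] this[of "-1"] show ?thesis by auto
qed

lemma expectation_cos_G: "expectation (\<lambda>\<omega>. cos (\<theta> * G t \<omega>)) = exp (- (\<theta>\<^sup>2 * R 0 / 2))"
  using expectation_cos_combination[of \<theta> t 0 t] by simp

text \<open>With y = \<theta>^2 R(0) and r the modulus of the correlation, the covariance is exp(-
  y) (cosh(r y) - 1), and exp(- y) (cosh y - 1) = (1 - exp(- y))^2 / 2. The square is comparable to
  the squared mean of 1 - cos, which keeps the later error proportional to the mean.\<close>

lemma covariance_cos_le:
  assumes R0: "0 < R 0"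
  shows "expectation (\<lambda>\<omega>. cos (\<theta> * G i \<omega>) * cos (\<theta> * G j \<omega>)) - (exp (- (\<theta>\<^sup>2 * R 0 / 2)))\<^sup>2
    \<le> \<bar>R (j - i)\<bar> / R 0 * ((1 - exp (- (\<theta>\<^sup>2 * R 0)))\<^sup>2 / 2)"
proof -
  define y where "y = \<theta>\<^sup>2 * R 0"
  define r where "r = \<bar>R (j - i)\<bar> / R 0"
  have r: "0 \<le> r" "r \<le> 1" using R0 abs_R_le[of "j - i"] by (auto simp: r_def)
  have bnd: "integrable M (\<lambda>\<omega>. cos (f \<omega>))" if [measurable]: "f \<in> borel_measurable M" for f :: "'a \<Rightarrow> real"
    by (rule integrable_const_bound[where B=1]) auto
  have "expectation (\<lambda>\<omega>. cos (\<theta> * G i \<omega>) * cos (\<theta> * G j \<omega>))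
     = expectation (\<lambda>\<omega>. (cos (\<theta> * G i \<omega> + - \<theta> * G j \<omega>) + cos (\<theta> * G i \<omega> + \<theta> * G j \<omega>)) / 2)"
    by (simp add: cos_times_cos)
  also have "\<dots> = (expectation (\<lambda>\<omega>. cos (\<theta> * G i \<omega> + - \<theta> * G j \<omega>)) + expectation (\<lambda>\<omega>. cos (\<theta> * G i \<omega> + \<theta> * G j \<omega>))) / 2"
    by (subst integral_divide_zero, subst Bochner_Integration.integral_add) (auto intro!: bnd)
  also have "\<dots> = exp (- y) * ((exp (\<theta>\<^sup>2 * R (j - i)) + exp (- (\<theta>\<^sup>2 * R (j - i)))) / 2)"
  proof -
    have "- ((\<theta>\<^sup>2 * R 0 + (- \<theta>)\<^sup>2 * R 0 + 2 * \<theta> * - \<theta> * R (j - i)) / 2) = - y + \<theta>\<^sup>2 * R (j - i)"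
      "- ((\<theta>\<^sup>2 * R 0 + \<theta>\<^sup>2 * R 0 + 2 * \<theta> * \<theta> * R (j - i)) / 2) = - y + - (\<theta>\<^sup>2 * R (j - i))"
      by (simp_all add: y_def power2_eq_square diff_divide_distrib add_divide_distrib mult.assoc)
    then show ?thesis unfolding expectation_cos_combination by (simp only: exp_add distrib_left[symmetric] times_divide_eq_right)
  qed
  also have "exp (\<theta>\<^sup>2 * R (j - i)) + exp (- (\<theta>\<^sup>2 * R (j - i))) = exp (r * y) + exp (- (r * y))"
    using R0 by (cases "0 \<le> R (j - i)") (auto simp: r_def y_def mult.commute)
  finally have 1: "expectation (\<lambda>\<omega>. cos (\<theta> * G i \<omega>) * cos (\<theta> * G j \<omega>)) = exp (- y) * ((exp (r * y) + exp (- (r * y))) / 2)" .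
  have 2: "(exp (- (\<theta>\<^sup>2 * R 0 / 2)))\<^sup>2 = exp (- y)"
    by (simp add: y_def exp_double[symmetric])
  have "exp (- y) * ((exp (r * y) + exp (- (r * y))) / 2 - 1) \<le> exp (- y) * (r * ((exp y + exp (- y)) / 2 - 1))"
    by (intro mult_left_mono cosh_mult_minus_one_le r) simp
  also have "\<dots> = r * ((1 - exp (- y))\<^sup>2 / 2)"
    by (simp add: power2_eq_square algebra_simps add_divide_distrib flip: exp_add)
  finally show ?thesis unfolding 1 2 by (simp add: y_def r_def right_diff_distrib)
qed

text \<open>Let m be the mean of the cosine. Summing the covariances gives a second moment of order
  n (sum of |R h|) (1 - m)^2, through 1 - m^2 \<le> 2 (1 - m), and its root bounds the first
  absolute moment.\<close>

theorem expectation_abs_sum_cos_le: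
  assumes R0: "0 < R 0"
  shows "expectation (\<lambda>\<omega>. \<bar>\<Sum>t=1..int n. cos (\<theta> * G t \<omega>) - exp (- (\<theta>\<^sup>2 * R 0 / 2))\<bar>)
    \<le> sqrt (2 * real n * (\<Sum>h\<in>{h. \<bar>h\<bar> < int n}. \<bar>R h\<bar>) / R 0) * (1 - exp (- (\<theta>\<^sup>2 * R 0 / 2)))"
proof -
  define m where "m = exp (- (\<theta>\<^sup>2 * R 0 / 2))"
  define Q where "Q = (\<Sum>h\<in>{h. \<bar>h\<bar> < int n}. \<bar>R h\<bar>)"
  define c where "c t \<omega> = cos (\<theta> * G t \<omega>) - m" for t \<omega>
  define S where "S \<omega> = (\<Sum>t=1..int n. c t \<omega>)" for \<omega>
  have [measurable]: "c t \<in> borel_measurable M" for t unfolding c_def by measurable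
  have [measurable]: "S \<in> borel_measurable M" unfolding S_def by measurable
  have m01: "0 < m" "m \<le> 1" using R0 by (auto simp: m_def)
  have Q0: "0 \<le> Q" unfolding Q_def by (intro sum_nonneg) auto
  have cb: "\<bar>c t \<omega>\<bar> \<le> 2" for t \<omega>
    using m01 cos_le_one[of "\<theta> * G t \<omega>"] cos_ge_minus_one[of "\<theta> * G t \<omega>"] unfolding c_def by linarith
  have icos: "integrable M (\<lambda>\<omega>. cos (\<theta> * G t \<omega>))" for t
    by (rule integrable_const_bound[where B=1]) auto
  have icc: "integrable M (\<lambda>\<omega>. cos (\<theta> * G i \<omega>) * cos (\<theta> * G j \<omega>))" for i j
    by (rule integrable_const_bound[where B=1]) (auto simp: abs_mult intro!: AE_I2 mult_le_one)
  have ic: "integrable M (\<lambda>\<omega>. c i \<omega> * c j \<omega>)" for i j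
    by (rule integrable_const_bound[where B=4])
       (use cb[of i] cb[of j] mult_mono[of "\<bar>c i _\<bar>" 2 "\<bar>c j _\<bar>" 2] in \<open>auto simp: abs_mult\<close>)
  have cov: "expectation (\<lambda>\<omega>. c i \<omega> * c j \<omega>) \<le> \<bar>R (j - i)\<bar> / R 0 * ((1 - m\<^sup>2)\<^sup>2 / 2)" for i j
  proof -
    have "expectation (\<lambda>\<omega>. c i \<omega> * c j \<omega>)
      = expectation (\<lambda>\<omega>. cos (\<theta> * G i \<omega>) * cos (\<theta> * G j \<omega>) - m * cos (\<theta> * G i \<omega>) - m * cos (\<theta> * G j \<omega>) + m\<^sup>2)"
      by (intro Bochner_Integration.integral_cong) (auto simp: c_def power2_eq_square algebra_simps)
    also have "\<dots> = expectation (\<lambda>\<omega>. cos (\<theta> * G i \<omega>) * cos (\<theta> * G j \<omega>)) - m\<^sup>2"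
      using prob_space icos icc by (simp add: expectation_cos_G flip: m_def) (simp add: power2_eq_square)
    also have "\<dots> \<le> \<bar>R (j - i)\<bar> / R 0 * ((1 - exp (- (\<theta>\<^sup>2 * R 0)))\<^sup>2 / 2)"
      unfolding m_def by (rule covariance_cos_le[OF R0])
    also have "exp (- (\<theta>\<^sup>2 * R 0)) = m\<^sup>2" by (simp add: m_def exp_double[symmetric])
    finally show ?thesis .
  qed
  have S2: "(S \<omega>)\<^sup>2 = (\<Sum>i=1..int n. \<Sum>j=1..int n. c i \<omega> * c j \<omega>)" for \<omega>
    by (simp add: S_def power2_eq_square sum_product)
  have iS2: "integrable M (\<lambda>\<omega>. (S \<omega>)\<^sup>2)" unfolding S2 by (intro Bochner_Integration.integrable_sum ic)
  have "expectation (\<lambda>\<omega>. (S \<omega>)\<^sup>2) = (\<Sum>i=1..int n. \<Sum>j=1..int n. expectation (\<lambda>\<omega>. c i \<omega> * c j \<omega>))"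
    unfolding S2 by (subst Bochner_Integration.integral_sum, intro Bochner_Integration.integrable_sum ic,
      subst Bochner_Integration.integral_sum, intro ic, rule refl)
  also have "\<dots> \<le> (\<Sum>i=1..int n. \<Sum>j=1..int n. \<bar>R (j - i)\<bar> / R 0 * ((1 - m\<^sup>2)\<^sup>2 / 2))"
    by (intro sum_mono cov)
  also have "\<dots> \<le> real n * (\<Sum>h\<in>{h. \<bar>h\<bar> < int n}. \<bar>R h\<bar> / R 0 * ((1 - m\<^sup>2)\<^sup>2 / 2))"
    by (rule sum_sum_diff_le) (use R0 in simp)
  also have "\<dots> = real n * Q / R 0 * ((1 - m\<^sup>2)\<^sup>2 / 2)"
    by (simp add: Q_def sum_distrib_right sum_divide_distrib sum_distrib_left mult_ac)
  also have "\<dots> \<le> real n * Q / R 0 * ((2 * (1 - m))\<^sup>2 / 2)"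
  proof (intro mult_left_mono divide_right_mono power_mono)
    show "1 - m\<^sup>2 \<le> 2 * (1 - m)"
      using zero_le_power2[of "1 - m"] unfolding power2_diff by simp
    show "0 \<le> 1 - m\<^sup>2" using m01 by (simp add: power_le_one)
  qed (use R0 Q0 in auto)
  also have "\<dots> = (2 * real n * Q / R 0) * (1 - m)\<^sup>2"
    unfolding power_mult_distrib by simp
  finally have E2: "expectation (\<lambda>\<omega>. (S \<omega>)\<^sup>2) \<le> (2 * real n * Q / R 0) * (1 - m)\<^sup>2" .
  have iS: "integrable M (\<lambda>\<omega>. \<bar>S \<omega>\<bar>)"
    using square_integrable_imp_integrable[OF _ iS2] by simp
  \<comment> \<open>Jensen's inequality in the form of a nonnegative variance of |S|.\<close>
  have "0 \<le> variance (\<lambda>\<omega>. \<bar>S \<omega>\<bar>)" by (rule variance_positive)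
  also have "\<dots> = expectation (\<lambda>\<omega>. (\<bar>S \<omega>\<bar>)\<^sup>2) - (expectation (\<lambda>\<omega>. \<bar>S \<omega>\<bar>))\<^sup>2"
    by (rule variance_eq) (use iS iS2 in auto)
  finally have "(expectation (\<lambda>\<omega>. \<bar>S \<omega>\<bar>))\<^sup>2 \<le> (2 * real n * Q / R 0) * (1 - m)\<^sup>2" using E2 by simp
  then have "expectation (\<lambda>\<omega>. \<bar>S \<omega>\<bar>) \<le> sqrt ((2 * real n * Q / R 0) * (1 - m)\<^sup>2)"
    by (rule real_le_rsqrt)
  also have "\<dots> = sqrt (2 * real n * Q / R 0) * (1 - m)"
    unfolding real_sqrt_mult[of _ "(1 - m)\<^sup>2"] using m01 by simp
  finally show ?thesis unfolding S_def c_def m_def Q_def .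
qed

end

section \<open>Conditional Laplace transforms\<close>

text \<open>\<open>E\<close> is the law of sqrt(2 |e|) T, with e of law \<open>N\<close> and T an
  independent standard normal variable: given e, the mean of cos(x sqrt(2 |e|) T) is exp(- x^2
  |e|).\<close>

lemma lap_tail_square_eq_char:
  assumes "real_distribution N"
  obtains E where "real_distribution E" "\<And>x. lap_tail N (x\<^sup>2) = (LINT u|E. 1 - cos (x * u))"
proof -
  interpret N: real_distribution N by fact
  interpret T: real_distribution std_gauss by (rule real_dist_normal_dist)
  interpret P: pair_prob_space N std_gauss ..
  let ?f = "\<lambda>z. sqrt (2 * \<bar>fst z\<bar>) * snd z"
  have [measurable]: "?f \<in> borel_measurable (N \<Otimes>\<^sub>M std_gauss)" by measurable
  define E where "E = distr (N \<Otimes>\<^sub>M std_gauss) borel ?f"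
  have E: "real_distribution E" unfolding E_def
    by (intro real_distribution.intro real_distribution_axioms.intro P.prob_space_distr) auto
  have c3: "cos y \<le> 3" for y :: real by (rule order_trans[OF cos_le_one]) simp
  have "lap_tail N (x\<^sup>2) = (LINT u|E. 1 - cos (x * u))" for x
  proof -
    have m: "(\<lambda>z. 1 - cos (x * ?f z)) \<in> borel_measurable (N \<Otimes>\<^sub>M std_gauss)" by measurable
    have "(LINT u|E. 1 - cos (x * u)) = (LINT z|(N \<Otimes>\<^sub>M std_gauss). 1 - cos (x * ?f z))"
      unfolding E_def by (subst integral_distr) auto
    also have "\<dots> = (LINT e|N. (LINT t|std_gauss. 1 - cos (x * ?f (e, t))))"
      by (rule P.integral_fst'[symmetric], rule P.integrable_const_bound[where B=2])
         (use m in \<open>auto intro!: AE_I2 simp: abs_le_iff c3\<close>)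
    also have "\<dots> = (LINT e|N. 1 - exp (- (x\<^sup>2 * \<bar>e\<bar>)))"
    proof (rule Bochner_Integration.integral_cong[OF refl])
      fix e :: real
      have "(LINT t|std_gauss. 1 - cos (x * ?f (e, t))) = (LINT t|std_gauss. 1 - cos ((x * sqrt (2 * \<bar>e\<bar>)) * t))"
        by (simp add: mult.assoc)
      also have "\<dots> = 1 - exp (- ((x * sqrt (2 * \<bar>e\<bar>))\<^sup>2 / 2))"
        using T.integrable_cos T.prob_space by (simp add: integral_cos_std_normal)
      finally show "(LINT t|std_gauss. 1 - cos (x * ?f (e, t))) = 1 - exp (- (x\<^sup>2 * \<bar>e\<bar>))"
        by (simp add: power_mult_distrib)
    qed
    finally show ?thesis by (simp add: lap_tail_def)
  qed
  then show thesis using E that by blast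
qed

lemma (in real_distribution) borel_measurable_lap_tail [measurable]: "lap_tail M \<in> borel_measurable borel"
  unfolding lap_tail_def by measurable

context stationary_gaussian
begin

text \<open>Superposition of the bounds \<open>expectation_abs_sum_cos_le\<close>: the right-hand sides add up to the
  mean of the summand, so no integrability of the mixing law is needed.\<close>

lemma expectation_abs_sum_lap_tail_le:
  assumes N: "real_distribution N" and R0: "0 < R 0" and k: "0 \<le> k"
  shows "expectation (\<lambda>\<omega>. \<bar>(\<Sum>t=1..int n. lap_tail N (k * (G t \<omega>)\<^sup>2)) - real n * expectation (\<lambda>\<omega>. lap_tail N (k * (G 0 \<omega>)\<^sup>2))\<bar>)
    \<le> sqrt (2 * real n * (\<Sum>h\<in>{h. \<bar>h\<bar> < int n}. \<bar>R h\<bar>) / R 0) * expectation (\<lambda>\<omega>. lap_tail N (k * (G 0 \<omega>)\<^sup>2))"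
proof -
  obtain E where E: "real_distribution E" and h: "\<And>x. lap_tail N (x\<^sup>2) = (LINT u|E. 1 - cos (x * u))"
    using lap_tail_square_eq_char[OF N] by blast
  interpret E: real_distribution E by fact
  interpret P: pair_prob_space M E ..
  define q where "q = sqrt (2 * real n * (\<Sum>h\<in>{h. \<bar>h\<bar> < int n}. \<bar>R h\<bar>) / R 0)"
  \<comment> \<open>The mean of cos(sqrt(k) u G t), the same for every \<open>t\<close>; averaging 1
    - m(u) over \<open>E\<close> returns the mean of one summand.\<close>
  define m where "m u = exp (- ((sqrt k * u)\<^sup>2 * R 0 / 2))" for u
  have [measurable]: "m \<in> borel_measurable borel" unfolding m_def by measurable
  have m01: "0 \<le> m u" "m u \<le> 1" for u using R0 by (auto simp: m_def)
  define S where "S \<omega> u = (\<Sum>t=1..int n. cos ((sqrt k * u) * G t \<omega>) - m u)" for \<omega> u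
  have c3: "cos y \<le> 3" for y :: real by (rule order_trans[OF cos_le_one]) simp
  have hG: "lap_tail N (k * (G t \<omega>)\<^sup>2) = (LINT u|E. 1 - cos ((sqrt k * u) * G t \<omega>))" for t \<omega>
    using h[of "sqrt k * G t \<omega>"] k by (simp add: power_mult_distrib mult_ac)
  have icos: "integrable M (\<lambda>\<omega>. cos (\<theta> * G t \<omega>))" for \<theta> t
    by (rule integrable_const_bound[where B=1]) auto
  have mean: "expectation (\<lambda>\<omega>. lap_tail N (k * (G 0 \<omega>)\<^sup>2)) = (LINT u|E. 1 - m u)"
  proof -
    have "expectation (\<lambda>\<omega>. lap_tail N (k * (G 0 \<omega>)\<^sup>2)) = (LINT u|E. expectation (\<lambda>\<omega>. 1 - cos ((sqrt k * u) * G 0 \<omega>)))"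
      unfolding hG by (rule P.Fubini_integral[symmetric], rule P.integrable_const_bound[where B=2])
        (auto intro!: AE_I2 simp: abs_le_iff c3)
    also have "\<dots> = (LINT u|E. 1 - m u)"
      using icos prob_space by (simp add: expectation_cos_G m_def)
    finally show ?thesis .
  qed
  have Sb: "\<bar>S \<omega> u\<bar> \<le> 2 * real n" for \<omega> u
  proof -
    have "\<bar>cos ((sqrt k * u) * G t \<omega>) - m u\<bar> \<le> 2" for t
      using m01[of u] cos_le_one[of "(sqrt k * u) * G t \<omega>"] cos_ge_minus_one[of "(sqrt k * u) * G t \<omega>"] by linarith
    then have "\<bar>S \<omega> u\<bar> \<le> (\<Sum>t=1..int n. 2)"
      unfolding S_def by (intro order_trans[OF sum_abs] sum_mono) auto
    then show ?thesis by simp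
  qed
  have Sm: "(\<lambda>(\<omega>, u). \<bar>S \<omega> u\<bar>) \<in> borel_measurable (M \<Otimes>\<^sub>M E)"
    unfolding S_def by measurable
  have Sint: "integrable (M \<Otimes>\<^sub>M E) (\<lambda>(\<omega>, u). \<bar>S \<omega> u\<bar>)"
    by (rule P.integrable_const_bound[where B="2 * real n"]) (use Sm Sb in auto)
  have [measurable]: "S \<omega> \<in> borel_measurable E" for \<omega> unfolding S_def by measurable
  have SintE: "integrable E (S \<omega>)" for \<omega>
    by (rule E.integrable_const_bound[where B="2 * real n"]) (use Sb in auto)
  have icosE: "integrable E (\<lambda>u. 1 - cos ((sqrt k * u) * y))" for y
    by (rule E.integrable_const_bound[where B=2]) (auto intro!: AE_I2 simp: abs_le_iff c3)
  have imE: "integrable E (\<lambda>u. 1 - m u)"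
    by (rule E.integrable_const_bound[where B=1]) (use m01 in auto)
  have diff: "(\<Sum>t=1..int n. lap_tail N (k * (G t \<omega>)\<^sup>2)) - real n * (LINT u|E. 1 - m u) = - (LINT u|E. S \<omega> u)" for \<omega>
  proof -
    have "(\<Sum>t=1..int n. lap_tail N (k * (G t \<omega>)\<^sup>2)) - real n * (LINT u|E. 1 - m u)
      = (\<Sum>t=1..int n. (LINT u|E. 1 - cos ((sqrt k * u) * G t \<omega>)) - (LINT u|E. 1 - m u))"
      unfolding hG by (simp add: sum_subtractf)
    also have "\<dots> = (\<Sum>t=1..int n. (LINT u|E. (1 - cos ((sqrt k * u) * G t \<omega>)) - (1 - m u)))"
      by (intro sum.cong refl Bochner_Integration.integral_diff[symmetric] icosE imE)
    also have "\<dots> = (LINT u|E. (\<Sum>t=1..int n. (1 - cos ((sqrt k * u) * G t \<omega>)) - (1 - m u)))"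
      by (rule Bochner_Integration.integral_sum[symmetric]) (intro Bochner_Integration.integrable_diff icosE imE)
    also have "\<dots> = (LINT u|E. - S \<omega> u)"
      by (intro Bochner_Integration.integral_cong) (auto simp: S_def sum_negf[symmetric])
    finally show ?thesis by simp
  qed
  have "expectation (\<lambda>\<omega>. \<bar>(\<Sum>t=1..int n. lap_tail N (k * (G t \<omega>)\<^sup>2)) - real n * (LINT u|E. 1 - m u)\<bar>)
    = expectation (\<lambda>\<omega>. \<bar>LINT u|E. S \<omega> u\<bar>)" by (simp add: diff)
  also have "\<dots> \<le> expectation (\<lambda>\<omega>. LINT u|E. \<bar>S \<omega> u\<bar>)"
  proof (rule integral_mono)
    have b: "\<bar>LINT u|E. S \<omega> u\<bar> \<le> (LINT u|E. \<bar>S \<omega> u\<bar>)" for \<omega> by (rule integral_abs_bound)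
    then show "\<bar>LINT u|E. S \<omega> u\<bar> \<le> (LINT u|E. \<bar>S \<omega> u\<bar>)" for \<omega> .
    show i: "integrable M (\<lambda>\<omega>. LINT u|E. \<bar>S \<omega> u\<bar>)"
      using P.integrable_fst'[OF Sint] by simp
    have "(\<lambda>(\<omega>, u). S \<omega> u) \<in> borel_measurable (M \<Otimes>\<^sub>M E)" unfolding S_def by measurable
    then have "(\<lambda>\<omega>. LINT u|E. S \<omega> u) \<in> borel_measurable M" by measurable
    then show "integrable M (\<lambda>\<omega>. \<bar>LINT u|E. S \<omega> u\<bar>)"
      by (intro Bochner_Integration.integrable_bound[OF i]) (auto intro!: AE_I2 order_trans[OF b])
  qed
  also have "\<dots> = (LINT u|E. expectation (\<lambda>\<omega>. \<bar>S \<omega> u\<bar>))"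
    by (rule P.Fubini_integral[symmetric, OF Sint])
  also have "\<dots> \<le> (LINT u|E. q * (1 - m u))"
  proof (rule integral_mono)
    show "integrable E (\<lambda>u. expectation (\<lambda>\<omega>. \<bar>S \<omega> u\<bar>))" by (rule P.integrable_snd[OF Sint])
    show "integrable E (\<lambda>u. q * (1 - m u))" by (intro integrable_mult_right imE)
    show "expectation (\<lambda>\<omega>. \<bar>S \<omega> u\<bar>) \<le> q * (1 - m u)" for u
      unfolding S_def q_def m_def by (rule expectation_abs_sum_cos_le[OF R0])
  qed
  also have "\<dots> = q * (LINT u|E. 1 - m u)" by (rule integral_mult_right_zero)
  finally show ?thesis unfolding mean q_def .
qed

end

section \<open>Products, exponentials and conditioning on the Gaussian path\<close>

lemma abs_one_minus_minus_exp_le: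
  fixes h :: real
  assumes "0 \<le> h"
  shows "\<bar>(1 - h) - exp (- h)\<bar> \<le> h\<^sup>2"
proof -
  have "1 - h \<le> exp (- h)" using exp_ge_add_one_self[of "- h"] by simp
  moreover have "exp (- h) \<le> 1 / (1 + h)"
    using exp_ge_add_one_self[of h] assms by (simp add: exp_minus field_simps)
  moreover have "1 / (1 + h) \<le> 1 - h + h\<^sup>2"
  proof -
    have "0 \<le> h * h * h" using assms by simp
    then have "1 \<le> (1 - h + h\<^sup>2) * (1 + h)" by (simp add: power2_eq_square algebra_simps)
    then show ?thesis using assms by (simp add: divide_le_eq)
  qed
  ultimately show ?thesis by linarith
qed

lemma abs_exp_minus_diff_le:
  fixes x y :: real
  assumes "0 \<le> x" "0 \<le> y"
  shows "\<bar>exp (- x) - exp (- y)\<bar> \<le> \<bar>x - y\<bar>"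
proof -
  have *: "exp (- x) - exp (- y) \<le> \<bar>x - y\<bar>" if "0 \<le> x" for x y :: real
  proof -
    have "1 - \<bar>x - y\<bar> \<le> exp (- \<bar>x - y\<bar>)" using exp_ge_add_one_self[of "- \<bar>x - y\<bar>"] by simp
    also have "\<dots> \<le> exp (x - y)" by simp
    finally have "1 - exp (x - y) \<le> \<bar>x - y\<bar>" by simp
    then have "exp (- x) * (1 - exp (x - y)) \<le> exp (- x) * \<bar>x - y\<bar>" by (intro mult_left_mono) auto
    also have "\<dots> \<le> 1 * \<bar>x - y\<bar>" using that by (intro mult_right_mono) auto
    finally show ?thesis by (simp add: right_diff_distrib flip: exp_add)
  qed
  from *[OF assms(1), of y] *[OF assms(2), of x] show ?thesis by (simp add: abs_minus_commute abs_le_iff)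
qed

text \<open>Factors and exponentials lie in [0, 1], so the two products differ by at most the sum of
  the differences of their factors, each of second order. The rest is the Lipschitz bound for exp(-
  x) on the nonnegative half-line.\<close>

lemma abs_prod_one_minus_exp_le:
  fixes h :: "'i \<Rightarrow> real"
  assumes "\<And>t. t \<in> I \<Longrightarrow> 0 \<le> h t" "\<And>t. t \<in> I \<Longrightarrow> h t \<le> 1" and "0 \<le> m"
  shows "\<bar>(\<Prod>t\<in>I. 1 - h t) - exp (- m)\<bar> \<le> (\<Sum>t\<in>I. (h t)\<^sup>2) + \<bar>(\<Sum>t\<in>I. h t) - m\<bar>"
proof (cases "finite I")
  case True
  have "\<bar>(\<Prod>t\<in>I. 1 - h t) - (\<Prod>t\<in>I. exp (- h t))\<bar> \<le> (\<Sum>t\<in>I. \<bar>(1 - h t) - exp (- h t)\<bar>)"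
    using norm_prod_diff[of I "\<lambda>t. 1 - h t" "\<lambda>t. exp (- h t)"] assms by auto
  also have "\<dots> \<le> (\<Sum>t\<in>I. (h t)\<^sup>2)" by (intro sum_mono abs_one_minus_minus_exp_le assms)
  also have "(\<Prod>t\<in>I. exp (- h t)) = exp (- (\<Sum>t\<in>I. h t))"
    using True by (simp add: exp_sum[symmetric] sum_negf)
  finally have "\<bar>(\<Prod>t\<in>I. 1 - h t) - exp (- (\<Sum>t\<in>I. h t))\<bar> \<le> (\<Sum>t\<in>I. (h t)\<^sup>2)" .
  moreover have "\<bar>exp (- (\<Sum>t\<in>I. h t)) - exp (- m)\<bar> \<le> \<bar>(\<Sum>t\<in>I. h t) - m\<bar>"
    using assms by (intro abs_exp_minus_diff_le sum_nonneg) auto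
  ultimately show ?thesis by linarith
next
  \<comment> \<open>Over an infinite index set the product is one and the sums are zero.\<close>
  case False
  then show ?thesis using abs_exp_minus_diff_le[of 0 m] assms(3) by simp
qed

text \<open>Conditioning on the Gaussian path becomes Fubini on the product of the two path laws:
  for a frozen path \<open>g\<close> the expectation factorizes over the independent
  \<open>e t\<close>. The absolute value keeps the integrand bounded by one for every path.\<close>

lemma (in prob_space) conditional_laplace:
  fixes e G :: "int \<Rightarrow> 'a \<Rightarrow> real"
  assumes ind: "indep_var (PiM UNIV (\<lambda>_. borel)) (\<lambda>\<omega> t. e t \<omega>) (PiM UNIV (\<lambda>_. borel)) (\<lambda>\<omega> t. G t \<omega>)"
    and e_ind: "indep_vars (\<lambda>_. borel) e UNIV"
    and law: "\<And>t. distr M borel (e t) = N" and k: "0 \<le> k"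
  shows "expectation (\<lambda>\<omega>. exp (- (k * (\<Sum>t=1..n. \<bar>e t \<omega>\<bar> * (G t \<omega>)\<^sup>2))))
    = expectation (\<lambda>\<omega>. \<Prod>t=1..n. 1 - lap_tail N (k * (G t \<omega>)\<^sup>2))"
proof -
  let ?P = "PiM UNIV (\<lambda>_::int. borel :: real measure)"
  have [measurable]: "e t \<in> borel_measurable M" for t using e_ind by (auto simp: indep_vars_def)
  have em: "(\<lambda>\<omega> t. e t \<omega>) \<in> measurable M ?P" and Gm: "(\<lambda>\<omega> t. G t \<omega>) \<in> measurable M ?P"
    using indep_var_rv1[OF ind] indep_var_rv2[OF ind] by auto
  note [measurable] = em Gm
  define De where "De = distr M ?P (\<lambda>\<omega> t. e t \<omega>)"
  define DG where "DG = distr M ?P (\<lambda>\<omega> t. G t \<omega>)"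
  interpret De: prob_space De unfolding De_def by (rule prob_space_distr[OF em])
  interpret DG: prob_space DG unfolding DG_def by (rule prob_space_distr[OF Gm])
  interpret P: pair_prob_space De DG ..
  have [measurable_cong]: "sets De = sets ?P" "sets DG = sets ?P" by (simp_all add: De_def DG_def)
  define F where "F x g = exp (- (k * (\<Sum>t=1..n. \<bar>x t\<bar> * (g t)\<^sup>2)))" for x g :: "int \<Rightarrow> real"
  have Fm: "(\<lambda>(x, g). F x g) \<in> borel_measurable (?P \<Otimes>\<^sub>M ?P)" unfolding F_def by measurable
  have Fm': "(\<lambda>(x, g). F x g) \<in> borel_measurable (De \<Otimes>\<^sub>M DG)" unfolding F_def by measurable
  have F01: "0 \<le> F x g" "F x g \<le> 1" for x g
    using k by (auto simp: F_def intro!: mult_nonneg_nonneg sum_nonneg)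
  have prodD: "De \<Otimes>\<^sub>M DG = distr M (?P \<Otimes>\<^sub>M ?P) (\<lambda>\<omega>. (\<lambda>t. e t \<omega>, \<lambda>t. G t \<omega>))"
    using ind unfolding indep_var_distribution_eq De_def DG_def by blast
  have inner: "(LINT x|De. F x g) = (\<Prod>t=1..n. 1 - lap_tail N (k * (g t)\<^sup>2))" for g
  proof -
    have "(LINT x|De. F x g) = expectation (\<lambda>\<omega>. F (\<lambda>t. e t \<omega>) g)"
      unfolding De_def by (rule integral_distr[OF em]) (unfold F_def, measurable)
    also have "\<dots> = expectation (\<lambda>\<omega>. \<Prod>t=1..n. exp (- (k * (g t)\<^sup>2 * \<bar>e t \<omega>\<bar>)))"
      by (intro Bochner_Integration.integral_cong)
         (auto simp: F_def exp_sum[symmetric] sum_distrib_left sum_negf mult_ac)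
    also have "\<dots> = (\<Prod>t=1..n. expectation (\<lambda>\<omega>. exp (- (k * (g t)\<^sup>2 * \<bar>e t \<omega>\<bar>))))"
    proof (rule indep_vars_lebesgue_integral)
      have "indep_vars (\<lambda>_. borel) e {1..n}" by (rule indep_vars_subset[OF e_ind]) simp
      then show "indep_vars (\<lambda>_. borel) (\<lambda>t \<omega>. exp (- (k * (g t)\<^sup>2 * \<bar>e t \<omega>\<bar>))) {1..n}"
        by (rule indep_vars_compose2[where Y="\<lambda>t x. exp (- (k * (g t)\<^sup>2 * \<bar>x\<bar>))"]) measurable
      show "integrable M (\<lambda>\<omega>. exp (- (k * (g t)\<^sup>2 * \<bar>e t \<omega>\<bar>)))" for t
        by (rule integrable_const_bound[where B=1]) (use k in auto)
    qed simp
    also have "\<dots> = (\<Prod>t=1..n. 1 - lap_tail N (k * (g t)\<^sup>2))"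
    proof (rule prod.cong[OF refl])
      fix t
      have i: "integrable M (\<lambda>\<omega>. exp (- (k * (g t)\<^sup>2 * \<bar>e t \<omega>\<bar>)))"
        by (rule integrable_const_bound[where B=1]) (use k in auto)
      have "lap_tail N (k * (g t)\<^sup>2) = expectation (\<lambda>\<omega>. 1 - exp (- (k * (g t)\<^sup>2 * \<bar>e t \<omega>\<bar>)))"
        unfolding lap_tail_def law[of t, symmetric] by (subst integral_distr) auto
      then show "expectation (\<lambda>\<omega>. exp (- (k * (g t)\<^sup>2 * \<bar>e t \<omega>\<bar>))) = 1 - lap_tail N (k * (g t)\<^sup>2)"
        using i prob_space by simp
    qed
    finally show ?thesis .
  qed
  have "expectation (\<lambda>\<omega>. F (\<lambda>t. e t \<omega>) (\<lambda>t. G t \<omega>)) = (LINT z|(De \<Otimes>\<^sub>M DG). (case z of (x, g) \<Rightarrow> F x g))"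
    unfolding prodD by (subst integral_distr) (use Fm in auto)
  also have "\<dots> = (LINT g|DG. (LINT x|De. F x g))"
    by (rule P.integral_snd[symmetric], rule P.integrable_const_bound[where B=1]) (use Fm' F01 in auto)
  also have "\<dots> = (LINT g|DG. (\<Prod>t=1..n. 1 - lap_tail N (k * (g t)\<^sup>2)))" by (simp add: inner)
  also have "\<dots> = expectation (\<lambda>\<omega>. \<Prod>t=1..n. 1 - lap_tail N (k * (G t \<omega>)\<^sup>2))"
    unfolding DG_def lap_tail_def
  proof (rule integral_distr[OF Gm])
    interpret N: prob_space N unfolding law[of 0, symmetric] by (rule prob_space_distr) measurable
    have [measurable_cong]: "sets N = sets borel" unfolding law[of 0, symmetric] by simp
    show "(\<lambda>g. \<Prod>t=1..n. 1 - (LINT x|N. 1 - exp (- (k * (g t)\<^sup>2 * \<bar>x\<bar>)))) \<in> borel_measurable ?P"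
      by measurable
  qed
  finally show ?thesis by (simp add: F_def)
qed

lemma square_powr: "(x\<^sup>2) powr p = \<bar>x\<bar> powr (2 * p)" for x :: real
proof (cases "x = 0")
  case False
  have "x\<^sup>2 = \<bar>x\<bar> powr 2" using False by simp
  then show ?thesis by (simp only: powr_powr)
qed simp

section \<open>Convergence of the conditional Laplace transforms\<close>

context stationary_gaussian
begin

lemma integrable_abs_powr_G:
  assumes "0 < p" "p < 1"
  shows "integrable M (\<lambda>\<omega>. \<bar>G t \<omega>\<bar> powr (2 * p))"
proof (rule Bochner_Integration.integrable_bound)
  show "integrable M (\<lambda>\<omega>. 1 + (G t \<omega>)\<^sup>2)" using integrable_square_G by simp
  have "\<bar>x\<bar> powr (2 * p) \<le> 1 + x\<^sup>2" for x :: real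
  proof (cases "x\<^sup>2 \<le> 1")
    case True
    then have "(x\<^sup>2) powr p \<le> 1" using assms by (intro powr_le1) auto
    then show ?thesis unfolding square_powr using zero_le_power2[of x] by linarith
  next
    case False
    then have "(x\<^sup>2) powr p \<le> (x\<^sup>2) powr 1" using assms by (intro powr_mono) auto
    then show ?thesis unfolding square_powr using False by simp
  qed
  then show "AE \<omega> in M. norm (\<bar>G t \<omega>\<bar> powr (2 * p)) \<le> norm (1 + (G t \<omega>)\<^sup>2)"
    by (intro AE_I2) simp
qed auto

lemma expectation_abs_powr_G_pos:
  assumes p: "0 < p" "p < 1" and R0: "0 < R 0"
  shows "0 < expectation (\<lambda>\<omega>. \<bar>G 0 \<omega>\<bar> powr (2 * p))"
proof -
  have "expectation (\<lambda>\<omega>. \<bar>G 0 \<omega>\<bar> powr (2 * p)) \<noteq> 0"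
  proof
    assume "expectation (\<lambda>\<omega>. \<bar>G 0 \<omega>\<bar> powr (2 * p)) = 0"
    then have "AE \<omega> in M. \<bar>G 0 \<omega>\<bar> powr (2 * p) = 0"
      using integral_nonneg_eq_0_iff_AE[OF integrable_abs_powr_G[OF p, of 0]] by simp
    then have "AE \<omega> in M. G 0 \<omega> * G 0 \<omega> = 0" by eventually_elim simp
    then have "expectation (\<lambda>\<omega>. G 0 \<omega> * G 0 \<omega>) = expectation (\<lambda>\<omega>. 0)"
      by (intro integral_cong_AE) auto
    then show False using expectation_mult_G[of 0 0] R0 by simp
  qed
  moreover have "0 \<le> expectation (\<lambda>\<omega>. \<bar>G 0 \<omega>\<bar> powr (2 * p))"
    by (rule Bochner_Integration.integral_nonneg) simp
  ultimately show ?thesis by linarith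
qed

context
  fixes N :: "real measure" and p s \<kappa> :: real and v :: "nat \<Rightarrow> real"
  assumes N: "real_distribution N" and nz: "\<not> (AE x in N. x = 0)"
    and rv: "regularly_varying_0 p (lap_tail N)"
    and p: "0 < p" and s: "0 < s" and v: "filterlim v (at_right 0) sequentially"
    and vpos: "\<And>n. 0 < v n"
    and lim: "(\<lambda>n. real n * lap_tail N (v n)) \<longlonglongrightarrow> \<kappa>"
begin

interpretation N: real_distribution N by (rule N)

text \<open>An integrable majorant, from concavity of the Laplace kernel and the finite variance of
  \<open>G 0\<close>.\<close>

lemma ratio_bound:
  "norm (lap_tail N (s * v n * (G 0 \<omega>)\<^sup>2) / lap_tail N (v n)) \<le> 1 + s * (G 0 \<omega>)\<^sup>2"
proof -
  have "lap_tail N (s * (G 0 \<omega>)\<^sup>2 * v n) \<le> max 1 (s * (G 0 \<omega>)\<^sup>2) * lap_tail N (v n)"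
    using s vpos[of n] by (intro N.lap_tail_mult_le) auto
  also have "\<dots> \<le> (1 + s * (G 0 \<omega>)\<^sup>2) * lap_tail N (v n)"
    using s N.lap_tail_nonneg[of "v n"] vpos[of n] by (intro mult_right_mono) auto
  finally have "lap_tail N (s * v n * (G 0 \<omega>)\<^sup>2) \<le> (1 + s * (G 0 \<omega>)\<^sup>2) * lap_tail N (v n)"
    by (simp add: mult_ac)
  moreover have "0 \<le> lap_tail N (s * v n * (G 0 \<omega>)\<^sup>2)"
    using s vpos[of n] by (intro N.lap_tail_nonneg mult_nonneg_nonneg) auto
  ultimately show ?thesis using N.lap_tail_pos[OF nz vpos[of n]] by (simp add: divide_le_eq)
qed

lemma ratio_tendsto:
  "(\<lambda>n. lap_tail N (s * v n * (G 0 \<omega>)\<^sup>2) / lap_tail N (v n)) \<longlonglongrightarrow> s powr p * \<bar>G 0 \<omega>\<bar> powr (2 * p)"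
proof (cases "G 0 \<omega> = 0")
  case False
  define c where "c = s * (G 0 \<omega>)\<^sup>2"
  have c: "0 < c" using False s by (simp add: c_def)
  have "((\<lambda>u. lap_tail N (c * u) / lap_tail N u) \<longlongrightarrow> c powr p) (at_right 0)"
    using rv c by (simp add: regularly_varying_0_def)
  from filterlim_compose[OF this v]
  have "(\<lambda>n. lap_tail N (c * v n) / lap_tail N (v n)) \<longlonglongrightarrow> c powr p" .
  moreover have "c powr p = s powr p * \<bar>G 0 \<omega>\<bar> powr (2 * p)"
    using s by (simp add: c_def powr_mult square_powr)
  ultimately show ?thesis by (simp add: c_def mult_ac)
qed (use p in simp)

text \<open>\<open>v n\<close> stands for the inverse square of the norming sequence. The factor
  \<open>real n * lap_tail N (v n)\<close> is split off; what remains is a quotient to which regular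
  variation and dominated convergence apply.\<close>

lemma scaled_mean_tendsto:
  "(\<lambda>n. real n * expectation (\<lambda>\<omega>. lap_tail N (s * v n * (G 0 \<omega>)\<^sup>2)))
    \<longlonglongrightarrow> \<kappa> * (s powr p * expectation (\<lambda>\<omega>. \<bar>G 0 \<omega>\<bar> powr (2 * p)))"
proof -
  have "(\<lambda>n. expectation (\<lambda>\<omega>. lap_tail N (s * v n * (G 0 \<omega>)\<^sup>2) / lap_tail N (v n)))
    \<longlonglongrightarrow> expectation (\<lambda>\<omega>. s powr p * \<bar>G 0 \<omega>\<bar> powr (2 * p))"
    by (rule integral_dominated_convergence[where w="\<lambda>\<omega>. 1 + s * (G 0 \<omega>)\<^sup>2"])
       (use ratio_bound ratio_tendsto integrable_square_G in auto)
  from tendsto_mult[OF lim this]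
  have "(\<lambda>n. real n * lap_tail N (v n) * expectation (\<lambda>\<omega>. lap_tail N (s * v n * (G 0 \<omega>)\<^sup>2) / lap_tail N (v n)))
    \<longlonglongrightarrow> \<kappa> * (s powr p * expectation (\<lambda>\<omega>. \<bar>G 0 \<omega>\<bar> powr (2 * p)))" by simp
  moreover have "real n * lap_tail N (v n) * expectation (\<lambda>\<omega>. lap_tail N (s * v n * (G 0 \<omega>)\<^sup>2) / lap_tail N (v n))
    = real n * expectation (\<lambda>\<omega>. lap_tail N (s * v n * (G 0 \<omega>)\<^sup>2))" for n
    using N.lap_tail_pos[OF nz vpos[of n]] by simp
  ultimately show ?thesis by simp
qed

text \<open>One of the two factors is normalized as in the mean, the other is bounded by one and
  tends to zero.\<close>

lemma scaled_second_moment_tendsto: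
  "(\<lambda>n. real n * expectation (\<lambda>\<omega>. (lap_tail N (s * v n * (G 0 \<omega>)\<^sup>2))\<^sup>2)) \<longlonglongrightarrow> 0"
proof -
  have "(\<lambda>n. expectation (\<lambda>\<omega>. lap_tail N (s * v n * (G 0 \<omega>)\<^sup>2) / lap_tail N (v n) * lap_tail N (s * v n * (G 0 \<omega>)\<^sup>2)))
    \<longlonglongrightarrow> expectation (\<lambda>\<omega>. s powr p * \<bar>G 0 \<omega>\<bar> powr (2 * p) * 0)"
  proof (rule integral_dominated_convergence[where w="\<lambda>\<omega>. (1 + s * (G 0 \<omega>)\<^sup>2) * 1"])
    show "AE \<omega> in M. norm (lap_tail N (s * v n * (G 0 \<omega>)\<^sup>2) / lap_tail N (v n) * lap_tail N (s * v n * (G 0 \<omega>)\<^sup>2))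
        \<le> (1 + s * (G 0 \<omega>)\<^sup>2) * 1" for n
    proof (rule AE_I2)
      fix \<omega>
      have "0 \<le> s * v n * (G 0 \<omega>)\<^sup>2" using s vpos[of n] by simp
      then have "norm (lap_tail N (s * v n * (G 0 \<omega>)\<^sup>2)) \<le> 1"
        using N.lap_tail_nonneg N.lap_tail_le_1 by simp
      then show "norm (lap_tail N (s * v n * (G 0 \<omega>)\<^sup>2) / lap_tail N (v n) * lap_tail N (s * v n * (G 0 \<omega>)\<^sup>2))
        \<le> (1 + s * (G 0 \<omega>)\<^sup>2) * 1"
        unfolding norm_mult using ratio_bound[of n \<omega>] s by (intro mult_mono) auto
    qed
    show "AE \<omega> in M. (\<lambda>n. lap_tail N (s * v n * (G 0 \<omega>)\<^sup>2) / lap_tail N (v n) * lap_tail N (s * v n * (G 0 \<omega>)\<^sup>2))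
        \<longlonglongrightarrow> s powr p * \<bar>G 0 \<omega>\<bar> powr (2 * p) * 0"
    proof (intro AE_I2 tendsto_mult ratio_tendsto)
      fix \<omega>
      show "(\<lambda>n. lap_tail N (s * v n * (G 0 \<omega>)\<^sup>2)) \<longlonglongrightarrow> 0"
      proof (cases "G 0 \<omega> = 0")
        case False
        then have c: "0 < s * (G 0 \<omega>)\<^sup>2" using s by simp
        have "filterlim (\<lambda>n. s * (G 0 \<omega>)\<^sup>2 * v n) (at_right 0) sequentially"
          by (rule filterlim_compose[OF filterlim_times_pos[OF filterlim_ident c] v]) simp
        from filterlim_compose[OF N.lap_tail_tendsto_0 this] show ?thesis by (simp add: mult_ac)
      qed simp
    qed
  qed (use integrable_square_G in auto)
  from tendsto_mult[OF lim this]
  have "(\<lambda>n. real n * lap_tail N (v n) * expectation (\<lambda>\<omega>. lap_tail N (s * v n * (G 0 \<omega>)\<^sup>2) / lap_tail N (v n) * lap_tail N (s * v n * (G 0 \<omega>)\<^sup>2)))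
    \<longlonglongrightarrow> 0" by simp
  moreover have "real n * lap_tail N (v n) * expectation (\<lambda>\<omega>. lap_tail N (s * v n * (G 0 \<omega>)\<^sup>2) / lap_tail N (v n) * lap_tail N (s * v n * (G 0 \<omega>)\<^sup>2))
    = real n * expectation (\<lambda>\<omega>. (lap_tail N (s * v n * (G 0 \<omega>)\<^sup>2))\<^sup>2)" for n
    using N.lap_tail_pos[OF nz vpos[of n]] by (simp add: power2_eq_square)
  ultimately show ?thesis by simp
qed

text \<open>The distance to the limit has three parts: n E h^2 from replacing factors by
  exponentials, q_n E h from the fluctuation of the exponent, and the error of its mean. As n E h
  converges, the second part vanishes together with q_n / n.\<close>

lemma expectation_prod_tendsto:
  assumes R0: "0 < R 0" and \<zeta>: "\<zeta> < 1" and \<kappa>: "0 \<le> \<kappa>"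
    and bigo: "(\<lambda>n::nat. \<Sum>h\<in>{h. \<bar>h\<bar> < int n}. \<bar>R h\<bar>) \<in> O(\<lambda>n. real n powr \<zeta>)"
  shows "(\<lambda>n. expectation (\<lambda>\<omega>. \<Prod>t=1..int n. 1 - lap_tail N (s * v n * (G t \<omega>)\<^sup>2)))
    \<longlonglongrightarrow> exp (- (\<kappa> * (s powr p * expectation (\<lambda>\<omega>. \<bar>G 0 \<omega>\<bar> powr (2 * p)))))"
proof -
  define h where "h n t \<omega> = lap_tail N (s * v n * (G t \<omega>)\<^sup>2)" for n :: nat and t :: int and \<omega>
  define m where "m = \<kappa> * (s powr p * expectation (\<lambda>\<omega>. \<bar>G 0 \<omega>\<bar> powr (2 * p)))"
  define q where "q n = sqrt (2 * real n * (\<Sum>h\<in>{h. \<bar>h\<bar> < int n}. \<bar>R h\<bar>) / R 0)" for n :: nat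
  have m0: "0 \<le> m" unfolding m_def using \<kappa>
    by (intro mult_nonneg_nonneg Bochner_Integration.integral_nonneg) auto
  have [measurable]: "h n t \<in> borel_measurable M" for n t unfolding h_def by measurable
  have h01: "0 \<le> h n t \<omega>" "h n t \<omega> \<le> 1" for n t \<omega>
    using s vpos[of n] by (auto simp: h_def intro!: N.lap_tail_nonneg N.lap_tail_le_1)
  have ih: "integrable M (h n t)" for n t
    by (rule integrable_const_bound[where B=1]) (use h01 in auto)
  have ih2: "integrable M (\<lambda>\<omega>. (h n t \<omega>)\<^sup>2)" for n t
    by (rule integrable_const_bound[where B=1]) (use h01 in \<open>auto simp: power_le_one\<close>)
  have mean: "(\<lambda>n. real n * expectation (h n 0)) \<longlonglongrightarrow> m"
    using scaled_mean_tendsto unfolding m_def h_def .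
  have second: "(\<lambda>n. real n * expectation (\<lambda>\<omega>. (h n 0 \<omega>)\<^sup>2)) \<longlonglongrightarrow> 0"
    using scaled_second_moment_tendsto unfolding h_def .
  \<comment> \<open>q_n / n is the root of 2 / (n R(0)) times the sum of |R h|, hence O(n^((\<zeta>
    - 1) / 2)).\<close>
  have qlim: "(\<lambda>n. q n / real n) \<longlonglongrightarrow> 0"
  proof -
    obtain c where c: "0 < c" "\<forall>\<^sub>F n in sequentially. norm (\<Sum>h\<in>{h. \<bar>h\<bar> < int n}. \<bar>R h\<bar>) \<le> c * norm (real n powr \<zeta>)"
      using landau_o.bigE[OF bigo] by blast
    have "(\<lambda>n. sqrt (2 * c / R 0 * real n powr (\<zeta> - 1))) \<longlonglongrightarrow> sqrt (2 * c / R 0 * 0)"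
      using \<zeta> by (intro tendsto_intros tendsto_neg_powr filterlim_real_sequentially) auto
    then have lim0: "(\<lambda>n. sqrt (2 * c / R 0 * real n powr (\<zeta> - 1))) \<longlonglongrightarrow> 0" by simp
    show ?thesis
    proof (rule tendsto_sandwich[OF _ _ tendsto_const lim0])
      show "\<forall>\<^sub>F n in sequentially. 0 \<le> q n / real n"
        unfolding q_def using R0 by (intro always_eventually allI divide_nonneg_nonneg real_sqrt_ge_zero mult_nonneg_nonneg sum_nonneg) auto
      show "\<forall>\<^sub>F n in sequentially. q n / real n \<le> sqrt (2 * c / R 0 * real n powr (\<zeta> - 1))"
        using c(2) eventually_gt_at_top[of 0]
      proof eventually_elim
        case (elim n)
        define Q where "Q = (\<Sum>h\<in>{h. \<bar>h\<bar> < int n}. \<bar>R h\<bar>)"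
        have Q: "0 \<le> Q" "Q \<le> c * real n powr \<zeta>" using elim by (auto simp: Q_def sum_nonneg)
        have "q n / real n = sqrt (2 * real n * Q / R 0) / sqrt ((real n)\<^sup>2)" by (simp add: q_def Q_def)
        also have "\<dots> = sqrt (2 * real n * Q / R 0 / (real n)\<^sup>2)" by (rule real_sqrt_divide[symmetric])
        also have "2 * real n * Q / R 0 / (real n)\<^sup>2 = 2 / R 0 * (Q / real n)"
          using elim by (simp add: power2_eq_square)
        also have "sqrt (2 / R 0 * (Q / real n)) \<le> sqrt (2 / R 0 * (c * real n powr \<zeta> / real n))"
          using Q R0 elim by (intro real_sqrt_le_mono mult_left_mono divide_right_mono) auto
        also have "c * real n powr \<zeta> / real n = c * real n powr (\<zeta> - 1)"
          using elim by (simp add: powr_diff)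
        finally show ?case by (simp add: mult_ac)
      qed
    qed
  qed
  have bound: "\<bar>expectation (\<lambda>\<omega>. \<Prod>t=1..int n. 1 - h n t \<omega>) - exp (- m)\<bar>
      \<le> real n * expectation (\<lambda>\<omega>. (h n 0 \<omega>)\<^sup>2) + (q n * expectation (h n 0) + \<bar>real n * expectation (h n 0) - m\<bar>)" for n
  proof -
    define T where "T \<omega> = (\<Sum>t=1..int n. h n t \<omega>)" for \<omega>
    have [measurable]: "T \<in> borel_measurable M" unfolding T_def by measurable
    have iT: "integrable M T" unfolding T_def by (intro Bochner_Integration.integrable_sum ih)
    have ip: "integrable M (\<lambda>\<omega>. \<Prod>t=1..int n. 1 - h n t \<omega>)"
    proof (rule integrable_const_bound[where B=1])
      show "AE \<omega> in M. norm (\<Prod>t=1..int n. 1 - h n t \<omega>) \<le> 1"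
        unfolding abs_prod real_norm_def using h01 by (intro AE_I2 prod_le_1) auto
    qed measurable
    have "\<bar>expectation (\<lambda>\<omega>. \<Prod>t=1..int n. 1 - h n t \<omega>) - exp (- m)\<bar>
        = \<bar>expectation (\<lambda>\<omega>. (\<Prod>t=1..int n. 1 - h n t \<omega>) - exp (- m))\<bar>"
      using ip prob_space by simp
    also have "\<dots> \<le> expectation (\<lambda>\<omega>. \<bar>(\<Prod>t=1..int n. 1 - h n t \<omega>) - exp (- m)\<bar>)"
      by (rule integral_abs_bound)
    also have "\<dots> \<le> expectation (\<lambda>\<omega>. (\<Sum>t=1..int n. (h n t \<omega>)\<^sup>2) + (\<bar>T \<omega> - real n * expectation (h n 0)\<bar> + \<bar>real n * expectation (h n 0) - m\<bar>))"
    proof (rule integral_mono)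
      fix \<omega>
      have "\<bar>(\<Prod>t=1..int n. 1 - h n t \<omega>) - exp (- m)\<bar> \<le> (\<Sum>t=1..int n. (h n t \<omega>)\<^sup>2) + \<bar>T \<omega> - m\<bar>"
        unfolding T_def by (rule abs_prod_one_minus_exp_le) (use h01 m0 in auto)
      then show "\<bar>(\<Prod>t=1..int n. 1 - h n t \<omega>) - exp (- m)\<bar> \<le> (\<Sum>t=1..int n. (h n t \<omega>)\<^sup>2) + (\<bar>T \<omega> - real n * expectation (h n 0)\<bar> + \<bar>real n * expectation (h n 0) - m\<bar>)"
        by linarith
    qed (use ip iT ih2 in auto)
    also have "\<dots> = (\<Sum>t=1..int n. expectation (\<lambda>\<omega>. (h n t \<omega>)\<^sup>2)) + (expectation (\<lambda>\<omega>. \<bar>T \<omega> - real n * expectation (h n 0)\<bar>) + \<bar>real n * expectation (h n 0) - m\<bar>)"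
      using iT ih2 prob_space by simp
    also have "(\<Sum>t=1..int n. expectation (\<lambda>\<omega>. (h n t \<omega>)\<^sup>2)) = real n * expectation (\<lambda>\<omega>. (h n 0 \<omega>)\<^sup>2)"
    proof -
      have "expectation (\<lambda>\<omega>. (h n t \<omega>)\<^sup>2) = expectation (\<lambda>\<omega>. (h n 0 \<omega>)\<^sup>2)" for t
        unfolding h_def by (rule expectation_marginal[of "\<lambda>x. (lap_tail N (s * v n * x\<^sup>2))\<^sup>2"]) measurable
      then have "(\<Sum>t=1..int n. expectation (\<lambda>\<omega>. (h n t \<omega>)\<^sup>2)) = (\<Sum>t=1..int n. expectation (\<lambda>\<omega>. (h n 0 \<omega>)\<^sup>2))"
        by (intro sum.cong refl)
      then show ?thesis by simp
    qed
    also have "expectation (\<lambda>\<omega>. \<bar>T \<omega> - real n * expectation (h n 0)\<bar>) \<le> q n * expectation (h n 0)"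
      unfolding T_def h_def q_def
      by (rule expectation_abs_sum_lap_tail_le[OF N R0]) (use s vpos[of n] in simp)
    finally show ?thesis by simp
  qed
  have qE: "(\<lambda>n. q n * expectation (h n 0)) \<longlonglongrightarrow> 0"
  proof -
    have "(\<lambda>n. q n / real n * (real n * expectation (h n 0))) \<longlonglongrightarrow> 0 * m"
      by (rule tendsto_mult[OF qlim mean])
    \<comment> \<open>At n = 0 the quotient is zero by convention, and q 0 = 0 as well.\<close>
    moreover have "q n / real n * (real n * expectation (h n 0)) = q n * expectation (h n 0)" for n
      by (cases "n = 0") (auto simp: q_def)
    ultimately show ?thesis by simp
  qed
  have "(\<lambda>n. real n * expectation (\<lambda>\<omega>. (h n 0 \<omega>)\<^sup>2) + (q n * expectation (h n 0) + \<bar>real n * expectation (h n 0) - m\<bar>))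
    \<longlonglongrightarrow> 0 + (0 + \<bar>m - m\<bar>)"
    by (intro tendsto_intros second qE mean)
  then have "(\<lambda>n. real n * expectation (\<lambda>\<omega>. (h n 0 \<omega>)\<^sup>2) + (q n * expectation (h n 0) + \<bar>real n * expectation (h n 0) - m\<bar>)) \<longlonglongrightarrow> 0"
    by simp
  then have "(\<lambda>n. expectation (\<lambda>\<omega>. \<Prod>t=1..int n. 1 - h n t \<omega>) - exp (- m)) \<longlonglongrightarrow> 0"
    by (rule Lim_null_comparison[rotated]) (use bound in auto)
  then have "(\<lambda>n. expectation (\<lambda>\<omega>. \<Prod>t=1..int n. 1 - h n t \<omega>)) \<longlonglongrightarrow> exp (- m)"
    by (rule LIM_zero_cancel)
  then show ?thesis unfolding h_def m_def .
qed

end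

end

theorem proposition5p1:
  fixes M :: "'a measure"
    and \<epsilon> G X :: "int \<Rightarrow> 'a \<Rightarrow> real"
    and R :: "int \<Rightarrow> real"
    and f :: "real \<Rightarrow> real"
    and \<alpha> \<zeta> C :: real
  assumes "prob_space M"
    and "0 < \<alpha>" and "\<alpha> < 2" and "0 \<le> \<zeta>" and "\<zeta> < 1"
    and X_def: "\<And>t \<omega>. X t \<omega> = sqrt (\<epsilon> t \<omega>) * G t \<omega>"
    and indep_series: "prob_space.indep_var M
           (PiM UNIV (\<lambda>_. borel)) (\<lambda>\<omega> t. \<epsilon> t \<omega>)
           (PiM UNIV (\<lambda>_. borel)) (\<lambda>\<omega> t. G t \<omega>)"
    and eps_pos: "\<And>t. AE \<omega> in M. 0 < \<epsilon> t \<omega>"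
    and eps_indep: "prob_space.indep_vars M (\<lambda>_. borel) \<epsilon> UNIV"
    and eps_ident: "\<And>t. distr M borel (\<epsilon> t) = distr M borel (\<epsilon> 0)"
    and eps_attr: "\<And>t. in_domain_of_attraction (\<alpha> / 2) (distr M borel (\<epsilon> t))"
    and G_stationary: "stationary_series M G"
    and G_gaussian: "gaussian_series M G"
    and G_mean: "\<And>t. integral\<^sup>L M (G t) = 0"
    and R_def: "\<And>k. R k = covariance M (G 0) (G k)"
    and "0 < C"
    and R_sum: "(\<lambda>n::nat. \<Sum>h\<in>{h. \<bar>h\<bar> < int n}. R h) \<sim>[at_top] (\<lambda>n. C * real n powr \<zeta>)"
    and R_abs_sum: "(\<lambda>n::nat. \<Sum>h\<in>{h. \<bar>h\<bar> < int n}. \<bar>R h\<bar>) \<in> O(\<lambda>n. real n powr \<zeta>)"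
    and f_nonneg: "\<And>x. 0 \<le> f x"
    and f_density: "\<And>t. distributed M lborel (\<epsilon> t) (\<lambda>x. ennreal (f x))"
    and f_bounded: "bounded (range f)"
    and f_monotone_right: "\<exists>z>0. mono_on {z<..} f \<or> antimono_on {z<..} f"
    and f_monotone_left: "\<exists>u<0. mono_on {..<u} f \<or> antimono_on {..<u} f"
  shows "\<exists>(K :: real \<Rightarrow> real) (a :: nat \<Rightarrow> real) (W :: real measure).
           slowly_varying K \<and>
           (\<forall>n. a n = real n powr (1 / \<alpha>) * K (real n)) \<and>
           stable_law (\<alpha> / 2)
             (stable_const (\<alpha> / 2) powr (- (2 / \<alpha>))
                * (integral\<^sup>L M (\<lambda>\<omega>. \<bar>G 0 \<omega>\<bar> powr \<alpha>)) powr (2 / \<alpha>))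
             1 0 W \<and>
           weak_conv_m
             (\<lambda>n. distr M borel (\<lambda>\<omega>. (\<Sum>t=1..int n. (X t \<omega>)\<^sup>2) / (a n)\<^sup>2)) W"
proof -
  interpret prob_space M by fact
  interpret G: stationary_gaussian M G R
    by unfold_locales (fact G_stationary G_gaussian G_mean R_def)+
  define p where "p = \<alpha> / 2"
  have p: "0 < p" "p < 1" using assms(2,3) by (auto simp: p_def)
  have \<alpha>: "\<alpha> = 2 * p" by (simp add: p_def)
  define N where "N = distr M borel (\<epsilon> 0)"
  have law: "distr M borel (\<epsilon> t) = N" for t unfolding N_def by (rule eps_ident)
  have [measurable]: "\<epsilon> t \<in> borel_measurable M" for t using eps_indep by (auto simp: indep_vars_def)
  have dom: "in_domain_of_attraction p N" using eps_attr[of 0] by (simp add: p_def N_def)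
  have N: "real_distribution N" using dom by (simp add: in_domain_of_attraction_def)
  interpret N: real_distribution N by fact
  have posN: "AE x in N. 0 < x" unfolding N_def using eps_pos[of 0] by (subst AE_distr_iff) auto
  have nz: "\<not> (AE x in N. x = 0)"
  proof
    assume "AE x in N. x = 0"
    with posN have "AE x in N. False" by eventually_elim simp
    then show False by (simp add: N.AE_False)
  qed
  have rv: "regularly_varying_0 p (lap_tail N)"
    by (rule regularly_varying_of_domain_of_attraction[OF p dom posN])
  \<comment> \<open>Otherwise all covariances vanish, and the zero sequence is asymptotically
    equivalent only to sequences that are eventually zero.\<close>
  have R0: "0 < R 0"
  proof (rule ccontr)
    assume "\<not> 0 < R 0"
    then have "R k = 0" for k using G.abs_R_le[of k] by linarith
    then have "\<forall>\<^sub>F n in sequentially. C * real n powr \<zeta> = 0" using R_sum by simp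
    moreover have "\<forall>\<^sub>F n in sequentially. 0 < C * real n powr \<zeta>"
      using eventually_gt_at_top[of 0] by eventually_elim (use \<open>0 < C\<close> in simp)
    ultimately have "\<forall>\<^sub>F n::nat in sequentially. False" by eventually_elim linarith
    then show False by simp
  qed
  \<comment> \<open>In classical terms, n h(1 / a_n^2) -> Gamma(1 - p) is the normalization n
    P(\<epsilon> > a_n^2) -> 1; with it the scale takes exactly the required form.\<close>
  define \<kappa> where "\<kappa> = Gamma (1 - p)"
  have \<kappa>: "0 < \<kappa>" using p by (simp add: \<kappa>_def)
  obtain b y0 where b: "mono b" "\<And>y. 0 < b y" "0 < y0"
    "\<And>y. y0 \<le> y \<Longrightarrow> lap_tail N (1 / b y) = \<kappa> / y"
    "filterlim b at_top at_top"
    "\<And>c. 0 < c \<Longrightarrow> ((\<lambda>y. b (c * y) / b y) \<longlongrightarrow> c powr (1 / p)) at_top"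
    by (rule N.asymptotic_inverse_lap_tail[OF nz rv p(1) \<kappa>]) (rule that)
  define v where "v n = 1 / b (real n)" for n :: nat
  have vpos: "0 < v n" for n using b(2) by (simp add: v_def)
  have v: "filterlim v (at_right 0) sequentially"
  proof -
    have "filterlim (\<lambda>n. inverse (b (real n))) (at_right 0) sequentially"
      by (rule filterlim_compose[OF filterlim_inverse_at_right_top
            filterlim_compose[OF b(5) filterlim_real_sequentially]])
    then show ?thesis by (simp add: v_def[abs_def] inverse_eq_divide)
  qed
  have limh: "(\<lambda>n. real n * lap_tail N (v n)) \<longlonglongrightarrow> \<kappa>"
  proof (rule Lim_transform_eventually[OF tendsto_const])
    have "\<forall>\<^sub>F n in sequentially. y0 \<le> real n"
      using filterlim_real_sequentially unfolding filterlim_at_top by blast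
    then show "\<forall>\<^sub>F n in sequentially. \<kappa> = real n * lap_tail N (v n)"
      by eventually_elim (use b(3,4) in \<open>simp add: v_def\<close>)
  qed
  define m where "m = \<kappa> * expectation (\<lambda>\<omega>. \<bar>G 0 \<omega>\<bar> powr \<alpha>)"
  have EG: "0 < expectation (\<lambda>\<omega>. \<bar>G 0 \<omega>\<bar> powr \<alpha>)"
    unfolding \<alpha> by (rule G.expectation_abs_powr_G_pos[OF p R0])
  have m: "0 < m" using \<kappa> EG by (simp add: m_def)
  define K where "K x = sqrt (b x) / x powr (1 / (2 * p))" for x
  define a where "a n = real n powr (1 / \<alpha>) * K (real n)" for n :: nat
  have K: "slowly_varying K"
    unfolding K_def by (rule slowly_varying_sqrt_quotient[OF b(1,2,6) p(1)])
  \<comment> \<open>Restricted to n > 0, since \<open>a 0\<close> is zero while \<open>b\<close> is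
    positive everywhere.\<close>
  have a2: "(a n)\<^sup>2 = b (real n)" if "0 < n" for n
    using that b(2)[of "real n"] by (simp add: a_def K_def \<alpha>)
  define S where "S n \<omega> = (\<Sum>t=1..int n. (X t \<omega>)\<^sup>2) / (a n)\<^sup>2" for n \<omega>
  have [measurable]: "X t \<in> borel_measurable M" for t
    unfolding X_def[abs_def] by measurable
  have [measurable]: "S n \<in> borel_measurable M" for n unfolding S_def by measurable
  have S0: "0 \<le> S n \<omega>" for n \<omega> unfolding S_def by (intro divide_nonneg_nonneg sum_nonneg) auto
  have Y: "real_distribution (distr M borel (S n))" for n
    by (intro real_distribution.intro real_distribution_axioms.intro prob_space_distr) auto
  have lapl: "(\<lambda>n. LINT x|distr M borel (S n). exp (- (s * x))) \<longlonglongrightarrow> exp (- (m * s powr p))" if s: "0 < s" for s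
  proof -
    have "(\<lambda>n. expectation (\<lambda>\<omega>. \<Prod>t=1..int n. 1 - lap_tail N (s * v n * (G t \<omega>)\<^sup>2))) \<longlonglongrightarrow> exp (- (m * s powr p))"
      using G.expectation_prod_tendsto[OF N nz rv p(1) s v vpos limh R0 \<open>\<zeta> < 1\<close> less_imp_le[OF \<kappa>] R_abs_sum]
      by (simp add: m_def \<alpha> mult_ac)
    moreover have "\<forall>\<^sub>F n in sequentially. expectation (\<lambda>\<omega>. \<Prod>t=1..int n. 1 - lap_tail N (s * v n * (G t \<omega>)\<^sup>2))
      = (LINT x|distr M borel (S n). exp (- (s * x)))"
      using eventually_gt_at_top[of 0]
    proof eventually_elim
      case (elim n)
      have "expectation (\<lambda>\<omega>. \<Prod>t=1..int n. 1 - lap_tail N (s * v n * (G t \<omega>)\<^sup>2))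
        = expectation (\<lambda>\<omega>. exp (- (s * v n * (\<Sum>t=1..int n. \<bar>\<epsilon> t \<omega>\<bar> * (G t \<omega>)\<^sup>2))))"
        using s vpos[of n] by (intro conditional_laplace[OF indep_series eps_indep law, symmetric]) auto
      also have "\<dots> = expectation (\<lambda>\<omega>. exp (- (s * S n \<omega>)))"
      proof (rule integral_cong_AE)
        \<comment> \<open>Finitely many \<epsilon> occur, so they are all positive off a single null
          set, and there |\<epsilon>| agrees with \<epsilon>.\<close>
        have "AE \<omega> in M. \<forall>t\<in>{1..int n}. 0 < \<epsilon> t \<omega>" using eps_pos by (intro AE_finite_allI) auto
        then show "AE \<omega> in M. exp (- (s * v n * (\<Sum>t=1..int n. \<bar>\<epsilon> t \<omega>\<bar> * (G t \<omega>)\<^sup>2))) = exp (- (s * S n \<omega>))"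
        proof eventually_elim
          case (elim \<omega>)
          have "(\<Sum>t=1..int n. (X t \<omega>)\<^sup>2) = (\<Sum>t=1..int n. \<bar>\<epsilon> t \<omega>\<bar> * (G t \<omega>)\<^sup>2)"
          proof (rule sum.cong[OF refl])
            fix t assume "t \<in> {1..int n}"
            then have "0 < \<epsilon> t \<omega>" using elim by blast
            then show "(X t \<omega>)\<^sup>2 = \<bar>\<epsilon> t \<omega>\<bar> * (G t \<omega>)\<^sup>2"
              by (simp add: X_def power_mult_distrib)
          qed
          then show ?case using a2[OF \<open>0 < n\<close>] by (simp add: S_def v_def)
        qed
      qed auto
      also have "\<dots> = (LINT x|distr M borel (S n). exp (- (s * x)))" by (subst integral_distr) auto
      finally show ?case .
    qed
    ultimately show ?thesis by (rule Lim_transform_eventually)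
  qed
  have nonneg: "AE x in distr M borel (S n). 0 \<le> x" for n using S0 by (subst AE_distr_iff) auto
  obtain W where W: "stable_law p ((m * cos (pi * p / 2)) powr (1 / p)) 1 0 W"
    "weak_conv_m (\<lambda>n. distr M borel (S n)) W"
    using laplace_continuity_stable[OF Y nonneg p m lapl] .
  have c: "0 < cos (pi * p / 2)" using p by (intro cos_gt_zero) (auto simp: field_simps)
  have "1 - p \<notin> \<int>\<^sub>\<le>\<^sub>0"
  proof
    assume "1 - p \<in> \<int>\<^sub>\<le>\<^sub>0"
    then have "1 - p \<le> 0" by (elim nonpos_Ints_cases) simp
    then show False using p by simp
  qed
  \<comment> \<open>The recurrence turns Gamma(2 - p) / (1 - p) into Gamma(1 - p), so that the
    inverse of C_p is \<kappa> cos(\<pi> p / 2), the \<open>x\<close> below.\<close>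
  then have "Gamma (1 - p + 1) = (1 - p) * Gamma (1 - p)" by (rule Gamma_plus1)
  moreover have "1 - p + 1 = 2 - p" by simp
  ultimately have "Gamma (2 - p) = (1 - p) * \<kappa>" by (simp only: \<kappa>_def)
  then have "Gamma (2 - p) * cos (pi * p / 2) / (1 - p) = \<kappa> * cos (pi * p / 2)"
    using p by simp
  then have C: "stable_const p = inverse (\<kappa> * cos (pi * p / 2))" by (simp only: stable_const_def)
  define x where "x = \<kappa> * cos (pi * p / 2)"
  define y where "y = expectation (\<lambda>\<omega>. \<bar>G 0 \<omega>\<bar> powr \<alpha>)"
  have xy: "0 < x" "0 < y" unfolding x_def y_def by (rule mult_pos_pos[OF \<kappa> c], rule EG)
  have mx: "m * cos (pi * p / 2) = x * y" by (simp only: m_def x_def y_def mult_ac)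
  have "inverse x powr (- (1 / p)) = inverse (inverse (x powr (1 / p)))"
    unfolding powr_minus using inverse_powr[of x "1 / p"] xy by simp
  then have "stable_const p powr (- (1 / p)) * y powr (1 / p) = (x * y) powr (1 / p)"
    unfolding C x_def[symmetric] using xy by (simp only: inverse_inverse_eq powr_mult less_imp_le)
  moreover have "2 / \<alpha> = 1 / p" "\<alpha> / 2 = p" by (simp_all add: \<alpha>)
  ultimately have scale: "(m * cos (pi * p / 2)) powr (1 / p)
    = stable_const (\<alpha> / 2) powr (- (2 / \<alpha>)) * expectation (\<lambda>\<omega>. \<bar>G 0 \<omega>\<bar> powr \<alpha>) powr (2 / \<alpha>)"
    unfolding y_def[symmetric] mx by (simp only:)
  show ?thesis
  proof (intro exI conjI)
    show "slowly_varying K" by (rule K)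
    show "\<forall>n. a n = real n powr (1 / \<alpha>) * K (real n)" by (simp add: a_def)
    show "stable_law (\<alpha> / 2) (stable_const (\<alpha> / 2) powr (- (2 / \<alpha>)) * expectation (\<lambda>\<omega>. \<bar>G 0 \<omega>\<bar> powr \<alpha>) powr (2 / \<alpha>)) 1 0 W"
      using W(1) unfolding scale by (simp add: p_def)
    show "weak_conv_m (\<lambda>n. distr M borel (\<lambda>\<omega>. (\<Sum>t=1..int n. (X t \<omega>)\<^sup>2) / (a n)\<^sup>2)) W"
      using W(2) unfolding S_def[abs_def] .
  qed
qed

end
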